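(* Let the planar steady state be polytropic, $\alpha(E)=(E_0-E)_+^k$ with $\tfrac12<k\le1$, or of King type, $\alpha(E)=(e^{E_0-E}-1)_+$. Then the planar Antonov operator restricted to $\bar H^{odd}$, $\bar{\mathcal A}|_{\bar H^{odd}}:D(\bar{\mathcal D}^2)\cap\bar H^{odd}\to\bar H^{odd}$, possesses an eigenvalue in the principal gap $\big]0,\frac{16\pi^2}{T(E_0)^2}\big[$.
   Context: Plane symmetric setting: $x\in\mathbb R$, $v=(v_1,\bar v)\in\mathbb R\times\mathbb R^2$. Steady state $f_0(x,v)=\varphi(E,\bar v)=\alpha(E)\beta(\bar v)$ with $E=\tfrac12v_1^2+U_0(x)$, where $\beta\ge0$ is continuous with compact support and $\int\beta=1$ ($t_+^k=t^k$ for $t>0$, else $0$), $\rho_0(x)=\int f_0(x,v)dv$, $U_0(x)=2\pi\int|x-y|\rho_0(y)dy$; $U_0,\rho_0$ even, $\mathrm{supp}\,\rho_0=[-R_0,R_0]$, $U_0$ convex and strictly increasing on $[0,\infty[$, $E_0=U_0(R_0)$. For $E>U_0(0)$ let $x_\pm(E)$ solve $U_0(x)=E$ and $T(E)=2\int_{x_-(E)}^{x_+(E)}\frac{dx}{\sqrt{2E-2U_0(x)}}$. Let $\bar\Omega_0=\{f_0>0\}$, $\varphi'=\partial_E\varphi=\alpha'(E)\beta(\bar v)$. $\bar H$ is the Hilbert space of measurable $g:\bar\Omega_0\to\mathbb R$ with $\|g\|_{\bar H}^2=\int_{\bar\Omega_0}|\varphi'(E,\bar v)|^{-1}|g|^2d(x,v)<\infty$;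 $\bar H^{odd}=\{g\in\bar H:g(x,v)=-g(-x,v)=-g(x,-v_1,\bar v)$ a.e.$\}$. For $g\in L^1_{loc}(\bar\Omega_0)$, $\bar{\mathcal D}g=\mu$ weakly if $\mu\in L^1_{loc}$ and $\int|\varphi'|^{-1}g\,\bar{\mathcal D}\xi=-\int|\varphi'|^{-1}\mu\xi$ for all $\xi\in C^1_c(\bar\Omega_0)$, where $\bar{\mathcal D}\xi=v_1\partial_x\xi-U_0'(x)\partial_{v_1}\xi$. $D(\bar{\mathcal D})=\{g\in\bar H:\bar{\mathcal D}g$ exists weakly and lies in $\bar H\}$, $D(\bar{\mathcal D}^2)=\{g\in D(\bar{\mathcal D}):\bar{\mathcal D}g\in D(\bar{\mathcal D})\}$. $\bar{\mathcal J}(g)(x)=\int v_1g(x,v)dv$, $(\bar{\mathcal B}g)(x,v)=4\pi|\varphi'(E,\bar v)|v_1\bar{\mathcal J}(g)(x)$, $\bar{\mathcal A}=-\bar{\mathcal D}^2-\bar{\mathcal B}$. *)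

theory Defs
  imports "HOL-Analysis.Analysis"
begin

text \<open>Phase space points z = (x, v1, vbar) with x, v1 real and vbar in R^2.\<close>
type_synonym ph = "real \<times> real \<times> (real \<times> real)"

definition energy :: "(real \<Rightarrow> real) \<Rightarrow> ph \<Rightarrow> real" where
  "energy U0 z = (case z of (x, v1, vb) \<Rightarrow> v1^2 / 2 + U0 x)"

definition fzero :: "(real \<Rightarrow> real) \<Rightarrow> (real \<times> real \<Rightarrow> real) \<Rightarrow> (real \<Rightarrow> real) \<Rightarrow> ph \<Rightarrow> real" where
  "fzero \<alpha> \<beta> U0 z = (case z of (x, v1, vb) \<Rightarrow> \<alpha> (energy U0 z) * \<beta> vb)"

definition phid :: "(real \<Rightarrow> real) \<Rightarrow> (real \<times> real \<Rightarrow> real) \<Rightarrow> (real \<Rightarrow> real) \<Rightarrow> ph \<Rightarrow> real" where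
  "phid \<alpha> \<beta> U0 z = (case z of (x, v1, vb) \<Rightarrow> deriv \<alpha> (energy U0 z) * \<beta> vb)"

definition Omega0 :: "(real \<Rightarrow> real) \<Rightarrow> (real \<times> real \<Rightarrow> real) \<Rightarrow> (real \<Rightarrow> real) \<Rightarrow> ph set" where
  "Omega0 \<alpha> \<beta> U0 = {z. fzero \<alpha> \<beta> U0 z > 0}"

text \<open>The weighted space Hbar (functions on Omega0; values outside Omega0 are irrelevant).\<close>
definition Hbar :: "(real \<Rightarrow> real) \<Rightarrow> (real \<times> real \<Rightarrow> real) \<Rightarrow> (real \<Rightarrow> real) \<Rightarrow> (ph \<Rightarrow> real) set" where
  "Hbar \<alpha> \<beta> U0 = {g. set_borel_measurable lborel (Omega0 \<alpha> \<beta> U0) g \<and>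
      set_integrable lborel (Omega0 \<alpha> \<beta> U0) (\<lambda>z. (g z)^2 / \<bar>phid \<alpha> \<beta> U0 z\<bar>)}"

definition Hbar_odd :: "(real \<Rightarrow> real) \<Rightarrow> (real \<times> real \<Rightarrow> real) \<Rightarrow> (real \<Rightarrow> real) \<Rightarrow> (ph \<Rightarrow> real) set" where
  "Hbar_odd \<alpha> \<beta> U0 = {g \<in> Hbar \<alpha> \<beta> U0. AE z in lborel. z \<in> Omega0 \<alpha> \<beta> U0 \<longrightarrow>
      (case z of (x, v1, vb) \<Rightarrow> g (x, v1, vb) = - g (-x, v1, vb) \<and> g (x, v1, vb) = - g (x, -v1, vb))}"

definition C1c :: "ph set \<Rightarrow> (ph \<Rightarrow> real) \<Rightarrow> bool" where
  "C1c \<Omega> \<xi> \<longleftrightarrow> (\<exists>D' :: ph \<Rightarrow> (ph \<Rightarrow>\<^sub>L real).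
        (\<forall>z. (\<xi> has_derivative blinfun_apply (D' z)) (at z)) \<and> continuous_on UNIV D') \<and>
      compact (closure {z. \<xi> z \<noteq> 0}) \<and> closure {z. \<xi> z \<noteq> 0} \<subseteq> \<Omega>"

definition Dtrans :: "(real \<Rightarrow> real) \<Rightarrow> (ph \<Rightarrow> real) \<Rightarrow> ph \<Rightarrow> real" where
  "Dtrans U0 \<xi> z = (case z of (x, v1, vb) \<Rightarrow>
      v1 * frechet_derivative \<xi> (at z) (1, 0, (0, 0))
      - deriv U0 x * frechet_derivative \<xi> (at z) (0, 1, (0, 0)))"

definition L1loc :: "ph set \<Rightarrow> (ph \<Rightarrow> real) \<Rightarrow> bool" where
  "L1loc \<Omega> g \<longleftrightarrow> (\<forall>K. compact K \<and> K \<subseteq> \<Omega> \<longrightarrow> set_integrable lborel K g)"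

definition weakD :: "(real \<Rightarrow> real) \<Rightarrow> (real \<times> real \<Rightarrow> real) \<Rightarrow> (real \<Rightarrow> real) \<Rightarrow> (ph \<Rightarrow> real) \<Rightarrow> (ph \<Rightarrow> real) \<Rightarrow> bool" where
  "weakD \<alpha> \<beta> U0 g \<mu> \<longleftrightarrow> L1loc (Omega0 \<alpha> \<beta> U0) g \<and> L1loc (Omega0 \<alpha> \<beta> U0) \<mu> \<and>
     (\<forall>\<xi>. C1c (Omega0 \<alpha> \<beta> U0) \<xi> \<longrightarrow>
        (LINT z:Omega0 \<alpha> \<beta> U0|lborel. g z * Dtrans U0 \<xi> z / \<bar>phid \<alpha> \<beta> U0 z\<bar>)
        = - (LINT z:Omega0 \<alpha> \<beta> U0|lborel. \<mu> z * \<xi> z / \<bar>phid \<alpha> \<beta> U0 z\<bar>))"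

definition Jbar :: "(real \<Rightarrow> real) \<Rightarrow> (real \<times> real \<Rightarrow> real) \<Rightarrow> (real \<Rightarrow> real) \<Rightarrow> (ph \<Rightarrow> real) \<Rightarrow> real \<Rightarrow> real" where
  "Jbar \<alpha> \<beta> U0 g x = (LINT v|lborel. indicator (Omega0 \<alpha> \<beta> U0) (x, v) * fst v * g (x, v))"

definition Bbar :: "(real \<Rightarrow> real) \<Rightarrow> (real \<times> real \<Rightarrow> real) \<Rightarrow> (real \<Rightarrow> real) \<Rightarrow> (ph \<Rightarrow> real) \<Rightarrow> ph \<Rightarrow> real" where
  "Bbar \<alpha> \<beta> U0 g z = (case z of (x, v1, vb) \<Rightarrow>
      4 * pi * \<bar>phid \<alpha> \<beta> U0 z\<bar> * v1 * Jbar \<alpha> \<beta> U0 g x)"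

definition xplus :: "(real \<Rightarrow> real) \<Rightarrow> real \<Rightarrow> real" where
  "xplus U0 E = (THE x. 0 \<le> x \<and> U0 x = E)"

definition xminus :: "(real \<Rightarrow> real) \<Rightarrow> real \<Rightarrow> real" where
  "xminus U0 E = (THE x. x \<le> 0 \<and> U0 x = E)"

definition Tper :: "(real \<Rightarrow> real) \<Rightarrow> real \<Rightarrow> real" where
  "Tper U0 E = 2 * (LBINT x=xminus U0 E..xplus U0 E. 1 / sqrt (2 * E - 2 * U0 x))"

end

theory Submission
  imports Defs "HOL-Complex_Analysis.Great_Picard"
begin

text \<open>
  On an orbit with turning point \<open>a\<close> the transport operator is the time derivative, and a function
  that is odd in \<open>x\<close> and in \<open>v\<^sub>1\<close> is determined by its values on a quarter of the orbit, with Dirichlet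
  conditions at both ends. The quarter lasts \<open>T / 4\<close>, so for \<open>\<lambda> < 16 \<pi>\<^sup>2 / T\<^sup>2\<close> the equation
  \<open>- D\<^sup>2 h - \<lambda> h = v\<^sub>1 F(x)\<close> is solved by a nonnegative Green function. Since \<open>B g\<close> depends on \<open>g\<close> only
  through \<open>F = 4 \<pi> J(g)\<close>, an eigenfunction with eigenvalue \<open>\<lambda> = c\<^sup>2\<close> amounts to a fixed point of an
  integral operator \<open>K\<^sub>c\<close> on \<open>[0, R\<^sub>0]\<close> with a continuous, symmetric, nonnegative kernel
  (a Birman-Schwinger principle). The form of \<open>K\<^sub>0\<close> is dominated by the identity because \<open>\<rho>\<^sub>0\<close> is a
  strict supersolution, \<open>K\<^sub>0 \<rho>\<^sub>0 < \<rho>\<^sub>0\<close>; and the form of \<open>K\<^sub>c\<close> exceeds it as \<open>c\<close> tends to the edge of the gap,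
  because \<open>\<bar>\<alpha>'\<bar>\<close> stays away from 0 at \<open>E\<^sub>0\<close> and the period is Lipschitz there. At the largest \<open>c\<close>
  for which the form is still dominated by the identity there is a fixed point.
\<close>

section \<open>Nonnegative kernels depending on a parameter\<close>

text \<open>On an orbit the factor v1 of the right-hand side is absorbed by v1 dt = dy, so each
  orbit contributes its Green function integrated dy; that is why the kernel on
  \<open>[0, R]\<close> comes out symmetric. The parameter therefore stays in \<open>[0, b]\<close>
  with \<open>b * quarter R < pi\<close>, where the kernels are jointly continuous, and
  \<open>b\<close> is taken so close to the edge that the form already exceeds the identity. The
  supersolution comes from translation invariance: D v1 = - U'(x), hence - D^2 v1 = 4 pi \<rho> v1,
  and v1 would be the orbit solution for F = 4 pi \<rho> if it vanished at x = 0. It is positive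
  there, and this surplus makes the inequality strict and excludes the eigenvalue 0. Compactness
  comes from Arzela-Ascoli for continuous functions in place of an L^2 theory. A derivative
  \<alpha>' that is unbounded at the boundary energy, as for k < 1, does no harm: it enters through
  a weight in the turning point that has finite mass.\<close>

definition kop :: "real \<Rightarrow> (real \<Rightarrow> real \<Rightarrow> real) \<Rightarrow> (real \<Rightarrow> real) \<Rightarrow> real \<Rightarrow> real" where
  "kop R k F x = integral {0..R} (\<lambda>y. k x y * F y)"

definition ip :: "real \<Rightarrow> (real \<Rightarrow> real) \<Rightarrow> (real \<Rightarrow> real) \<Rightarrow> real" where
  "ip R F G = integral {0..R} (\<lambda>x. F x * G x)"

text \<open>Cauchy-Schwarz against the constant 1, read off from the nonnegative variance of |F|
  about its mean \<open>m\<close>. It converts the normalization \<open>ip R F F = 1\<close> into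
  the L^1 bound that controls the integral operators.\<close>

lemma square_integral_abs_le:
  fixes F :: "real \<Rightarrow> real"
  assumes R: "0 < R" and F: "continuous_on {0..R} F"
  shows "(integral {0..R} (\<lambda>x. \<bar>F x\<bar>))\<^sup>2 \<le> R * ip R F F"
proof -
  obtain m where m: "integral {0..R} (\<lambda>x. \<bar>F x\<bar>) = m * R"
    using R by (metis nonzero_eq_divide_eq order_less_irrefl)
  have i1: "(\<lambda>x. F x * F x) integrable_on {0..R}" "(\<lambda>x. \<bar>F x\<bar>) integrable_on {0..R}"
    by (intro integrable_continuous_interval continuous_intros F)+
  have "0 \<le> integral {0..R} (\<lambda>x. (\<bar>F x\<bar> - m)\<^sup>2)"
    by (rule integral_nonneg) (auto intro!: integrable_continuous_interval continuous_intros F)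
  also have "(\<lambda>x. (\<bar>F x\<bar> - m)\<^sup>2) = (\<lambda>x. F x * F x - 2 * m * \<bar>F x\<bar> + m\<^sup>2)"
    by (auto simp: power2_eq_square algebra_simps)
  also have "integral {0..R} (\<lambda>x. F x * F x - 2 * m * \<bar>F x\<bar> + m\<^sup>2) =
      ip R F F - 2 * m * (m * R) + m\<^sup>2 * R"
  proof -
    have "((\<lambda>x. F x * F x - 2 * m * \<bar>F x\<bar> + m\<^sup>2) has_integral ip R F F - 2 * m * (m * R) + m\<^sup>2 * R) {0..R}"
      using i1 R has_integral_const_real[of "m\<^sup>2" 0 R]
      by (intro has_integral_add has_integral_diff has_integral_mult_right)
        (auto simp: ip_def has_integral_iff m mult.commute)
    then show ?thesis by (rule integral_unique)
  qed
  finally have "m * m * R \<le> ip R F F" by (simp add: power2_eq_square algebra_simps)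
  then have "R * (m * m * R) \<le> R * ip R F F" using R by simp
  moreover have "R * (m * m * R) = (integral {0..R} (\<lambda>x. \<bar>F x\<bar>))\<^sup>2"
    by (simp add: m power2_eq_square)
  ultimately show ?thesis by simp
qed

section \<open>Continuous kernels on [0, R]\<close>

context
  fixes R :: real and k :: "real \<Rightarrow> real \<Rightarrow> real"
  assumes R: "0 < R"
    and k: "continuous_on ({0..R} \<times> {0..R}) (\<lambda>(x, y). k x y)"
begin

lemma kernel_section:
  assumes x: "x \<in> {0..R}" shows "continuous_on {0..R} (k x)"
proof -
  have "continuous_on {0..R} (\<lambda>y. (\<lambda>(x, y). k x y) (x, y))"
    by (rule continuous_on_compose2[OF k]) (use x in \<open>auto intro!: continuous_intros\<close>)
  then show ?thesis by simp
qed

lemma kernel_times: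
  assumes F: "continuous_on {0..R} F" and H: "continuous_on {0..R} H"
  shows "continuous_on ({0..R} \<times> {0..R}) (\<lambda>(x, y). H x * (k x y * F y))"
proof -
  have "continuous_on ({0..R} \<times> {0..R}) (\<lambda>z. H (fst z) * ((\<lambda>(x, y). k x y) z * F (snd z)))"
    by (intro continuous_intros k continuous_on_compose2[OF F] continuous_on_compose2[OF H]) auto
  then show ?thesis by (simp add: case_prod_beta)
qed

lemma kop_continuous:
  assumes F: "continuous_on {0..R} F"
  shows "continuous_on {0..R} (kop R k F)"
  using integral_continuous_on_param[of "{0..R}" 0 R "\<lambda>x y. k x y * F y"]
    kernel_times[OF F, of "\<lambda>_. 1"] by (simp add: kop_def[abs_def])

lemma kop_integrable:
  assumes "continuous_on {0..R} F" "x \<in> {0..R}"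
  shows "(\<lambda>y. k x y * F y) integrable_on {0..R}"
  by (intro integrable_continuous_interval continuous_intros kernel_section assms)

lemma kop_add:
  assumes "continuous_on {0..R} F" "continuous_on {0..R} H" "x \<in> {0..R}"
  shows "kop R k (\<lambda>y. F y + c * H y) x = kop R k F x + c * kop R k H x"
proof -
  have "kop R k (\<lambda>y. F y + c * H y) x = integral {0..R} (\<lambda>y. k x y * F y + c * (k x y * H y))"
    by (simp add: kop_def algebra_simps)
  also have "\<dots> = kop R k F x + c * kop R k H x"
    unfolding kop_def using kop_integrable[OF assms(1,3)] kop_integrable[OF assms(2,3)]
    by (simp add: integral_add integrable_on_mult_right)
  finally show ?thesis .
qed

lemma kop_bound:
  assumes F: "continuous_on {0..R} F" and x: "x \<in> {0..R}"
    and M: "\<And>y. y \<in> {0..R} \<Longrightarrow> \<bar>k x y\<bar> \<le> M"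
  shows "\<bar>kop R k F x\<bar> \<le> M * integral {0..R} (\<lambda>y. \<bar>F y\<bar>)"
proof -
  have "\<bar>kop R k F x\<bar> \<le> integral {0..R} (\<lambda>y. M * \<bar>F y\<bar>)"
    unfolding kop_def real_norm_def[symmetric]
    by (rule integral_norm_bound_integral)
      (auto intro!: kernel_section[OF x] F integrable_continuous_interval continuous_intros mult_right_mono M
        simp: abs_mult)
  then show ?thesis by simp
qed

lemma kop_adjoint:
  assumes sym: "\<And>x y. x \<in> {0..R} \<Longrightarrow> y \<in> {0..R} \<Longrightarrow> k x y = k y x"
    and F: "continuous_on {0..R} F" and H: "continuous_on {0..R} H"
  shows "ip R H (kop R k F) = ip R (kop R k H) F"
proof -
  have "ip R H (kop R k F) = integral {0..R} (\<lambda>x. integral {0..R} (\<lambda>y. H x * (k x y * F y)))"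
    by (simp add: ip_def kop_def)
  also have "\<dots> = integral {0..R} (\<lambda>y. integral {0..R} (\<lambda>x. H x * (k x y * F y)))"
    using integral_swap_continuous[of 0 0 R R "\<lambda>x y. H x * (k x y * F y)"] kernel_times[OF F H]
    by (simp add: cbox_Pair_eq)
  also have "\<dots> = integral {0..R} (\<lambda>y. kop R k H y * F y)"
  proof (rule integral_cong)
    fix y assume y: "y \<in> {0..R}"
    have "integral {0..R} (\<lambda>x. H x * (k x y * F y)) = integral {0..R} (\<lambda>x. (k y x * H x) * F y)"
      by (rule integral_cong) (use sym y in \<open>auto simp: algebra_simps\<close>)
    then show "integral {0..R} (\<lambda>x. H x * (k x y * F y)) = kop R k H y * F y"
      by (simp add: kop_def)
  qed
  finally show ?thesis by (simp add: ip_def)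
qed

end

section \<open>The inner product and the forms of two kernels\<close>

lemma ip_commute: "ip R F H = ip R H F"
  by (simp add: ip_def mult.commute)

lemma ip_add_self:
  assumes "continuous_on {0..R} F" "continuous_on {0..R} H"
  shows "ip R (\<lambda>x. F x + c * H x) (\<lambda>x. F x + c * H x) = ip R F F + 2 * c * ip R F H + c\<^sup>2 * ip R H H"
proof -
  have i: "(\<lambda>x. F x * F x) integrable_on {0..R}" "(\<lambda>x. F x * H x) integrable_on {0..R}"
     "(\<lambda>x. H x * H x) integrable_on {0..R}"
    by (intro integrable_continuous_interval continuous_intros assms)+
  have "ip R (\<lambda>x. F x + c * H x) (\<lambda>x. F x + c * H x)
     = integral {0..R} (\<lambda>x. F x * F x + (2 * c) * (F x * H x) + c\<^sup>2 * (H x * H x))"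
    unfolding ip_def by (rule integral_cong) (simp add: algebra_simps power2_eq_square)
  then show ?thesis using i by (simp add: integral_add integrable_add integrable_on_mult_right ip_def)
qed

lemma ip_add_right:
  assumes "continuous_on {0..R} F" "continuous_on {0..R} G" "continuous_on {0..R} H"
  shows "ip R F (\<lambda>x. G x + c * H x) = ip R F G + c * ip R F H"
proof -
  have i: "(\<lambda>x. F x * G x) integrable_on {0..R}" "(\<lambda>x. F x * H x) integrable_on {0..R}"
    by (intro integrable_continuous_interval continuous_intros assms)+
  have "ip R F (\<lambda>x. G x + c * H x) = integral {0..R} (\<lambda>x. F x * G x + c * (F x * H x))"
    unfolding ip_def by (simp add: algebra_simps)
  then show ?thesis using i by (simp add: integral_add integrable_on_mult_right ip_def)
qed

lemma ip_self_nonneg: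
  assumes "continuous_on {0..R} F" shows "0 \<le> ip R F F"
  unfolding ip_def
  by (rule integral_nonneg) (auto intro!: integrable_continuous_interval continuous_intros assms)

lemma abs_ip_le:
  assumes "continuous_on {0..R} F" "continuous_on {0..R} G" "\<And>x. x \<in> {0..R} \<Longrightarrow> \<bar>G x\<bar> \<le> M"
  shows "\<bar>ip R G F\<bar> \<le> M * integral {0..R} (\<lambda>x. \<bar>F x\<bar>)"
proof -
  have "\<bar>ip R G F\<bar> \<le> integral {0..R} (\<lambda>y. M * \<bar>F y\<bar>)"
    unfolding ip_def real_norm_def[symmetric]
    by (rule integral_norm_bound_integral)
      (auto intro!: integrable_continuous_interval continuous_intros mult_right_mono assms simp: abs_mult)
  then show ?thesis by simp
qed

text \<open>Continuity of the form with respect to the supremum norm of the kernel, at the price of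
  the squared L^1 norm of \<open>F\<close>. Through it, closeness of parameters is passed on to the
  forms.\<close>

lemma form_difference:
  assumes R: "0 < R" and k: "continuous_on ({0..R} \<times> {0..R}) (\<lambda>(x, y). k x y)"
    and l: "continuous_on ({0..R} \<times> {0..R}) (\<lambda>(x, y). l x y)"
    and F: "continuous_on {0..R} F"
    and e: "\<And>x y. x \<in> {0..R} \<Longrightarrow> y \<in> {0..R} \<Longrightarrow> \<bar>k x y - l x y\<bar> \<le> e"
  shows "\<bar>ip R F (kop R k F) - ip R F (kop R l F)\<bar> \<le> e * (integral {0..R} (\<lambda>x. \<bar>F x\<bar>))\<^sup>2"
proof -
  let ?m = "\<lambda>x y. k x y - l x y"
  have m: "continuous_on ({0..R} \<times> {0..R}) (\<lambda>(x, y). ?m x y)"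
    using continuous_on_diff[OF k l] by (simp add: case_prod_beta)
  note ck = kop_continuous[OF R k F] and cl = kop_continuous[OF R l F] and cm = kop_continuous[OF R m F]
  have eq: "kop R ?m F x = kop R k F x + (-1) * kop R l F x" if "x \<in> {0..R}" for x
    unfolding kop_def using kop_integrable[OF R k F that] kop_integrable[OF R l F that]
    by (simp add: left_diff_distrib integral_diff)
  have "ip R F (kop R ?m F) = ip R F (\<lambda>x. kop R k F x + (-1) * kop R l F x)"
    unfolding ip_def by (rule integral_cong) (simp only: eq)
  then have "ip R F (kop R k F) - ip R F (kop R l F) = ip R (kop R ?m F) F"
    using ip_add_right[OF F ck cl, of "-1"] by (simp add: ip_commute)
  also have "\<bar>\<dots>\<bar> \<le> (e * integral {0..R} (\<lambda>x. \<bar>F x\<bar>)) * integral {0..R} (\<lambda>x. \<bar>F x\<bar>)"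
    by (rule abs_ip_le[OF F cm]) (intro kop_bound[OF R m F] e)
  finally show ?thesis by (simp add: power2_eq_square mult.assoc)
qed

text \<open>For a nonnegative kernel an upper bound on the form is also a lower bound, since
  \<open>\<bar>F\<bar>\<close> competes with \<open>F\<close>; polarization then bounds the operator.\<close>
lemma almost_eigenfunction:
  assumes R: "0 < R" and k: "continuous_on ({0..R} \<times> {0..R}) (\<lambda>(x, y). k x y)"
    and sym: "\<And>x y. x \<in> {0..R} \<Longrightarrow> y \<in> {0..R} \<Longrightarrow> k x y = k y x"
    and nonneg: "\<And>x y. x \<in> {0..R} \<Longrightarrow> y \<in> {0..R} \<Longrightarrow> 0 \<le> k x y"
    and le: "\<And>F. continuous_on {0..R} F \<Longrightarrow> ip R F (kop R k F) \<le> ip R F F"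
    and F: "continuous_on {0..R} F"
  shows "ip R (\<lambda>x. F x + (-1) * kop R k F x) (\<lambda>x. F x + (-1) * kop R k F x)
     \<le> 2 * (ip R F F - ip R F (kop R k F))"
proof -
  have lower: "- ip R H H \<le> ip R H (kop R k H)" if H: "continuous_on {0..R} H" for H
  proof -
    have aH: "continuous_on {0..R} (\<lambda>x. \<bar>H x\<bar>)" by (intro continuous_intros H)
    have "\<bar>kop R k H x\<bar> \<le> kop R k (\<lambda>x. \<bar>H x\<bar>) x" if x: "x \<in> {0..R}" for x
      unfolding kop_def real_norm_def[symmetric]
      by (rule integral_norm_bound_integral)
        (use kop_integrable[OF R k H x] kop_integrable[OF R k aH x] nonneg x in \<open>auto simp: abs_mult\<close>)
    then have "\<bar>ip R H (kop R k H)\<bar> \<le> ip R (\<lambda>x. \<bar>H x\<bar>) (kop R k (\<lambda>x. \<bar>H x\<bar>))"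
      unfolding ip_def real_norm_def[symmetric]
      by (intro integral_norm_bound_integral)
        (auto intro!: integrable_continuous_interval continuous_intros H kop_continuous[OF R k H]
          kop_continuous[OF R k aH] mult_left_mono simp: abs_mult)
    also have "\<dots> \<le> ip R (\<lambda>x. \<bar>H x\<bar>) (\<lambda>x. \<bar>H x\<bar>)" by (rule le[OF aH])
    also have "\<dots> = ip R H H" by (simp add: ip_def)
    finally show ?thesis by auto
  qed
  let ?K = "kop R k F"
  have K: "continuous_on {0..R} ?K" by (rule kop_continuous[OF R k F])
  have KK: "continuous_on {0..R} (kop R k ?K)" by (rule kop_continuous[OF R k K])
  have form: "ip R (\<lambda>x. F x + c * ?K x) (kop R k (\<lambda>x. F x + c * ?K x)) =
     ip R F ?K + 2 * c * ip R ?K ?K + c\<^sup>2 * ip R ?K (kop R k ?K)" for c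
  proof -
    have "ip R (\<lambda>x. F x + c * ?K x) (kop R k (\<lambda>x. F x + c * ?K x)) =
       ip R (\<lambda>x. F x + c * ?K x) (\<lambda>x. ?K x + c * kop R k ?K x)"
      unfolding ip_def by (rule integral_cong) (simp only: kop_add[OF R k F K])
    also have "\<dots> = ip R (\<lambda>x. F x + c * ?K x) ?K + c * ip R (\<lambda>x. F x + c * ?K x) (kop R k ?K)"
      by (intro ip_add_right continuous_intros F K KK)
    also have "ip R (\<lambda>x. F x + c * ?K x) ?K = ip R ?K F + c * ip R ?K ?K"
      using ip_add_right[OF K F K] by (simp add: ip_commute)
    also have "ip R (\<lambda>x. F x + c * ?K x) (kop R k ?K) = ip R (kop R k ?K) F + c * ip R (kop R k ?K) ?K"
      using ip_add_right[OF KK F K] by (simp add: ip_commute)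
    also have "ip R (kop R k ?K) F = ip R ?K ?K"
      using kop_adjoint[OF R k sym F K] by simp
    finally show ?thesis by (simp add: ip_commute power2_eq_square algebra_simps)
  qed
  \<comment> \<open>The upper bound is tested with F + KF, the lower one with F - KF. On
    subtracting, the terms <F, KF> and <KF, KKF> cancel and 4 |KF|^2 \<le> 2 |F|^2 + 2 |KF|^2
    remains.\<close>
  have "ip R F ?K + 2 * ip R ?K ?K + ip R ?K (kop R k ?K) \<le> ip R F F + 2 * ip R F ?K + ip R ?K ?K"
    using le[of "\<lambda>x. F x + 1 * ?K x"] F K form[of 1] ip_add_self[OF F K, of 1]
    by (auto intro!: continuous_intros)
  moreover have "- (ip R F F - 2 * ip R F ?K + ip R ?K ?K) \<le> ip R F ?K - 2 * ip R ?K ?K + ip R ?K (kop R k ?K)"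
    using lower[of "\<lambda>x. F x + (-1) * ?K x"] F K form[of "-1"] ip_add_self[OF F K, of "-1"]
    by (auto intro!: continuous_intros)
  ultimately have "ip R ?K ?K \<le> ip R F F" by linarith
  then show ?thesis using ip_add_self[OF F K, of "-1"] by simp
qed


text \<open>A maximizing sequence need not converge, but its images do along a subsequence: the
  kernel is uniformly continuous and the L^1 norms are at most sqrt R, so Arzela-Ascoli applies to
  \<open>K n\<close>. As F_n - K F_n tends to 0 in L^1, the limit of the images is a fixed
  point.\<close>

lemma eigenfunction_of_maximizing:
  assumes R: "0 < R" and k: "continuous_on ({0..R} \<times> {0..R}) (\<lambda>(x, y). k x y)"
    and sym: "\<And>x y. x \<in> {0..R} \<Longrightarrow> y \<in> {0..R} \<Longrightarrow> k x y = k y x"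
    and nonneg: "\<And>x y. x \<in> {0..R} \<Longrightarrow> y \<in> {0..R} \<Longrightarrow> 0 \<le> k x y"
    and le: "\<And>F. continuous_on {0..R} F \<Longrightarrow> ip R F (kop R k F) \<le> ip R F F"
    and max: "\<And>e. 0 < e \<Longrightarrow> \<exists>F. continuous_on {0..R} F \<and> ip R F F = 1 \<and> 1 - e < ip R F (kop R k F)"
  shows "\<exists>G. continuous_on {0..R} G \<and> (\<exists>x\<in>{0..R}. G x \<noteq> 0) \<and> (\<forall>x\<in>{0..R}. kop R k G x = G x)"
proof -
  have "\<forall>n. \<exists>F. continuous_on {0..R} F \<and> ip R F F = 1 \<and> 1 - 1 / real (Suc n) < ip R F (kop R k F)"
    by (intro allI max) simp
  then obtain F where F: "\<And>n. continuous_on {0..R} (F n)" and F1: "\<And>n. ip R (F n) (F n) = 1"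
    and Fe: "\<And>n. 1 - 1 / real (Suc n) < ip R (F n) (kop R k (F n))" by metis
  define K where "K n = kop R k (F n)" for n
  have K: "continuous_on {0..R} (K n)" for n unfolding K_def by (rule kop_continuous[OF R k F])
  have intF: "integral {0..R} (\<lambda>x. \<bar>F n x\<bar>) \<le> sqrt R" for n
    using square_integral_abs_le[OF R F] F1 by (intro real_le_rsqrt) simp
  have compact: "compact ({0..R} \<times> {0..R})" by (intro compact_Times) auto
  have "bounded ((\<lambda>(x, y). k x y) ` ({0..R} \<times> {0..R}))"
    by (rule compact_imp_bounded[OF compact_continuous_image[OF k compact]])
  then obtain M where M0: "0 < M" and M: "\<And>x y. x \<in> {0..R} \<Longrightarrow> y \<in> {0..R} \<Longrightarrow> \<bar>k x y\<bar> \<le> M"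
    unfolding bounded_pos by auto
  have KM: "norm (K n x) \<le> M * sqrt R" if "x \<in> {0..R}" for n x
    using order_trans[OF kop_bound[OF R k F that M[OF that]] mult_left_mono[OF intF]] M0
    by (simp add: K_def)
  have unif: "uniformly_continuous_on ({0..R} \<times> {0..R}) (\<lambda>(x, y). k x y)"
    by (rule compact_uniformly_continuous[OF k compact])
  have equi: "\<exists>d. 0 < d \<and> (\<forall>n y. y \<in> {0..R} \<and> norm (x - y) < d \<longrightarrow> norm (K n x - K n y) < e)"
    if x: "x \<in> {0..R}" and e: "0 < e" for x e
  proof -
    define e' where "e' = e / (2 * (sqrt R + 1))"
    have e': "0 < e'" using e R by (auto simp: e'_def intro!: divide_pos_pos add_nonneg_pos)
    obtain d where d: "0 < d" and d': "\<And>z z'. z \<in> {0..R} \<times> {0..R} \<Longrightarrow> z' \<in> {0..R} \<times> {0..R} \<Longrightarrow>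
       dist z' z < d \<Longrightarrow> dist ((\<lambda>(x, y). k x y) z') ((\<lambda>(x, y). k x y) z) < e'"
      using unif e' unfolding uniformly_continuous_on_def by metis
    have "norm (K n x - K n y) < e" if y: "y \<in> {0..R}" and xy: "norm (x - y) < d" for n y
    proof -
      have "\<bar>K n x - K n y\<bar> = \<bar>integral {0..R} (\<lambda>z. (k x z - k y z) * F n z)\<bar>"
        unfolding K_def kop_def using kop_integrable[OF R k F x] kop_integrable[OF R k F y]
        by (simp add: left_diff_distrib integral_diff)
      also have "\<dots> \<le> integral {0..R} (\<lambda>z. e' * \<bar>F n z\<bar>)"
        unfolding real_norm_def[symmetric]
      proof (rule integral_norm_bound_integral)
        show "(\<lambda>z. (k x z - k y z) * F n z) integrable_on {0..R}"
          using integrable_diff[OF kop_integrable[OF R k F[of n] x] kop_integrable[OF R k F[of n] y]]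
          by (simp add: left_diff_distrib)
        show "(\<lambda>z. e' * norm (F n z)) integrable_on {0..R}"
          by (intro integrable_continuous_interval continuous_intros F)
        fix z assume z: "z \<in> {0..R}"
        have "\<bar>k x z - k y z\<bar> \<le> e'"
          using d'[of "(y, z)" "(x, z)"] x y z xy by (auto simp: dist_prod_def dist_norm)
        then show "norm ((k x z - k y z) * F n z) \<le> e' * norm (F n z)"
          by (auto simp: abs_mult intro: mult_right_mono)
      qed
      also have "\<dots> \<le> e' * sqrt R" using intF e' by (simp add: mult_left_mono)
      also have "\<dots> < e" using e R by (simp add: e'_def field_simps add_pos_nonneg)
      finally show ?thesis by simp
    qed
    with d show ?thesis by blast
  qed
  obtain G s where G: "continuous_on {0..R} G" and s: "strict_mono (s :: nat \<Rightarrow> nat)"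
    and lim: "\<And>e. 0 < e \<Longrightarrow> \<exists>N. \<forall>n x. n \<ge> N \<and> x \<in> {0..R} \<longrightarrow> norm (K (s n) x - G x) < e"
    using Arzela_Ascoli[of "{0..R}" K, OF compact_Icc KM equi] by blast
  \<comment> \<open>By \<open>almost_eigenfunction\<close> the squared L^2 norm of F - KF is at most
    twice the amount by which the form misses 1, hence at most 2 / (s n + 1).\<close>
  have close: "\<exists>N. \<forall>n\<ge>N. integral {0..R} (\<lambda>x. \<bar>F (s n) x + (-1) * K (s n) x\<bar>) < e" if e: "0 < e" for e
  proof -
    obtain N :: nat where N: "2 * R / e\<^sup>2 < real N" using reals_Archimedean2 by blast
    have "integral {0..R} (\<lambda>x. \<bar>F (s n) x + (-1) * K (s n) x\<bar>) < e" if n: "n \<ge> N" for n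
    proof -
      have c: "continuous_on {0..R} (\<lambda>x. F (s n) x + (-1) * K (s n) x)"
        by (intro continuous_intros F K)
      have sn: "n \<le> s n" using s by (rule strict_mono_imp_increasing)
      have "(integral {0..R} (\<lambda>x. \<bar>F (s n) x + (-1) * K (s n) x\<bar>))\<^sup>2
         \<le> R * (2 * (ip R (F (s n)) (F (s n)) - ip R (F (s n)) (K (s n))))"
        using order_trans[OF square_integral_abs_le[OF R c] mult_left_mono[OF
            almost_eigenfunction[OF R k sym nonneg le F, of "s n"], folded K_def]] R by simp
      also have "\<dots> \<le> R * (2 * (1 / real (Suc (s n))))"
        using Fe[of "s n"] F1[of "s n"] R unfolding K_def by (intro mult_left_mono) auto
      also have "\<dots> = 2 * R / real (Suc (s n))" by simp
      also have "\<dots> < e\<^sup>2"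
      proof -
        have "2 * R / e\<^sup>2 < real (Suc (s n))" using N n sn by linarith
        then show ?thesis using e by (simp add: field_simps)
      qed
      finally show ?thesis by (rule power2_less_imp_less) (use e in simp)
    qed
    then show ?thesis by blast
  qed
  have KG: "kop R k G x = G x" if x: "x \<in> {0..R}" for x
  proof (rule ccontr)
    assume "kop R k G x \<noteq> G x"
    then have e: "0 < \<bar>kop R k G x - G x\<bar>" (is "0 < ?e") by simp
    \<comment> \<open>The errors |K_n x - G x|, |K_n x - K K_n x| and |K K_n x - K G x| are at most
      d, M d and M R d; together they make up only half of the assumed defect.\<close>
    define d where "d = ?e / (2 * (M * R + M + 1))"
    have MR: "0 < M * R + M + 1" using M0 R by (simp add: add_pos_pos)
    have d: "0 < d" using e MR unfolding d_def by (intro divide_pos_pos) auto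
    obtain N1 where N1: "\<forall>n x. n \<ge> N1 \<and> x \<in> {0..R} \<longrightarrow> norm (K (s n) x - G x) < d" using lim[OF d] by blast
    obtain N2 where N2: "\<forall>n\<ge>N2. integral {0..R} (\<lambda>x. \<bar>F (s n) x + (-1) * K (s n) x\<bar>) < d" using close[OF d] by blast
    define n where "n = max N1 N2"
    let ?F = "F (s n)" and ?K = "K (s n)"
    have c: "continuous_on {0..R} (\<lambda>x. ?F x + (-1) * ?K x)" "continuous_on {0..R} (\<lambda>x. ?K x + (-1) * G x)"
      by (intro continuous_intros F K G)+
    have a: "\<bar>?K x - G x\<bar> < d" using N1 x by (simp add: n_def)
    have "\<bar>kop R k ?F x + (-1) * kop R k ?K x\<bar> \<le> M * integral {0..R} (\<lambda>x. \<bar>?F x + (-1) * ?K x\<bar>)"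
      using kop_bound[OF R k c(1) x M[OF x]] unfolding kop_add[OF R k F K x] .
    also have "\<dots> \<le> M * d" using N2 M0 by (intro mult_left_mono) (auto simp: n_def less_imp_le)
    finally have b: "\<bar>?K x - kop R k ?K x\<bar> \<le> M * d" by (simp add: K_def)
    have "\<bar>kop R k ?K x + (-1) * kop R k G x\<bar> \<le> M * integral {0..R} (\<lambda>x. \<bar>?K x + (-1) * G x\<bar>)"
      using kop_bound[OF R k c(2) x M[OF x]] unfolding kop_add[OF R k K G x] .
    also have "integral {0..R} (\<lambda>x. \<bar>?K x + (-1) * G x\<bar>) \<le> integral {0..R} (\<lambda>x. d)"
      using N1 by (intro integral_le integrable_continuous_interval continuous_intros c(2))
        (auto simp: n_def less_imp_le)
    finally have "\<bar>kop R k ?K x - kop R k G x\<bar> \<le> M * (R * d)" using M0 R by simp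
    with a b have "?e < d + M * d + M * (R * d)" by linarith
    also have "\<dots> = (M * R + M + 1) * d" by (simp add: algebra_simps)
    also have "\<dots> = ?e / 2" using MR unfolding d_def by (simp add: divide_simps)
    finally show False using e by simp
  qed
  have "\<exists>x\<in>{0..R}. G x \<noteq> 0"
  proof (rule ccontr)
    assume "\<not> ?thesis"
    then have G0: "\<And>x. x \<in> {0..R} \<Longrightarrow> G x = 0" by blast
    \<comment> \<open>If the limit were 0, the images would fall below d and the form below
      \<open>d * sqrt R \<le> 1/4\<close>. It exceeds 1 - 1 / (s n + 1), which is at least 1/2
      because n is taken to be a successor.\<close>
    define d where "d = 1 / (4 * (sqrt R + 1))"
    have d: "0 < d" using R by (simp add: d_def add_nonneg_pos)
    obtain N where N: "\<forall>n x. n \<ge> N \<and> x \<in> {0..R} \<longrightarrow> norm (K (s n) x - G x) < d" using lim[OF d] by blast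
    define n where "n = Suc N"
    have sn: "n \<le> s n" using s by (rule strict_mono_imp_increasing)
    have "1 - 1 / real (Suc (s n)) < ip R (K (s n)) (F (s n))"
      using Fe[of "s n"] by (simp add: K_def ip_commute)
    also have "\<dots> \<le> d * integral {0..R} (\<lambda>x. \<bar>F (s n) x\<bar>)"
    proof -
      have "\<bar>K (s n) x\<bar> \<le> d" if x: "x \<in> {0..R}" for x
        using N[rule_format, of n x] x G0[OF x] by (simp add: n_def)
      from abs_ip_le[OF F[of "s n"] K[of "s n"] this] show ?thesis by auto
    qed
    also have "\<dots> \<le> d * sqrt R" using intF d by simp
    also have "\<dots> \<le> 1/4"
    proof -
      have "0 \<le> sqrt R" using R by simp
      then show ?thesis unfolding d_def by (simp add: divide_simps not_less add_nonneg_nonneg)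
    qed
    finally have "1 < 1 / 4 + 1 / real (Suc (s n))" by linarith
    moreover have "1 / real (Suc (s n)) \<le> 1 / 2" using sn by (simp add: n_def field_simps)
    ultimately show False by linarith
  qed
  with G KG show ?thesis by blast
qed

text \<open>The square of G x \<phi> y - G y \<phi> x gives 2 G x G y \<le> (G x)^2 \<phi> y /
  \<phi> x + (G y)^2 \<phi> x / \<phi> y. Integrated against a symmetric kernel, the two terms on
  the right agree.\<close>

lemma schur_test:
  assumes R: "0 < R" and k: "continuous_on ({0..R} \<times> {0..R}) (\<lambda>(x, y). k x y)"
    and sym: "\<And>x y. x \<in> {0..R} \<Longrightarrow> y \<in> {0..R} \<Longrightarrow> k x y = k y x"
    and nonneg: "\<And>x y. x \<in> {0..R} \<Longrightarrow> y \<in> {0..R} \<Longrightarrow> 0 \<le> k x y"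
    and phi: "continuous_on {0..R} \<phi>" "\<And>x. x \<in> {0..R} \<Longrightarrow> 0 < \<phi> x"
    and G: "continuous_on {0..R} G"
  shows "ip R G (kop R k G) \<le> ip R (\<lambda>x. (G x)\<^sup>2 / \<phi> x) (kop R k \<phi>)"
proof -
  let ?u = "\<lambda>x. (G x)\<^sup>2 / \<phi> x"
  have phi0: "\<And>x. x \<in> {0..R} \<Longrightarrow> \<phi> x \<noteq> 0" using phi(2) by force
  have u: "continuous_on {0..R} ?u" by (intro continuous_intros G phi(1)) (use phi0 in auto)
  note cont = kop_continuous[OF R k G] kop_continuous[OF R k phi(1)] kop_continuous[OF R k u]
  have pt: "G x * kop R k G x \<le> (1/2) * (?u x * kop R k \<phi> x + \<phi> x * kop R k ?u x)" if x: "x \<in> {0..R}" for x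
  proof -
    have "G x * kop R k G x = integral {0..R} (\<lambda>y. G x * (k x y * G y))" by (simp add: kop_def)
    also have "\<dots> \<le> integral {0..R} (\<lambda>y. (1/2) * (?u x * (k x y * \<phi> y) + \<phi> x * (k x y * ?u y)))"
    proof (rule integral_le)
      show "(\<lambda>y. G x * (k x y * G y)) integrable_on {0..R}"
        by (intro integrable_continuous_interval continuous_intros kernel_section[OF R k x] G)
      show "(\<lambda>y. (1/2) * (?u x * (k x y * \<phi> y) + \<phi> x * (k x y * ?u y))) integrable_on {0..R}"
        by (intro integrable_continuous_interval continuous_intros kernel_section[OF R k x] G phi(1)) (use phi0 in auto)
      fix y assume y: "y \<in> {0..R}"
      have p: "0 < \<phi> x" "0 < \<phi> y" using phi(2) x y by auto
      have "0 \<le> (G x * \<phi> y - G y * \<phi> x)\<^sup>2 / (\<phi> x * \<phi> y)" using p by simp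
      also have "\<dots> = ?u x * \<phi> y + \<phi> x * ?u y - 2 * (G x * G y)"
        using p by (simp add: field_simps power2_eq_square)
      finally have "G x * G y \<le> (1/2) * (?u x * \<phi> y + \<phi> x * ?u y)" by simp
      from mult_left_mono[OF this nonneg[OF x y]]
      show "G x * (k x y * G y) \<le> (1/2) * (?u x * (k x y * \<phi> y) + \<phi> x * (k x y * ?u y))"
        by (simp add: algebra_simps)
    qed
    also have "\<dots> = (1/2) * (?u x * kop R k \<phi> x + \<phi> x * kop R k ?u x)"
    proof -
      have "((\<lambda>y. (1/2) * (?u x * (k x y * \<phi> y) + \<phi> x * (k x y * ?u y))) has_integral
         (1/2) * (?u x * kop R k \<phi> x + \<phi> x * kop R k ?u x)) {0..R}"
        unfolding kop_def by (intro has_integral_mult_right has_integral_add integrable_integral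
          kop_integrable[OF R k _ x] u phi(1))
      then show ?thesis by (rule integral_unique)
    qed
    finally show ?thesis .
  qed
  have "ip R G (kop R k G) \<le> integral {0..R} (\<lambda>x. (1/2) * (?u x * kop R k \<phi> x + \<phi> x * kop R k ?u x))"
    unfolding ip_def by (intro integral_le integrable_continuous_interval continuous_intros cont G phi(1) pt)
      (use phi0 in auto)
  also have "\<dots> = (1/2) * (ip R ?u (kop R k \<phi>) + ip R \<phi> (kop R k ?u))"
    unfolding ip_def
    by (intro integral_unique has_integral_mult_right has_integral_add integrable_integral
        integrable_continuous_interval continuous_intros cont G phi(1)) (use phi0 in auto)
  also have "ip R \<phi> (kop R k ?u) = ip R ?u (kop R k \<phi>)"
    using kop_adjoint[OF R k sym u phi(1)] by (simp add: ip_commute)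
  finally show ?thesis by simp
qed

text \<open>The Schur test with weight r would give the bound at once, but r may vanish at an
  endpoint, as a density does at the edge of its support. So the weight is r + e_n with e_n tending
  to 0. In the limit the form stays below the identity by at least the integral of G^2 (1 - Kr / r),
  and a fixed point forces that integral to vanish.\<close>

lemma strict_supersolution:
  assumes R: "0 < R" and k: "continuous_on ({0..R} \<times> {0..R}) (\<lambda>(x, y). k x y)"
    and sym: "\<And>x y. x \<in> {0..R} \<Longrightarrow> y \<in> {0..R} \<Longrightarrow> k x y = k y x"
    and nonneg: "\<And>x y. x \<in> {0..R} \<Longrightarrow> y \<in> {0..R} \<Longrightarrow> 0 \<le> k x y"
    and r: "continuous_on {0..R} r" "\<And>x. x \<in> {0<..<R} \<Longrightarrow> 0 < r x"
    and super: "\<And>x. x \<in> {0<..<R} \<Longrightarrow> kop R k r x < r x"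
    and G: "continuous_on {0..R} G"
  shows "ip R G (kop R k G) \<le> ip R G G"
    and "(\<And>x. x \<in> {0..R} \<Longrightarrow> kop R k G x = G x) \<Longrightarrow> x \<in> {0..R} \<Longrightarrow> G x = 0"
proof -
  have closure: "closure {0<..<R} = {0..R}" using R by simp
  note Kr = kop_continuous[OF R k r(1)]
  have r0: "0 \<le> r x" if "x \<in> {0..R}" for x
    using continuous_ge_on_closure[of "{0<..<R}" r x 0] closure r that by (force intro: less_imp_le)
  have Krr: "kop R k r x \<le> r x" if "x \<in> {0..R}" for x
  proof -
    have "0 \<le> r x - kop R k r x"
      using continuous_ge_on_closure[of "{0<..<R}" "\<lambda>x. r x - kop R k r x" x 0] closure super that
        continuous_on_diff[OF r(1) Kr] by (force intro: less_imp_le)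
    then show ?thesis by simp
  qed
  have one: "continuous_on {0..R} (\<lambda>_. 1)" by simp
  note K1 = kop_continuous[OF R k one]
  \<comment> \<open>One constant for both summands: K r \<le> r \<le> C r and K 1 \<le> C, so K (r +
    e_n) / (r + e_n) \<le> C. This provides the integrable majorant C G^2.\<close>
  obtain C where C: "1 \<le> C" "\<And>x. x \<in> {0..R} \<Longrightarrow> kop R k (\<lambda>_. 1) x \<le> C"
  proof -
    have "bounded (kop R k (\<lambda>_. 1) ` {0..R})"
      by (rule compact_imp_bounded[OF compact_continuous_image[OF K1 compact_Icc]])
    then obtain B where "\<And>x. x \<in> {0..R} \<Longrightarrow> \<bar>kop R k (\<lambda>_. 1) x\<bar> \<le> B" unfolding bounded_iff by force
    then show ?thesis by (intro that[of "max 1 B"]) (force simp: le_max_iff_disj)+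
  qed
  have Kpos: "0 \<le> kop R k H x" if "continuous_on {0..R} H" "x \<in> {0..R}" "\<And>y. y \<in> {0..R} \<Longrightarrow> 0 \<le> H y" for H x
    unfolding kop_def by (rule integral_nonneg[OF kop_integrable[OF R k that(1,2)]]) (use that nonneg in auto)
  define e where "e n = 1 / real (Suc n)" for n
  have e: "0 < e n" for n by (simp add: e_def)
  have elim: "e \<longlonglongrightarrow> 0"
    using LIMSEQ_inverse_real_of_nat by (simp add: e_def[abs_def] inverse_eq_divide)
  define f where "f n x = (G x)\<^sup>2 / (r x + e n * 1) * (kop R k r x + e n * kop R k (\<lambda>_. 1) x)" for n x
  define f0 where "f0 x = (G x)\<^sup>2 / r x * kop R k r x" for x
  have pos: "0 < r x + e n * 1" if "x \<in> {0..R}" for n x using r0[OF that] e[of n] by simp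
  have fcont: "continuous_on {0..R} (f n)" for n
    unfolding f_def[abs_def]
    by (intro continuous_intros G Kr r K1 ballI less_imp_neq[OF pos, symmetric])
  have fi: "f n integrable_on {0<..<R}" for n
    using integrable_continuous_interval[OF fcont] by (simp add: integrable_on_open_interval_real)
  have form: "ip R G (kop R k G) \<le> integral {0<..<R} (f n)" for n
  proof -
    have c: "continuous_on {0..R} (\<lambda>x. r x + e n * 1)" by (intro continuous_intros r)
    have "ip R G (kop R k G) \<le> ip R (\<lambda>x. (G x)\<^sup>2 / (r x + e n * 1)) (kop R k (\<lambda>x. r x + e n * 1))"
      by (rule schur_test[OF R k sym nonneg c pos G])
    also have "\<dots> = integral {0..R} (f n)"
      unfolding ip_def f_def by (rule integral_cong) (simp only: kop_add[OF R k r(1) one])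
    finally show ?thesis by (simp add: integral_open_interval_real)
  qed
  have lim: "(\<lambda>n. f n x) \<longlonglongrightarrow> f0 x" if "x \<in> {0<..<R}" for x
  proof -
    have "(\<lambda>n. (G x)\<^sup>2 / (r x + e n * 1) * (kop R k r x + e n * kop R k (\<lambda>_. 1) x)) \<longlonglongrightarrow>
       (G x)\<^sup>2 / (r x + 0 * 1) * (kop R k r x + 0 * kop R k (\<lambda>_. 1) x)"
      by (intro tendsto_intros elim) (use r(2)[OF that] in auto)
    then show ?thesis by (simp add: f_def f0_def)
  qed
  have dom: "norm (f n x) \<le> C * (G x)\<^sup>2" if x: "x \<in> {0<..<R}" for n x
  proof -
    have x': "x \<in> {0..R}" using x by auto
    have "kop R k r x + e n * kop R k (\<lambda>_. 1) x \<le> C * r x + e n * C"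
      using Krr[OF x'] C(2)[OF x'] e[of n] mult_right_mono[OF C(1) r0[OF x']]
      by (intro add_mono mult_left_mono) auto
    moreover have "0 \<le> kop R k r x + e n * kop R k (\<lambda>_. 1) x"
      using Kpos[OF r(1) x' r0] Kpos[OF one x'] e[of n] by simp
    ultimately have "\<bar>f n x\<bar> \<le> (G x)\<^sup>2 / (r x + e n * 1) * (C * (r x + e n * 1))"
      unfolding f_def abs_mult using pos[OF x', of n]
      by (intro mult_mono) (auto simp: algebra_simps)
    then show ?thesis using pos[OF x', of n] by (simp add: mult.commute)
  qed
  have Gi: "(\<lambda>x. C * (G x)\<^sup>2) integrable_on {0<..<R}" "(\<lambda>x. G x * G x) integrable_on {0<..<R}"
    unfolding integrable_on_open_interval_real
    by (intro integrable_continuous_interval continuous_intros G)+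
  note dc = dominated_convergence[OF fi Gi(1) dom lim]
  have le: "ip R G (kop R k G) \<le> integral {0<..<R} f0"
    by (rule LIMSEQ_le_const[OF dc(2)]) (use form in auto)
  have f0le: "f0 x \<le> G x * G x" if "x \<in> {0<..<R}" for x
    using mult_left_mono[of "kop R k r x / r x" 1 "(G x)\<^sup>2"] super[OF that] r(2)[OF that]
    by (simp add: f0_def power2_eq_square)
  have ipG: "ip R G G = integral {0<..<R} (\<lambda>x. G x * G x)"
    by (simp add: ip_def integral_open_interval_real)
  also have "integral {0<..<R} f0 \<le> \<dots>" by (rule integral_le[OF dc(1) Gi(2) f0le])
  finally show "ip R G (kop R k G) \<le> ip R G G" using le ipG by (simp add: ip_def)
  assume eig: "\<And>x. x \<in> {0..R} \<Longrightarrow> kop R k G x = G x" and x: "x \<in> {0..R}"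
  have "ip R G (kop R k G) = ip R G G" unfolding ip_def by (rule integral_cong) (simp add: eig)
  then have I0: "integral {0<..<R} (\<lambda>x. G x * G x - f0 x) \<le> 0"
    using le ipG dc(1) Gi(2) by (simp add: integral_diff)
  \<comment> \<open>The integrand is nonnegative on (0, R) and continuous on compact subintervals,
    so its integral can be nonpositive only if it vanishes pointwise.\<close>
  have zero: "G x = 0" if x: "x \<in> {0<..<R}" for x
  proof -
    obtain c d where cd: "0 < c" "c < x" "x < d" "d < R"
      using x dense[of 0 x] dense[of x R] by auto
    have sub: "{c..d} \<subseteq> {0..R}" "{c..d} \<subseteq> {0<..<R}" using cd by auto
    have rne: "\<forall>x\<in>{c..d}. r x \<noteq> 0" using r(2) sub by force
    have gc: "continuous_on {c..d} (\<lambda>x. G x * G x - f0 x)"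
      unfolding f0_def
      by (intro continuous_intros continuous_on_subset[OF G sub(1)] continuous_on_subset[OF r(1) sub(1)]
          continuous_on_subset[OF Kr sub(1)]) (use rne in auto)
    have nn: "0 \<le> G y * G y - f0 y" if "y \<in> {0<..<R}" for y using f0le[OF that] by simp
    have "integral {c..d} (\<lambda>x. G x * G x - f0 x) \<le> integral {0<..<R} (\<lambda>x. G x * G x - f0 x)"
      by (rule integral_subset_le[OF sub(2) integrable_continuous_interval[OF gc] integrable_diff[OF Gi(2) dc(1)]])
        (use nn in auto)
    moreover have "0 \<le> integral {c..d} (\<lambda>x. G x * G x - f0 x)"
      by (rule integral_nonneg[OF integrable_continuous_interval[OF gc]]) (use nn sub in auto)
    ultimately have "integral {c..d} (\<lambda>x. G x * G x - f0 x) = 0" using I0 by linarith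
    then have "G x * G x - f0 x = 0"
      using integral_eq_0_iff[OF gc] cd nn sub by auto
    then have "(G x)\<^sup>2 * (1 - kop R k r x / r x) = 0"
      by (simp only: f0_def power2_eq_square right_diff_distrib mult_1_right times_divide_eq_left times_divide_eq_right)
    moreover have "1 - kop R k r x / r x > 0" using super[OF x] r(2)[OF x] by simp
    ultimately show ?thesis by (metis mult_eq_0_iff less_irrefl power_eq_0_iff)
  qed
  show "G x = 0"
    using continuous_constant_on_closure[of "{0<..<R}" G 0 x] zero x closure G by auto
qed

text \<open>Take the supremum c of the parameters at which the form is dominated by the identity. By
  continuity domination persists at c, so c < b. It fails just above c, and the functions that
  witness the failure, normalized, are maximizing at c. Strictness of the supersolution at parameter
  0 rules out c = 0.\<close>

lemma unit_eigenfunction_exists: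
  fixes k :: "real \<Rightarrow> real \<Rightarrow> real \<Rightarrow> real"
  assumes R: "0 < R" and b: "0 \<le> b"
    and cont: "continuous_on ({0..b} \<times> {0..R} \<times> {0..R}) (\<lambda>(c, x, y). k c x y)"
    and sym: "\<And>c x y. c \<in> {0..b} \<Longrightarrow> x \<in> {0..R} \<Longrightarrow> y \<in> {0..R} \<Longrightarrow> k c x y = k c y x"
    and nonneg: "\<And>c x y. c \<in> {0..b} \<Longrightarrow> x \<in> {0..R} \<Longrightarrow> y \<in> {0..R} \<Longrightarrow> 0 \<le> k c x y"
    and r: "continuous_on {0..R} r" "\<And>x. x \<in> {0<..<R} \<Longrightarrow> 0 < r x"
    and super: "\<And>x. x \<in> {0<..<R} \<Longrightarrow> kop R (k 0) r x < r x"
    and H: "continuous_on {0..R} H" "ip R H H < ip R H (kop R (k b) H)"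
  shows "\<exists>c G. 0 < c \<and> c < b \<and> continuous_on {0..R} G \<and> (\<exists>x\<in>{0..R}. G x \<noteq> 0) \<and>
     (\<forall>x\<in>{0..R}. kop R (k c) G x = G x)"
proof -
  have kc: "continuous_on ({0..R} \<times> {0..R}) (\<lambda>(x, y). k c x y)" if "c \<in> {0..b}" for c
  proof -
    have "continuous_on ({0..R} \<times> {0..R}) (\<lambda>z. (\<lambda>(c, x, y). k c x y) (c, z))"
      by (rule continuous_on_compose2[OF cont]) (use that in \<open>auto intro!: continuous_intros\<close>)
    then show ?thesis by (simp add: case_prod_beta)
  qed
  have "compact ({0..b} \<times> {0..R} \<times> {0..R})" by (intro compact_Times) auto
  from compact_uniformly_continuous[OF cont this]
  have unif: "\<exists>d>0. \<forall>c\<in>{0..b}. \<forall>c'\<in>{0..b}. \<bar>c - c'\<bar> < d \<longrightarrow>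
      (\<forall>x\<in>{0..R}. \<forall>y\<in>{0..R}. \<bar>k c x y - k c' x y\<bar> \<le> e)" if "0 < e" for e
    unfolding uniformly_continuous_on_def
    by (drule_tac spec[of _ e]) (use that in \<open>force simp: dist_prod_def dist_norm\<close>)
  define S where "S = {c \<in> {0..b}. \<forall>F. continuous_on {0..R} F \<longrightarrow> ip R F (kop R (k c) F) \<le> ip R F F}"
  have b0: "0 \<in> {0..b}" using b by simp
  have S0: "0 \<in> S"
    unfolding S_def using strict_supersolution(1)[OF R kc[OF b0] sym[OF b0] nonneg[OF b0] r super] b0 by blast
  have Sbdd: "bdd_above S" unfolding S_def by (rule bdd_aboveI[of _ b]) auto
  define c where "c = Sup S"
  have c: "c \<in> {0..b}"
    unfolding c_def using S0 Sbdd by (auto simp: S_def intro!: cSup_upper cSup_least)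
  have cS: "ip R F (kop R (k c) F) \<le> ip R F F" if F: "continuous_on {0..R} F" for F
  proof (rule field_le_epsilon)
    fix e :: real assume e: "0 < e"
    define I where "I = (integral {0..R} (\<lambda>x. \<bar>F x\<bar>))\<^sup>2"
    \<comment> \<open>The divisor is I + 1 because the L^1 norm of F may be 0.\<close>
    have e': "0 < e / (I + 1)" using e by (simp add: I_def add_nonneg_pos)
    from unif[OF this] obtain d where d: "0 < d" and d': "\<And>c'. c' \<in> {0..b} \<Longrightarrow> \<bar>c - c'\<bar> < d \<Longrightarrow>
      \<forall>x\<in>{0..R}. \<forall>y\<in>{0..R}. \<bar>k c x y - k c' x y\<bar> \<le> e / (I + 1)" using c by blast
    obtain c' where c': "c' \<in> S" "c - d < c'"
      using less_cSupD[of S "c - d"] S0 d by (force simp: c_def)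
    have "c' \<le> c" unfolding c_def by (rule cSup_upper[OF c'(1) Sbdd])
    then have "ip R F (kop R (k c) F) - ip R F (kop R (k c') F) \<le> e / (I + 1) * I"
      using form_difference[OF R kc[OF c] kc F, of c' "e / (I + 1)"] d'[of c'] c' by (auto simp: S_def I_def)
    also have "\<dots> \<le> e"
    proof -
      have "0 \<le> I" by (simp add: I_def)
      then show ?thesis using e by (simp add: field_simps)
    qed
    finally show "ip R F (kop R (k c) F) \<le> ip R F F + e" using c'(1) F by (force simp: S_def)
  qed
  have "c \<noteq> b" using cS[OF H(1)] H(2) by auto
  with c have cb: "0 \<le> c" "c < b" by auto
  have max: "\<exists>F. continuous_on {0..R} F \<and> ip R F F = 1 \<and> 1 - e < ip R F (kop R (k c) F)" if e: "0 < e" for e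
  proof -
    have "0 < e / R" using e R by simp
    from unif[OF this] obtain d where d: "0 < d" and d': "\<And>c'. c' \<in> {0..b} \<Longrightarrow> \<bar>c - c'\<bar> < d \<Longrightarrow>
      \<forall>x\<in>{0..R}. \<forall>y\<in>{0..R}. \<bar>k c x y - k c' x y\<bar> \<le> e / R" using c by blast
    \<comment> \<open>Strictly above the supremum and hence outside \<open>S\<close>, yet within d
      of c and still in [0, b].\<close>
    define c' where "c' = min b (c + d / 2)"
    have c': "c < c'" "c' \<in> {0..b}" "\<bar>c - c'\<bar> < d" using cb d by (auto simp: c'_def min_def)
    then have "c' \<notin> S" using cSup_upper[OF _ Sbdd] unfolding c_def by force
    then obtain F where F: "continuous_on {0..R} F" and Fl: "ip R F F < ip R F (kop R (k c') F)"
      using c'(2) by (force simp: S_def)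
    have diff: "\<bar>ip R H (kop R (k c) H) - ip R H (kop R (k c') H)\<bar> \<le> e / R * (integral {0..R} (\<lambda>x. \<bar>H x\<bar>))\<^sup>2"
      if "continuous_on {0..R} H" for H
      using form_difference[OF R kc[OF c] kc[OF c'(2)] that] d'[OF c'(2,3)] by blast
    \<comment> \<open>A violating function of norm 0 would have L^1 norm 0 as well; then the forms
      at c and c' would agree, although one is at most 0 and the other positive.\<close>
    have "ip R F F \<noteq> 0"
    proof
      assume z: "ip R F F = 0"
      then have "(integral {0..R} (\<lambda>x. \<bar>F x\<bar>))\<^sup>2 = 0"
        using square_integral_abs_le[OF R F] by (simp add: antisym)
      with diff[OF F] cS[OF F] Fl z show False by simp
    qed
    then have p: "0 < ip R F F" using ip_self_nonneg[OF F] by simp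
    define q where "q = 1 / sqrt (ip R F F)"
    define H where "H x = q * F x" for x
    have q: "q * q * ip R F F = 1" using p by (simp add: q_def)
    have Hc: "continuous_on {0..R} H" unfolding H_def[abs_def] by (intro continuous_intros F)
    have kH: "kop R m H x = q * kop R m F x" for m x
      unfolding kop_def H_def by (simp add: mult.left_commute)
    have "ip R H (kop R (k c') H) = q * q * ip R F (kop R (k c') F)"
      unfolding ip_def kH unfolding H_def by (simp add: algebra_simps flip: integral_mult_right)
    then have H1: "1 < ip R H (kop R (k c') H)"
      using mult_strict_left_mono[OF Fl, of "q * q"] q p by (simp add: q_def)
    have ipH: "ip R H H = 1"
      using q unfolding ip_def H_def by (simp add: algebra_simps flip: integral_mult_right)
    have "e / R * (integral {0..R} (\<lambda>x. \<bar>H x\<bar>))\<^sup>2 \<le> e / R * R"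
      using square_integral_abs_le[OF R Hc] ipH e R by (intro mult_left_mono) auto
    then have "1 - e < ip R H (kop R (k c) H)" using diff[OF Hc] H1 R by simp
    with Hc ipH show ?thesis by blast
  qed
  obtain G where G: "continuous_on {0..R} G" "\<exists>x\<in>{0..R}. G x \<noteq> 0" "\<forall>x\<in>{0..R}. kop R (k c) G x = G x"
    using eigenfunction_of_maximizing[OF R kc[OF c] sym[OF c] nonneg[OF c] cS max] by blast
  have "c \<noteq> 0"
    using strict_supersolution(2)[OF R kc[OF b0] sym[OF b0] nonneg[OF b0] r super G(1)] G(2,3) by blast
  with cb G show ?thesis by (intro exI[of _ c] exI[of _ G]) auto
qed

section \<open>The period of the orbits\<close>

lemma FTC_open:
  fixes F f :: "real \<Rightarrow> real"
  assumes cd: "c \<le> d" and F: "continuous_on {c..d} F"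
    and F': "\<And>x. c < x \<Longrightarrow> x < d \<Longrightarrow> (F has_real_derivative f x) (at x)"
    and f: "set_integrable lborel {c<..<d} f"
  shows "(LINT x:{c<..<d}|lborel. f x) = F d - F c"
proof -
  have "(f has_integral F d - F c) {c..d}"
    using assms by (intro fundamental_theorem_of_calculus_interior)
      (auto simp: has_real_derivative_iff_has_vector_derivative)
  then show ?thesis
    using set_borel_integral_eq_integral(2)[OF f] by (metis integral_open_interval_real integral_unique)
qed

text \<open>Speeds vanish at turning points, so the derivatives met here are singular at the ends of
  the interval. For a nonnegative derivative, continuity of the primitive up to the ends already
  yields Lebesgue integrability.\<close>

lemma FTC_open_nonneg:
  fixes F f :: "real \<Rightarrow> real"
  assumes cd: "c \<le> d" and F: "continuous_on {c..d} F"
    and F': "\<And>x. c < x \<Longrightarrow> x < d \<Longrightarrow> (F has_real_derivative f x) (at x)"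
    and f[measurable]: "f \<in> borel_measurable borel" and f0: "\<And>x. c < x \<Longrightarrow> x < d \<Longrightarrow> 0 \<le> f x"
  shows "set_integrable lborel {c<..<d} f" "(LINT x:{c<..<d}|lborel. f x) = F d - F c"
proof -
  let ?g = "\<lambda>x. indicator {c<..<d} x * f x"
  have "(f has_integral F d - F c) {c..d}"
    using assms by (intro fundamental_theorem_of_calculus_interior)
      (auto simp: has_real_derivative_iff_has_vector_derivative)
  then have "(f has_integral F d - F c) {c<..<d}" by (simp add: has_integral_Icc_iff_Ioo)
  then have "((\<lambda>x. if x \<in> {c<..<d} then f x else 0) has_integral F d - F c) UNIV"
    by (simp only: has_integral_restrict_UNIV)
  also have "(\<lambda>x. if x \<in> {c<..<d} then f x else 0) = ?g" by (auto simp: indicator_def)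
  finally have I: "(?g has_integral F d - F c) UNIV" .
  have "(\<integral>\<^sup>+x. ennreal (?g x) \<partial>lborel) = ennreal (F d - F c)"
    by (rule nn_integral_has_integral_lborel[OF _ _ I]) (auto simp: indicator_def f0)
  then show *: "set_integrable lborel {c<..<d} f"
    unfolding set_integrable_def
    by (intro integrableI_nonneg) (auto simp: indicator_def f0)
  show "(LINT x:{c<..<d}|lborel. f x) = F d - F c" by (rule FTC_open[OF cd F F' *])
qed

section \<open>The potential, the orbits and their travel times\<close>

locale planar_potential =
  fixes U U' \<rho> :: "real \<Rightarrow> real" and R :: real
  assumes R_pos: "0 < R"
    and U_deriv: "\<And>x. (U has_real_derivative U' x) (at x)"
    and U'_deriv: "\<And>x. (U' has_real_derivative 4 * pi * \<rho> x) (at x)"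
    and U_even: "\<And>x. U (- x) = U x"
    and rho_cont: "continuous_on UNIV \<rho>"
    and rho_antimono: "\<And>x y. 0 \<le> x \<Longrightarrow> x \<le> y \<Longrightarrow> \<rho> y \<le> \<rho> x"
    and rho_nonneg: "\<And>x. 0 \<le> \<rho> x"
    and rho_pos: "\<And>x. 0 \<le> x \<Longrightarrow> x < R \<Longrightarrow> 0 < \<rho> x"
begin

lemma U_cont: "continuous_on S U"
  using U_deriv by (meson DERIV_isCont continuous_at_imp_continuous_on)

lemma U'_cont: "continuous_on S U'"
  using U'_deriv by (meson DERIV_isCont continuous_at_imp_continuous_on)

lemma U_meas[measurable]: "U \<in> borel_measurable borel" "U' \<in> borel_measurable borel"
    "\<rho> \<in> borel_measurable borel"
  by (intro borel_measurable_continuous_onI U_cont U'_cont rho_cont)+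

lemma U'_odd: "U' (- x) = - U' x"
proof -
  have "((\<lambda>x. U (- x)) has_real_derivative - U' (- x)) (at x)"
    by (rule DERIV_cong[OF DERIV_chain2[OF U_deriv]]) (auto intro!: derivative_eq_intros)
  then have "(U has_real_derivative - U' (- x)) (at x)" by (simp add: U_even)
  then show ?thesis using DERIV_unique[OF U_deriv] by force
qed

lemma U'_0 [simp]: "U' 0 = 0"
  using U'_odd[of 0] by simp

lemma U'_mono: "x \<le> y \<Longrightarrow> U' x \<le> U' y"
  by (rule DERIV_nonneg_imp_nondecreasing[of x y U']) (use U'_deriv rho_nonneg in \<open>force+\<close>)

lemma U'_pos: assumes "0 < x" shows "0 < U' x"
proof -
  define y where "y = min x (R / 2)"
  have y: "0 < y" "y \<le> x" "y < R" using assms R_pos by (auto simp: y_def)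
  have "U' 0 < U' y"
  proof (rule DERIV_pos_imp_increasing[OF y(1)])
    fix z assume z: "0 \<le> z" "z \<le> y"
    have "0 < \<rho> z" using rho_pos z y by simp
    then show "\<exists>D. (U' has_real_derivative D) (at z) \<and> 0 < D" using U'_deriv[of z] by force
  qed
  then show ?thesis using U'_mono[OF y(2)] by simp
qed

lemma U'_nonneg: "0 \<le> x \<Longrightarrow> 0 \<le> U' x"
  using U'_mono[of 0 x] by simp

lemma U_strict: assumes "0 \<le> x" "x < y" shows "U x < U y"
proof (rule DERIV_pos_imp_increasing_open[OF assms(2) _ U_cont])
  fix z assume "x < z" "z < y"
  then show "\<exists>D. (U has_real_derivative D) (at z) \<and> 0 < D" using U_deriv[of z] U'_pos[of z] assms by force
qed

lemma U_less_iff: "0 \<le> x \<Longrightarrow> 0 \<le> y \<Longrightarrow> U x < U y \<longleftrightarrow> x < y"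
  using U_strict by (metis linorder_neqE_linordered_idom order_less_asym' order_less_irrefl)

lemma U_le_iff: "0 \<le> x \<Longrightarrow> 0 \<le> y \<Longrightarrow> U x \<le> U y \<longleftrightarrow> x \<le> y"
  using U_less_iff by (meson linorder_not_less)

text \<open>\<open>U'\<close> is concave on the half line because \<open>\<rho>\<close> decreases.\<close>
lemma U'_star: assumes "0 < y" "y \<le> z" shows "y * U' z \<le> z * U' y"
proof -
  have "U' z / z \<le> U' y / y"
  proof (rule DERIV_nonpos_imp_nonincreasing[OF assms(2)])
    fix x assume "y \<le> x" "x \<le> z"
    then have x: "0 < x" using assms by simp
    obtain c where c: "0 < c" "c < x" "U' x - U' 0 = (x - 0) * (4 * pi * \<rho> c)"
      using MVT2[OF x, of U' "\<lambda>x. 4 * pi * \<rho> x"] U'_deriv by blast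
    have "x * (4 * pi * \<rho> x) \<le> x * (4 * pi * \<rho> c)" using x c rho_antimono[of c x] by simp
    then have "(4 * pi * \<rho> x * x - U' x * 1) / (x * x) \<le> 0"
      using c x by (intro divide_nonpos_nonneg) (auto simp: algebra_simps)
    moreover have "((\<lambda>x. U' x / x) has_real_derivative (4 * pi * \<rho> x * x - U' x * 1) / (x * x)) (at x)"
      using x by (intro DERIV_divide U'_deriv DERIV_ident) auto
    ultimately show "\<exists>D. ((\<lambda>x. U' x / x) has_real_derivative D) (at x) \<and> D \<le> 0" by blast
  qed
  then show ?thesis using assms by (simp add: field_simps)
qed

text \<open>The squared speed at position a s on the orbit with turning point a, divided by a^2. In
  this scaling all quarter orbits live on [0, 1], and the quarter period is the integral of 1 / sqrt
  (q a s) ds.\<close>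

definition q :: "real \<Rightarrow> real \<Rightarrow> real" where "q a s = 2 * (U a - U (a * s)) / a\<^sup>2"

lemma q_deriv: "0 < a \<Longrightarrow> ((q a) has_real_derivative - 2 * U' (a * s) / a) (at s)"
  unfolding q_def[abs_def]
  by (rule derivative_eq_intros DERIV_chain2[OF U_deriv] refl | simp add: power2_eq_square)+

lemma q_1[simp]: "q a 1 = 0" by (simp add: q_def)

text \<open>Both functions vanish at s = 1, so it suffices to compare slopes, and U'(y) / y
  decreases by \<open>U'_star\<close>.\<close>

lemma q_antimono: assumes a: "0 < a" "a \<le> b" and s: "0 \<le> s" "s \<le> 1" shows "q b s \<le> q a s"
proof -
  have "q a 1 - q b 1 \<le> q a s - q b s"
  proof (rule DERIV_nonpos_imp_nonincreasing[OF s(2)])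
    fix x assume x: "s \<le> x" "x \<le> 1"
    have "U' (b * x) / b \<le> U' (a * x) / a"
    proof (cases "x = 0")
      case False
      then have "(a * x) * U' (b * x) \<le> (b * x) * U' (a * x)" using x s a by (intro U'_star) auto
      then have "a * U' (b * x) \<le> b * U' (a * x)" using False x s by (simp add: mult.assoc mult.left_commute)
      then show ?thesis using a by (simp add: field_simps)
    qed simp
    moreover have "((\<lambda>s. q a s - q b s) has_real_derivative - 2 * U' (a * x) / a - (- 2 * U' (b * x) / b)) (at x)"
      using a by (intro DERIV_diff q_deriv) auto
    ultimately show "\<exists>y. ((\<lambda>s. q a s - q b s) has_real_derivative y) (at x) \<and> y \<le> 0" by force
  qed
  then show ?thesis by simp
qed

text \<open>Slopes are compared again, now quantitatively. The factor 1 - s will tame the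
  singularity (1 - s)^(-3/2) in the difference of two quarter periods; \<open>R / 2 \<le> a\<close>
  enters through 1 / (a R) \<le> 2 / R^2.\<close>

lemma q_lipschitz:
  assumes a: "R / 2 \<le> a" "a \<le> R" and s: "0 \<le> s" "s \<le> 1"
  shows "q a s - q R s \<le> 4 * U' R / R\<^sup>2 * (R - a) * (1 - s)"
proof -
  have a0: "0 < a" using a R_pos by simp
  let ?C = "4 * U' R / R\<^sup>2 * (R - a)"
  have "q a s - q R s - ?C * (1 - s) \<le> q a 1 - q R 1 - ?C * (1 - 1)"
  proof (rule DERIV_nonneg_imp_nondecreasing[OF s(2)])
    fix x assume x: "s \<le> x" "x \<le> 1"
    have "U' (a * x) \<le> U' (R * x)" using x s a by (intro U'_mono mult_right_mono) auto
    then have "U' (a * x) / a - U' (R * x) / R \<le> U' (R * x) * (1 / a - 1 / R)"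
      using a0 by (simp add: divide_right_mono right_diff_distrib)
    also have "\<dots> \<le> U' R * (1 / a - 1 / R)"
      using a a0 x s R_pos by (intro mult_right_mono U'_mono) (auto simp: field_simps mult_left_le)
    also have "1 / a - 1 / R = (R - a) / (a * R)" using a0 R_pos by (simp add: field_simps)
    also have "(R - a) / (a * R) \<le> (R - a) / (R / 2 * R)"
      using a a0 R_pos by (intro divide_left_mono mult_right_mono) auto
    finally have "U' (a * x) / a - U' (R * x) / R \<le> U' R * ((R - a) / (R / 2 * R))"
      using U'_nonneg[of R] R_pos by (simp add: mult_left_mono)
    also have "\<dots> = ?C / 2" using R_pos by (simp add: power2_eq_square field_simps)
    finally have "0 \<le> - 2 * U' (a * x) / a - (- 2 * U' (R * x) / R) - ?C * (0 - 1)" by simp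
    moreover have "((\<lambda>s. q a s - q R s - ?C * (1 - s)) has_real_derivative
        - 2 * U' (a * x) / a - (- 2 * U' (R * x) / R) - ?C * (0 - 1)) (at x)"
      by (intro DERIV_diff q_deriv a0 R_pos DERIV_cmult DERIV_const DERIV_ident)
    ultimately show "\<exists>y. ((\<lambda>s. q a s - q R s - ?C * (1 - s)) has_real_derivative y) (at x) \<and> 0 \<le> y" by blast
  qed
  then show ?thesis by simp
qed

definition q0 :: real where "q0 = 2 * (U R - U 0) / R\<^sup>2"

lemma q0_pos: "0 < q0" using U_strict[of 0 R] R_pos by (simp add: q0_def)

text \<open>U is convex, so \<open>q R\<close> is concave and lies above its chord from q0 at s = 0
  to 0 at s = 1. The two mean values c < R s < d with U' c \<le> U' d spell this out.\<close>

lemma qR_lower: assumes s: "0 \<le> s" "s \<le> 1" shows "q0 * (1 - s) \<le> q R s"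
proof (cases "s = 0 \<or> s = 1")
  case True then show ?thesis by (auto simp: q_def q0_def)
next
  case False
  let ?y = "R * s"
  have y: "0 < ?y" "?y < R" using False s R_pos by auto
  obtain c where c: "0 < c" "c < ?y" "U ?y - U 0 = (?y - 0) * U' c"
    using MVT2[OF y(1), of U U'] U_deriv by blast
  obtain d where d: "?y < d" "d < R" "U R - U ?y = (R - ?y) * U' d"
    using MVT2[OF y(2), of U U'] U_deriv by blast
  have cd: "U' c \<le> U' d" using c d by (intro U'_mono) auto
  have "U R - U 0 = R * ((1 - s) * U' d + s * U' c)" using c(3) d(3) by (simp add: algebra_simps)
  also have "\<dots> \<le> R * ((1 - s) * U' d + s * U' d)" using cd s R_pos by (simp add: mult_left_mono)
  finally have "U R - U 0 \<le> R * U' d" by (simp add: algebra_simps)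
  then have "(1 - s) * (U R - U 0) \<le> (1 - s) * (R * U' d)" using s by (intro mult_left_mono) auto
  then have "(1 - s) * (U R - U 0) \<le> U R - U ?y" using d(3) by (simp add: algebra_simps)
  then have "2 * ((1 - s) * (U R - U 0)) / R\<^sup>2 \<le> 2 * (U R - U ?y) / R\<^sup>2"
    by (intro divide_right_mono) auto
  then show ?thesis by (simp only: q_def q0_def times_divide_eq_right mult.commute mult.left_commute)
qed

lemma q_pos: assumes "0 < a" "a \<le> R" "0 \<le> s" "s < 1" shows "0 < q a s"
  using q_antimono[of a R s] qR_lower[of s] q0_pos assms by (smt (verit) mult_pos_pos)

definition speed :: "real \<Rightarrow> real \<Rightarrow> real" where "speed x a = sqrt (2 * (U a - U x))"

lemma speed_pos: "0 \<le> x \<Longrightarrow> x < a \<Longrightarrow> 0 < speed x a"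
  using U_strict by (simp add: speed_def)

lemma speed_nonneg: "0 \<le> x \<Longrightarrow> x \<le> a \<Longrightarrow> 0 \<le> speed x a"
  using U_le_iff[of x a] by (simp add: speed_def)

lemma speed_sq: "0 \<le> x \<Longrightarrow> x \<le> a \<Longrightarrow> (speed x a)\<^sup>2 = 2 * (U a - U x)"
  using U_le_iff[of x a] by (simp add: speed_def)

lemma speed_self[simp]: "speed a a = 0" by (simp add: speed_def)

lemma speed_cont: "continuous_on S (\<lambda>x. speed x a)" "continuous_on S (speed x)"
  unfolding speed_def[abs_def] by (intro continuous_intros U_cont)+

lemma speed_meas[measurable]: "case_prod speed \<in> borel_measurable (borel \<Otimes>\<^sub>M borel)"
  unfolding speed_def[abs_def] by measurable

lemma speed_deriv:
  assumes "0 \<le> x" "x < a"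
  shows "((\<lambda>x. speed x a) has_real_derivative - U' x / speed x a) (at x)"
    "(speed x has_real_derivative U' a / speed x a) (at a)"
  unfolding speed_def[abs_def] using U_strict[OF assms]
  by (auto intro!: derivative_eq_intros U_deriv simp: divide_simps)

lemma speed_scale: assumes "0 < a" shows "speed (a * s) a = a * sqrt (q a s)"
  using assms by (simp add: speed_def q_def real_sqrt_divide)

definition vmax :: real where "vmax = speed 0 R"

lemma vmax_pos: "0 < vmax" using speed_pos[of 0 R] R_pos by (simp add: vmax_def)

lemma speed_le_vmax: "0 \<le> x \<Longrightarrow> 0 \<le> a \<Longrightarrow> a \<le> R \<Longrightarrow> speed x a \<le> vmax"
  using U_le_iff[of 0 x] U_le_iff[of a R] by (simp add: speed_def vmax_def)

text \<open>Cutting the reciprocal speed to the open interval (0, a) yields a function on the whole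
  line that is jointly measurable in a and y. The travel time built from it stays constant, equal to
  the quarter period, beyond the turning point.\<close>

definition slow :: "real \<Rightarrow> real \<Rightarrow> real" where
  "slow a y = (if 0 < y \<and> y < a then 1 / speed y a else 0)"

definition time :: "real \<Rightarrow> real \<Rightarrow> real" where
  "time x a = (LINT y|lborel. indicator {0..x} y * slow a y)"

definition quarter :: "real \<Rightarrow> real" where
  "quarter a = (LINT y|lborel. slow a y)"

lemma slow_nonneg: "0 \<le> slow a y"
  using speed_pos by (auto simp: slow_def intro: less_imp_le)

lemma slow_meas[measurable]: "case_prod slow \<in> borel_measurable (borel \<Otimes>\<^sub>M borel)"
  unfolding slow_def[abs_def] by measurable

lemma slow_scale:
  assumes "0 < a"
  shows "a * slow a (a * s) = (if 0 < s \<and> s < 1 then 1 / sqrt (q a s) else 0)"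
  using assms by (auto simp: slow_def speed_scale zero_less_mult_iff)

lemma inv_sqrt_integrable: "integrable lborel (\<lambda>s. indicator {0<..<1} s * (1 / sqrt (1 - s)))"
proof -
  have "set_integrable lborel {0<..<1::real} (\<lambda>s. 1 / sqrt (1 - s))"
    by (rule FTC_open_nonneg(1)[of 0 1 "\<lambda>s. - 2 * sqrt (1 - s)"])
      (auto intro!: continuous_intros derivative_eq_intros simp: divide_simps)
  then show ?thesis by (simp add: set_integrable_def)
qed

lemma inv_sqrt_q_le:
  assumes a: "0 < a" "a \<le> R" and s: "0 < s" "s < 1"
  shows "1 / sqrt (q a s) \<le> 1 / sqrt (q R s)" "1 / sqrt (q R s) \<le> 1 / sqrt q0 * (1 / sqrt (1 - s))"
proof -
  show "1 / sqrt (q a s) \<le> 1 / sqrt (q R s)"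
    using q_pos[of R s] q_pos[of a s] q_antimono[of a R s] a s R_pos by (simp add: frac_le)
  have "0 < q0 * (1 - s)" using q0_pos s by simp
  then show "1 / sqrt (q R s) \<le> 1 / sqrt q0 * (1 / sqrt (1 - s))"
    using qR_lower[of s] s by (simp add: frac_le flip: real_sqrt_mult)
qed

lemma slow_scale_integrable:
  assumes a: "0 < a" "a \<le> R"
  shows "integrable lborel (\<lambda>s. a * slow a (a * s))"
proof (rule Bochner_Integration.integrable_bound[OF integrable_mult_right[OF inv_sqrt_integrable, of "1 / sqrt q0"]])
  show "(\<lambda>s. a * slow a (a * s)) \<in> borel_measurable lborel" by measurable
  show "AE s in lborel. norm (a * slow a (a * s))
      \<le> norm (1 / sqrt q0 * (indicator {0<..<1} s * (1 / sqrt (1 - s))))"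
  proof (rule AE_I2)
    fix s :: real
    show "norm (a * slow a (a * s)) \<le> norm (1 / sqrt q0 * (indicator {0<..<1} s * (1 / sqrt (1 - s))))"
      using inv_sqrt_q_le[OF a, of s] q_pos[OF a, of s] q0_pos
      by (auto simp: slow_scale[OF a(1)] indicator_def)
  qed
qed

lemma slow_integrable:
  assumes a: "0 < a" "a \<le> R"
  shows "integrable lborel (slow a)"
  using slow_scale_integrable[OF a] lborel_integrable_real_affine_iff[of a "slow a" 0] a by simp

lemma quarter_scale:
  assumes a: "0 < a"
  shows "quarter a = (LINT s|lborel. a * slow a (a * s))"
  unfolding quarter_def using lborel_integral_real_affine[of a "slow a" 0] a by simp

text \<open>By \<open>q_antimono\<close> larger orbits take longer, so the outermost orbit alone
  sets the edge of the gap.\<close>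

lemma quarter_mono:
  assumes a: "0 < a" "a \<le> R" shows "quarter a \<le> quarter R"
  unfolding quarter_scale[OF a(1)] quarter_scale[OF R_pos]
proof (rule integral_mono[OF slow_scale_integrable[OF a] slow_scale_integrable[OF R_pos order_refl]])
  fix s show "a * slow a (a * s) \<le> R * slow R (R * s)"
    using inv_sqrt_q_le(1)[OF a, of s] by (auto simp: slow_scale[OF a(1)] slow_scale[OF R_pos])
qed

text \<open>Rationalize the difference of roots, then replace every root in the denominator by the
  smaller sqrt c.\<close>

lemma inv_sqrt_diff:
  fixes u v c :: real
  assumes "0 < c" "c \<le> u" "u \<le> v"
  shows "1 / sqrt u - 1 / sqrt v \<le> (v - u) / (2 * c * sqrt c)"
proof -
  have p: "0 < sqrt u" "0 < sqrt v" "sqrt u \<le> sqrt v" using assms by auto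
  have "1 / sqrt u - 1 / sqrt v = (sqrt v - sqrt u) / (sqrt u * sqrt v)" using p by (simp add: field_simps)
  also have "sqrt v - sqrt u = (v - u) / (sqrt v + sqrt u)"
  proof -
    have "(sqrt v - sqrt u) * (sqrt v + sqrt u) = (sqrt v)\<^sup>2 - (sqrt u)\<^sup>2"
      by (simp add: power2_eq_square algebra_simps)
    also have "\<dots> = v - u" using assms by simp
    finally show ?thesis using p by (metis add_pos_pos less_irrefl nonzero_eq_divide_eq)
  qed
  also have "(v - u) / (sqrt v + sqrt u) / (sqrt u * sqrt v) = (v - u) / ((sqrt v + sqrt u) * (sqrt u * sqrt v))" by simp
  also have "\<dots> \<le> (v - u) / ((sqrt c + sqrt c) * (sqrt c * sqrt c))"
    using assms by (intro divide_left_mono mult_mono add_mono real_sqrt_le_mono) (auto intro!: mult_pos_pos add_pos_pos)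
  also have "(sqrt c + sqrt c) * (sqrt c * sqrt c) = 2 * c * sqrt c" using assms by simp
  finally show ?thesis .
qed

text \<open>After scaling, the integrands differ by at most a multiple of (R - a) (1 - s) / (1 -
  s)^(3/2), which is integrable in s. A Lipschitz bound is just enough for the integral over orbits
  to diverge logarithmically at the edge of the gap.\<close>

lemma quarter_lipschitz:
  "\<exists>C>0. \<forall>a. R / 2 \<le> a \<longrightarrow> a \<le> R \<longrightarrow> quarter R - quarter a \<le> C * (R - a)"
proof -
  define I where "I = (LINT s|lborel. indicator {0<..<1} s * (1 / sqrt (1 - s)))"
  define D where "D = 4 * U' R / R\<^sup>2 / (2 * q0 * sqrt q0)"
  have D: "0 \<le> D" using U'_nonneg[of R] R_pos q0_pos by (simp add: D_def)
  have I: "0 \<le> I" unfolding I_def by (rule integral_nonneg_AE) (auto simp: indicator_def)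
  have "quarter R - quarter a \<le> (D * I + 1) * (R - a)" if a: "R / 2 \<le> a" "a \<le> R" for a
  proof -
    have a0: "0 < a" using a R_pos by simp
    have "quarter R - quarter a = (LINT s|lborel. R * slow R (R * s) - a * slow a (a * s))"
      unfolding quarter_scale[OF a0] quarter_scale[OF R_pos]
      using Bochner_Integration.integral_diff[OF slow_scale_integrable[OF R_pos order_refl]
          slow_scale_integrable[OF a0 a(2)]] by simp
    also have "\<dots> \<le> (LINT s|lborel. D * (R - a) * (indicator {0<..<1} s * (1 / sqrt (1 - s))))"
    proof (rule integral_mono)
      fix s :: real
      show "R * slow R (R * s) - a * slow a (a * s) \<le> D * (R - a) * (indicator {0<..<1} s * (1 / sqrt (1 - s)))"
      proof (cases "0 < s \<and> s < 1")
        case True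
        then have s: "0 < s" "s < 1" by auto
        have c: "0 < q0 * (1 - s)" using q0_pos s by simp
        have "1 / sqrt (q R s) - 1 / sqrt (q a s) \<le> (q a s - q R s) / (2 * (q0 * (1 - s)) * sqrt (q0 * (1 - s)))"
          by (rule inv_sqrt_diff[OF c]) (use qR_lower q_antimono a0 a s in auto)
        also have "\<dots> \<le> (4 * U' R / R\<^sup>2 * (R - a) * (1 - s)) / (2 * (q0 * (1 - s)) * sqrt (q0 * (1 - s)))"
          using c q_lipschitz[OF a, of s] s by (intro divide_right_mono) auto
        also have "\<dots> = D * (R - a) * (1 / sqrt (1 - s))"
          using s q0_pos unfolding D_def by (simp add: real_sqrt_mult divide_simps)
        finally show ?thesis using s by (simp add: slow_scale[OF a0] slow_scale[OF R_pos])
      qed (auto simp: slow_scale[OF a0] slow_scale[OF R_pos])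
    qed (intro Bochner_Integration.integrable_diff integrable_mult_right inv_sqrt_integrable
        slow_scale_integrable R_pos order_refl a0 a)+
    also have "\<dots> = D * (R - a) * I" unfolding I_def by (rule integral_mult_right_zero)
    also have "\<dots> = D * I * (R - a)" by simp
    also have "\<dots> \<le> (D * I + 1) * (R - a)" using a by (simp add: algebra_simps)
    finally show ?thesis .
  qed
  moreover have "0 < D * I + 1" using D I by (simp add: add_nonneg_pos)
  ultimately show ?thesis by blast
qed

lemma slow_part_integrable:
  assumes "0 < a" "a \<le> R" shows "integrable lborel (\<lambda>y. indicator {0..x} y * slow a y)"
  using integrable_mult_indicator[OF _ slow_integrable[OF assms], of "{0..x}"] by simp

lemma time_eq: assumes "0 < a" "a \<le> R" shows "time x a = integral {0..x} (slow a)"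
  unfolding time_def
  using set_borel_integral_eq_integral(2)[of "{0..x}" "slow a"] slow_part_integrable[OF assms, of x]
  by (simp add: set_integrable_def set_lebesgue_integral_def)

lemma time_cont: assumes "0 < a" "a \<le> R" shows "continuous_on {0..c} (\<lambda>x. time x a)"
  unfolding time_eq[OF assms]
  by (rule indefinite_integral_continuous_1)
    (use set_borel_integral_eq_integral(1)[of "{0..c}" "slow a"] slow_part_integrable[OF assms, of c]
      in \<open>simp add: set_integrable_def\<close>)

lemma time_deriv:
  assumes a: "0 < a" "a \<le> R" and x: "0 < x" "x < a"
  shows "((\<lambda>x. time x a) has_real_derivative 1 / speed x a) (at x)"
proof -
  have i: "slow a integrable_on {0..a}"
    using set_borel_integral_eq_integral(1)[of "{0..a}" "slow a"] slow_part_integrable[OF a, of a]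
    by (simp add: set_integrable_def)
  have "continuous_on {0<..<a} (\<lambda>y. 1 / speed y a)"
    by (intro continuous_intros speed_cont ballI) (metis greaterThanLessThan_iff less_imp_le less_irrefl speed_pos)
  then have "continuous_on {0<..<a} (slow a)"
    by (rule continuous_on_eq) (auto simp: slow_def)
  then have "isCont (slow a) x" using x by (simp add: continuous_on_eq_continuous_at)
  then have "((\<lambda>u. integral {0..u} (slow a)) has_vector_derivative slow a x) (at x within ({0..a} - {}))"
    by (intro integral_has_vector_derivative_continuous_at i) (use x in \<open>auto simp: continuous_at_imp_continuous_within\<close>)
  then have "((\<lambda>u. integral {0..u} (slow a)) has_vector_derivative slow a x) (at x)"
    using x by (simp add: at_within_Icc_at)
  then show ?thesis
    unfolding time_eq[OF a] has_real_derivative_iff_has_vector_derivative using x by (simp add: slow_def)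
qed

lemma time_0[simp]: "time 0 a = 0"
proof -
  have "(\<lambda>y. indicator {0..0} y * slow a y) = (\<lambda>y. 0)" by (auto simp: indicator_def slow_def)
  then show ?thesis by (simp add: time_def)
qed

lemma time_ge: "a \<le> x \<Longrightarrow> time x a = quarter a"
  unfolding time_def quarter_def
  by (rule Bochner_Integration.integral_cong) (auto simp: indicator_def slow_def)

lemma time_mono:
  assumes "0 < a" "a \<le> R" "x \<le> y" shows "time x a \<le> time y a"
  unfolding time_def
  by (intro integral_mono slow_part_integrable assms mult_right_mono slow_nonneg)
    (use assms in \<open>auto simp: indicator_def\<close>)

lemma time_nonneg: "0 \<le> time x a"
  unfolding time_def by (intro integral_nonneg_AE AE_I2 mult_nonneg_nonneg slow_nonneg) auto

lemma time_le_quarter: assumes "0 < a" "a \<le> R" shows "time x a \<le> quarter a"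
  using time_mono[OF assms, of x "max x a"] time_ge[of a "max x a"] by simp

text \<open>The speed never exceeds \<open>vmax\<close>. This makes the time strictly increasing and
  later keeps the phases away from both ends of the quarter orbit.\<close>

lemma time_increase:
  assumes a: "0 < a" "a \<le> R" and x: "0 \<le> x" "x \<le> y" "y \<le> a"
  shows "(y - x) / vmax \<le> time y a - time x a"
proof (cases "x = y")
  case False
  then have xy: "x < y" using x by simp
  have "continuous_on {x..y} (\<lambda>x. time x a)"
    by (rule continuous_on_subset[OF time_cont[OF a, of a]]) (use x in auto)
  moreover have der: "((\<lambda>x. time x a) has_real_derivative 1 / speed z a) (at z)" if "x < z" "z < y" for z
    using that x by (intro time_deriv a) auto
  ultimately obtain l c where c: "x < c" "c < y" "((\<lambda>x. time x a) has_real_derivative l) (at c)"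
      "time y a - time x a = (y - x) * l"
    using MVT[OF xy, of "\<lambda>x. time x a"] real_differentiable_def by blast
  have l: "l = 1 / speed c a" by (rule DERIV_unique[OF c(3) der[OF c(1,2)]])
  have "1 / vmax \<le> 1 / speed c a"
    using speed_pos[of c a] speed_le_vmax[of c a] c x a by (intro divide_left_mono) (auto intro: mult_pos_pos vmax_pos)
  then have "(y - x) * (1 / vmax) \<le> (y - x) * (1 / speed c a)" using xy by (intro mult_left_mono) auto
  then show ?thesis using c l by simp
qed simp

lemma time_less_quarter:
  assumes a: "0 < a" "a \<le> R" and x: "0 \<le> x" "x < a"
  shows "time x a < quarter a"
proof -
  have "0 < (a - x) / vmax" using x vmax_pos by simp
  then show ?thesis using time_increase[OF a, of x a] x time_ge[of a a] by simp
qed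

lemma quarter_pos: assumes "0 < a" "a \<le> R" shows "0 < quarter a"
  using time_less_quarter[OF assms, of 0] assms by simp

lemma time_meas[measurable]: "case_prod time \<in> borel_measurable (borel \<Otimes>\<^sub>M borel)"
proof -
  have "(\<lambda>z. LINT y|lborel. (if 0 \<le> y \<and> y \<le> fst z then slow (snd z) y else 0)) \<in> borel_measurable (borel \<Otimes>\<^sub>M borel)"
    by measurable
  also have "(\<lambda>z. LINT y|lborel. (if 0 \<le> y \<and> y \<le> fst z then slow (snd z) y else 0)) = case_prod time"
    by (auto simp: time_def indicator_def fun_eq_iff intro!: Bochner_Integration.integral_cong)
  finally show ?thesis .
qed

lemma quarter_meas[measurable]: "quarter \<in> borel_measurable borel"
  unfolding quarter_def by measurable

end

section \<open>The Green kernel\<close>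

lemma (in pair_sigma_finite) integrable_times:
  fixes f :: "_ \<Rightarrow> real" and g :: "_ \<Rightarrow> real"
  assumes f: "integrable M1 f" and g: "integrable M2 g"
  shows "integrable (M1 \<Otimes>\<^sub>M M2) (\<lambda>(x, y). f x * g y)"
proof (rule Fubini_integrable)
  have [measurable]: "f \<in> borel_measurable M1" "g \<in> borel_measurable M2" using f g by auto
  show "(\<lambda>(x, y). f x * g y) \<in> borel_measurable (M1 \<Otimes>\<^sub>M M2)" by measurable
  show "integrable M1 (\<lambda>x. LINT y|M2. norm (case (x, y) of (x, y) \<Rightarrow> f x * g y))"
    using f by (simp add: abs_mult)
  show "AE x in M1. integrable M2 (\<lambda>y. case (x, y) of (x, y) \<Rightarrow> f x * g y)"
    using g by simp
qed

lemma lebesgue_integral_even: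
  fixes f :: "real \<Rightarrow> real"
  assumes f: "integrable lborel f" and even: "\<And>x. f (- x) = f x"
  shows "(LINT x|lborel. f x) = 2 * (LINT x:{0<..}|lborel. f x)"
proof -
  have i: "integrable lborel (\<lambda>x. indicator S x * f x)" if "S \<in> sets borel" for S
    using integrable_mult_indicator[OF _ f, of S] that by simp
  have "(LINT x|lborel. f x) = (LINT x|lborel. indicator {0<..} x * f x + indicator {..<0} x * f x)"
  proof (rule integral_cong_AE)
    have "AE x in lborel. x \<noteq> (0::real)" by (rule AE_lborel_singleton)
    then show "AE x in lborel. f x = indicator {0<..} x * f x + indicator {..<0} x * f x"
      by eventually_elim (auto simp: indicator_def)
  qed (use f i[of "{0<..}"] i[of "{..<0}"] in auto)
  also have "\<dots> = (LINT x|lborel. indicator {0<..} x * f x) + (LINT x|lborel. indicator {..<0} x * f x)"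
    by (intro Bochner_Integration.integral_add i) auto
  also have "(LINT x|lborel. indicator {..<0} x * f x) = (LINT x|lborel. indicator {0<..} x * f x)"
    using lborel_integral_real_affine[of "-1" "\<lambda>x. indicator {..<0} x * f x" 0]
    by (simp add: even indicator_def)
  finally show ?thesis by (simp add: set_lebesgue_integral_def)
qed

context planar_potential
begin

text \<open>At fixed x the turning point a replaces the velocity v = speed x a. The Jacobian U' a /
  speed x a may be unbounded as a decreases to x, so the substitution is carried out on
  \<open>{c n..R}\<close> and extended by monotone convergence.\<close>

lemma speed_substitution:
  fixes f :: "real \<Rightarrow> ennreal"
  assumes f[measurable]: "f \<in> borel_measurable borel" and x: "0 \<le> x" "x < R"
  shows "(\<integral>\<^sup>+v. f v * indicator {0<..speed x R} v \<partial>lborel) =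
     (\<integral>\<^sup>+a. f (speed x a) * ennreal (U' a / speed x a) * indicator {x<..R} a \<partial>lborel)"
proof -
  \<comment> \<open>The summand 2 keeps every \<open>c n\<close> strictly below R.\<close>
  define c where "c n = x + (R - x) / (n + 2)" for n :: nat
  have c: "x < c n" "c n < R" for n
  proof -
    have "(R - x) / (real n + 2) < R - x" using x by (simp add: divide_less_eq)
    then show "x < c n" "c n < R" using x by (auto simp: c_def add.commute)
  qed
  have cdec: "c n \<le> c m" if "m \<le> n" for m n
    using x that by (auto simp: c_def intro!: divide_left_mono)
  have clim: "c \<longlonglongrightarrow> x"
  proof -
    have "(\<lambda>n. (R - x) / (real n + 2)) \<longlonglongrightarrow> 0"
      by (rule tendsto_divide_0[OF tendsto_const])
        (simp add: filterlim_at_infinity_imp_norm_at_top filterlim_real_sequentially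
          filterlim_at_top_imp_at_infinity filterlim_tendsto_add_at_top[OF tendsto_const, of _ _ 2, simplified add.commute])
    from tendsto_add[OF tendsto_const this, of x] show ?thesis by (simp add: c_def[abs_def] add.commute)
  qed
  have mono: "speed x a \<le> speed x b" if "x \<le> a" "a \<le> b" for a b
    using that x by (simp add: speed_def U_le_iff)
  have smono: "speed x a < speed x b" if "x \<le> a" "a < b" for a b
    using that x U_strict[of a b] by (simp add: speed_def)
  let ?l = "\<lambda>n v. f v * indicator {speed x (c n)..speed x R} v"
  let ?r = "\<lambda>n a. f (speed x a) * ennreal (U' a / speed x a) * indicator {c n..R} a"
  have eq: "integral\<^sup>N lborel (?l n) = integral\<^sup>N lborel (?r n)" for n
  proof (rule nn_integral_substitution_aux[OF f _ _ _ _ c(2)])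
    fix a assume a: "a \<in> {c n..R}"
    then have xa: "x < a" using c(1)[of n] by auto
    show "(speed x has_real_derivative U' a / speed x a) (at a)" by (rule speed_deriv(2)[OF x(1) xa])
    show "0 \<le> U' a / speed x a" using U'_nonneg[of a] speed_nonneg[of x a] x xa by simp
  next
    have "speed x a \<noteq> 0" if "a \<in> {c n..R}" for a
      using speed_pos[of x a] x c(1)[of n] that by auto
    then show "continuous_on {c n..R} (\<lambda>a. U' a / speed x a)"
      by (intro continuous_intros speed_cont U'_cont) auto
  qed simp
  have ev: "\<forall>\<^sub>F n in sequentially. c n < a" if "x < a" for a
    using order_tendstoD(2)[OF clim that] .
  have "(\<lambda>n. integral\<^sup>N lborel (?l n)) \<longlonglongrightarrow> (\<integral>\<^sup>+v. f v * indicator {0<..speed x R} v \<partial>lborel)"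
  proof (rule nn_integral_LIMSEQ)
    show "incseq ?l"
    proof (intro incseq_SucI le_funI mult_left_mono)
      fix n v
      have "speed x (c (Suc n)) \<le> speed x (c n)" using c[of "Suc n"] cdec[of n "Suc n"] by (intro mono) auto
      then show "indicator {speed x (c n)..speed x R} v \<le> (indicator {speed x (c (Suc n))..speed x R} v :: ennreal)"
        by (auto simp: indicator_def)
    qed simp
    fix v
    show "(\<lambda>n. ?l n v) \<longlonglongrightarrow> f v * indicator {0<..speed x R} v"
    proof (cases "0 < v")
      case True
      have "((\<lambda>n. speed x (c n)) \<longlonglongrightarrow> speed x x)"
        using continuous_on_tendsto_compose[OF speed_cont(2)[of UNIV x] clim] by simp
      then have "\<forall>\<^sub>F n in sequentially. speed x (c n) < v" using True by (intro order_tendstoD(2)) auto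
      then have "\<forall>\<^sub>F n in sequentially. ?l n v = f v * indicator {0<..speed x R} v"
        by eventually_elim (use True in \<open>auto simp: indicator_def\<close>)
      then show ?thesis by (rule tendsto_eventually)
    next
      case False
      then have "?l n v = 0" for n using speed_pos[of x "c n"] c[of n] x by (auto simp: indicator_def)
      moreover have "f v * indicator {0<..speed x R} v = 0" using False by simp
      ultimately show ?thesis by (simp only: tendsto_const)
    qed
  qed measurable
  moreover have "(\<lambda>n. integral\<^sup>N lborel (?r n)) \<longlonglongrightarrow>
      (\<integral>\<^sup>+a. f (speed x a) * ennreal (U' a / speed x a) * indicator {x<..R} a \<partial>lborel)"
  proof (rule nn_integral_LIMSEQ)
    show "incseq ?r"
    proof (intro incseq_SucI le_funI mult_left_mono)
      fix n a
      show "indicator {c n..R} a \<le> (indicator {c (Suc n)..R} a :: ennreal)"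
        using cdec[of n "Suc n"] by (auto simp: indicator_def)
    qed simp
    fix a
    show "(\<lambda>n. ?r n a) \<longlonglongrightarrow> f (speed x a) * ennreal (U' a / speed x a) * indicator {x<..R} a"
    proof (cases "x < a")
      case True
      have "\<forall>\<^sub>F n in sequentially. ?r n a = f (speed x a) * ennreal (U' a / speed x a) * indicator {x<..R} a"
        using ev[OF True] by eventually_elim (use True in \<open>auto simp: indicator_def\<close>)
      then show ?thesis by (rule tendsto_eventually)
    next
      case False
      then have "?r n a = 0" for n using c[of n] by (auto simp: indicator_def)
      moreover have "f (speed x a) * ennreal (U' a / speed x a) * indicator {x<..R} a = 0" using False by simp
      ultimately show ?thesis by (simp only: tendsto_const)
    qed
  qed measurable
  ultimately show ?thesis unfolding eq by (rule LIMSEQ_unique)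
qed

lemma speed_substitution_open:
  fixes f :: "real \<Rightarrow> ennreal"
  assumes f[measurable]: "f \<in> borel_measurable borel" and x: "0 \<le> x" "x < R"
  shows "(\<integral>\<^sup>+v. f v * indicator {0<..<speed x R} v \<partial>lborel) =
     (\<integral>\<^sup>+a. f (speed x a) * ennreal (U' a / speed x a) * indicator {x<..<R} a \<partial>lborel)"
proof -
  let ?f = "\<lambda>v. f v * indicator {..<speed x R} v"
  have "(\<integral>\<^sup>+v. f v * indicator {0<..<speed x R} v \<partial>lborel) = (\<integral>\<^sup>+v. ?f v * indicator {0<..speed x R} v \<partial>lborel)"
    by (rule nn_integral_cong) (auto simp: indicator_def)
  also have "\<dots> = (\<integral>\<^sup>+a. ?f (speed x a) * ennreal (U' a / speed x a) * indicator {x<..R} a \<partial>lborel)"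
    by (rule speed_substitution) (use x in auto)
  also have "\<dots> = (\<integral>\<^sup>+a. f (speed x a) * ennreal (U' a / speed x a) * indicator {x<..<R} a \<partial>lborel)"
    by (rule nn_integral_cong) (use x U_less_iff in \<open>auto simp: indicator_def speed_def\<close>)
  finally show ?thesis .
qed

end

section \<open>The sine solution sin (c t) / c, continuous down to c = 0\<close>

definition sinc :: "real \<Rightarrow> real" where "sinc u = (if u = 0 then 1 else sin u / u)"

lemma sinc_cont: "continuous_on S sinc"
proof -
  have "isCont sinc u" for u
  proof (cases "u = 0")
    case True
    have "((\<lambda>u. sin u / u) \<longlongrightarrow> 1) (at (0::real))"
      using DERIV_sin[of 0] unfolding has_field_derivative_iff by simp
    then have "(sinc \<longlongrightarrow> 1) (at 0)"
      by (rule Lim_transform_eventually) (auto simp: eventually_at_filter sinc_def)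
    then have "(sinc \<longlongrightarrow> sinc 0) (at 0)" by (simp add: sinc_def)
    then show ?thesis using True by (simp add: isCont_def)
  next
    case False
    have "continuous_on (- {0}) (\<lambda>u. sin u / u :: real)" by (intro continuous_intros) auto
    then have "continuous_on (- {0}) sinc" by (rule continuous_on_eq) (auto simp: sinc_def)
    then show ?thesis using False by (simp add: continuous_on_eq_continuous_at open_Compl)
  qed
  then show ?thesis by (simp add: continuous_at_imp_continuous_on)
qed

lemma sinc_pos: "0 \<le> u \<Longrightarrow> u < pi \<Longrightarrow> 0 < sinc u"
  by (auto simp: sinc_def sin_gt_zero)

lemma sinc_le_1: "0 \<le> u \<Longrightarrow> sinc u \<le> 1"
  using sin_x_le_x[of u] by (auto simp: sinc_def)

text \<open>\<open>sn c t = sin (c t) / c\<close>, with the value \<open>t\<close> at \<open>c = 0\<close>.\<close>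
definition sn :: "real \<Rightarrow> real \<Rightarrow> real" where "sn c t = t * sinc (c * t)"

lemma sn_eq: "c \<noteq> 0 \<Longrightarrow> sn c t = sin (c * t) / c"
  by (simp add: sn_def sinc_def)

lemma sn_zero_left[simp]: "sn 0 t = t" by (simp add: sn_def sinc_def)

lemma sn_0[simp]: "sn c 0 = 0" by (simp add: sn_def)

lemma sn_cont: "continuous_on S f \<Longrightarrow> continuous_on S g \<Longrightarrow> continuous_on S (\<lambda>z. sn (f z) (g z))"
  unfolding sn_def by (intro continuous_intros continuous_on_compose2[OF sinc_cont[of UNIV]]) auto

lemma sinc_meas[measurable]: "sinc \<in> borel_measurable borel"
  by (intro borel_measurable_continuous_onI sinc_cont)

lemma sn_meas[measurable]: "sn c \<in> borel_measurable borel"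
  unfolding sn_def[abs_def] by measurable

lemma sn_nonneg: "0 \<le> c \<Longrightarrow> 0 \<le> t \<Longrightarrow> c * t < pi \<Longrightarrow> 0 \<le> sn c t"
  unfolding sn_def using sinc_pos[of "c * t"] by (simp add: less_imp_le)

lemma sn_pos: "0 \<le> c \<Longrightarrow> 0 < t \<Longrightarrow> c * t < pi \<Longrightarrow> 0 < sn c t"
  unfolding sn_def using sinc_pos[of "c * t"] by simp

lemma sn_le: "0 \<le> c \<Longrightarrow> 0 \<le> t \<Longrightarrow> sn c t \<le> t"
  unfolding sn_def using sinc_le_1[of "c * t"] by (simp add: mult_left_le)

section \<open>Steady states and the kernel obtained by superposing orbits\<close>

locale planar_steady = planar_potential +
  fixes \<alpha> A :: "real \<Rightarrow> real" and A0 :: real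
  assumes alpha_cont: "continuous_on UNIV \<alpha>"
    and alpha_deriv: "\<And>E. E < U R \<Longrightarrow> (\<alpha> has_real_derivative - A E) (at E)"
    and alpha_zero: "\<And>E. U R \<le> E \<Longrightarrow> \<alpha> E = 0"
    and A_meas[measurable]: "A \<in> borel_measurable borel"
    and A0: "0 < A0"
    and A_lower: "\<And>E. U 0 \<le> E \<Longrightarrow> E < U R \<Longrightarrow> A0 \<le> A E"
    and rho_eq: "\<And>x. \<rho> x = (LINT v|lborel. \<alpha> (v\<^sup>2 / 2 + U x))"
begin

text \<open>This is - d/da of \<alpha> (U a), that is |\<alpha>'(E)| dE expressed in the turning
  point.\<close>

definition w :: "real \<Rightarrow> real" where "w a = (if 0 < a \<and> a < R then A (U a) * U' a else 0)"

lemma A_U_lower: "0 < a \<Longrightarrow> a < R \<Longrightarrow> A0 \<le> A (U a)"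
  by (intro A_lower) (use U_strict in \<open>auto intro: less_imp_le\<close>)

lemma w_pos: "0 < a \<Longrightarrow> a < R \<Longrightarrow> 0 < w a"
  using A_U_lower[of a] A0 U'_pos[of a] by (simp add: w_def)

lemma w_nonneg: "0 \<le> w a"
  using w_pos[of a] by (cases "0 < a \<and> a < R") (auto simp: w_def)

lemma w_meas[measurable]: "w \<in> borel_measurable borel"
  unfolding w_def[abs_def] by measurable

text \<open>The primitive - \<alpha> (U a) is continuous up to a = R, so the mass is finite even if
  |\<alpha>'| is unbounded at the boundary energy.\<close>

lemma w_integrable: "integrable lborel w"
proof -
  have "set_integrable lborel {0<..<R} (\<lambda>a. A (U a) * U' a)"
  proof (rule FTC_open_nonneg(1)[of 0 R "\<lambda>a. - \<alpha> (U a)"])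
    show "continuous_on {0..R} (\<lambda>a. - \<alpha> (U a))"
      by (intro continuous_intros continuous_on_compose2[OF alpha_cont] U_cont) auto
    fix a assume a: "0 < a" "a < R"
    have "((\<lambda>a. \<alpha> (U a)) has_real_derivative - A (U a) * U' a) (at a)"
      by (rule DERIV_chain2[OF alpha_deriv U_deriv]) (use a U_strict in auto)
    then show "((\<lambda>a. - \<alpha> (U a)) has_real_derivative A (U a) * U' a) (at a)"
      using DERIV_minus by fastforce
    show "0 \<le> A (U a) * U' a" using w_pos[OF a] a by (simp add: w_def)
  qed (use R_pos in auto)
  moreover have "(\<lambda>a. indicator {0<..<R} a * (A (U a) * U' a)) = w"
    by (auto simp: w_def indicator_def)
  ultimately show ?thesis by (simp add: set_integrable_def)
qed

text \<open>Integration by parts in v turns \<rho> x into twice the integral of v^2 A over (0, speed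
  x R), without boundary term because \<alpha> vanishes at the boundary energy. Under v = speed x a
  the measure v^2 A dv becomes w a (speed x a) da.\<close>

lemma rho_speed:
  assumes x: "0 \<le> x" "x < R"
  shows "integrable lborel (\<lambda>a. indicator {x<..<R} a * (w a * speed x a))"
    "\<rho> x = 2 * (LINT a:{x<..<R}|lborel. w a * speed x a)"
proof -
  let ?m = "speed x R"
  let ?E = "\<lambda>v. v\<^sup>2 / 2 + U x"
  have m: "0 < ?m" using speed_pos x by simp
  have Elt: "?E v < U R \<longleftrightarrow> \<bar>v\<bar> < ?m" for v
  proof -
    have "?E v < U R \<longleftrightarrow> v\<^sup>2 < 2 * (U R - U x)" by auto
    also have "\<dots> \<longleftrightarrow> \<bar>v\<bar>\<^sup>2 < ?m\<^sup>2" using speed_sq[of x R] x by simp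
    also have "\<dots> \<longleftrightarrow> \<bar>v\<bar> < ?m" using m by (metis abs_ge_zero less_imp_le power2_less_imp_less power_strict_mono zero_less_numeral)
    finally show ?thesis .
  qed
  have cont: "continuous_on S (\<lambda>v. \<alpha> (?E v))" for S
    by (intro continuous_on_compose2[OF alpha_cont] continuous_intros) auto
  have supp: "\<alpha> (?E v) = indicator {-?m..?m} v * \<alpha> (?E v)" for v
    using alpha_zero[of "?E v"] Elt[of v] by (auto simp: indicator_def)
  have int: "integrable lborel (\<lambda>v. \<alpha> (?E v))"
    using borel_integrable_atLeastAtMost'[OF cont, of "-?m" ?m] supp
    by (simp add: set_integrable_def flip: supp)
  have "\<rho> x = 2 * (LINT v:{0<..}|lborel. \<alpha> (?E v))"
    unfolding rho_eq by (rule lebesgue_integral_even[OF int]) simp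
  also have "(LINT v:{0<..}|lborel. \<alpha> (?E v)) = (LINT v:{0..?m}|lborel. \<alpha> (?E v))"
    unfolding set_lebesgue_integral_def
  proof (rule integral_cong_AE)
    have "AE v in lborel. v \<noteq> (0::real)" by (rule AE_lborel_singleton)
    then show "AE v in lborel. indicator {0<..} v *\<^sub>R \<alpha> (?E v) = indicator {0..?m} v *\<^sub>R \<alpha> (?E v)"
      by eventually_elim (use supp in \<open>auto simp: indicator_def split: if_splits\<close>)
  qed (use int in auto)
  also have "\<dots> = integral {0..?m} (\<lambda>v. \<alpha> (?E v))"
    by (intro set_borel_integral_eq_integral(2) borel_integrable_atLeastAtMost' cont)
  finally have rho1: "\<rho> x = 2 * integral {0..?m} (\<lambda>v. \<alpha> (?E v))" .
  \<comment> \<open>The primitive of v^2 A that the product rule suggests; its second term vanishes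
    at both ends 0 and \<open>?m\<close>.\<close>
  let ?F = "\<lambda>u. integral {0..u} (\<lambda>v. \<alpha> (?E v)) - u * \<alpha> (?E u)"
  have F: "(?F has_real_derivative v\<^sup>2 * A (?E v)) (at v)" if v: "0 < v" "v < ?m" for v
  proof -
    have 1: "((\<lambda>u. integral {0..u} (\<lambda>v. \<alpha> (?E v))) has_real_derivative \<alpha> (?E v)) (at v)"
      using integral_has_real_derivative[OF cont, of v 0 ?m] v by (simp add: at_within_Icc_at)
    have "((\<lambda>u. \<alpha> (?E u)) has_real_derivative - A (?E v) * v) (at v)"
      by (rule DERIV_chain2[OF alpha_deriv]) (use v Elt in \<open>auto intro!: derivative_eq_intros\<close>)
    from DERIV_diff[OF 1 DERIV_mult[OF DERIV_ident this]] show ?thesis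
      by (rule DERIV_cong) (simp add: power2_eq_square)
  qed
  have Fc: "continuous_on {0..?m} ?F"
    by (intro continuous_intros indefinite_integral_continuous_1 integrable_continuous_interval cont)
  have Apos: "0 \<le> v\<^sup>2 * A (?E v)" if "0 < v" "v < ?m" for v
  proof -
    have "U 0 \<le> ?E v" using U_le_iff[of 0 x] x by (auto intro: add_increasing)
    then have "A0 \<le> A (?E v)" using Elt[of v] that by (intro A_lower) auto
    then show ?thesis using A0 by simp
  qed
  have "(\<lambda>v. v\<^sup>2 * A (?E v)) \<in> borel_measurable borel" by measurable
  note FTC = FTC_open_nonneg[OF less_imp_le[OF m] Fc F this Apos]
  have "?F ?m - ?F 0 = integral {0..?m} (\<lambda>v. \<alpha> (?E v))"
    using alpha_zero[of "?E ?m"] Elt[of ?m] m by simp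
  with FTC(2) rho1 have rho2: "\<rho> x = 2 * (LINT v:{0<..<?m}|lborel. v\<^sup>2 * A (?E v))" by simp
  have nn: "(\<integral>\<^sup>+v. ennreal (indicator {0<..<?m} v * (v\<^sup>2 * A (?E v))) \<partial>lborel)
     = (\<integral>\<^sup>+a. ennreal (indicator {x<..<R} a * (w a * speed x a)) \<partial>lborel)"
  proof -
    have "(\<integral>\<^sup>+v. ennreal (indicator {0<..<?m} v * (v\<^sup>2 * A (?E v))) \<partial>lborel)
       = (\<integral>\<^sup>+v. ennreal (v\<^sup>2 * A (?E v)) * indicator {0<..<?m} v \<partial>lborel)"
      by (rule nn_integral_cong) (auto simp: indicator_def)
    also have "\<dots> = (\<integral>\<^sup>+a. ennreal ((speed x a)\<^sup>2 * A (?E (speed x a))) * ennreal (U' a / speed x a) * indicator {x<..<R} a \<partial>lborel)"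
      by (rule speed_substitution_open) (use x in auto)
    also have "\<dots> = (\<integral>\<^sup>+a. ennreal (indicator {x<..<R} a * (w a * speed x a)) \<partial>lborel)"
    proof (rule nn_integral_cong)
      fix a
      show "ennreal ((speed x a)\<^sup>2 * A (?E (speed x a))) * ennreal (U' a / speed x a) * indicator {x<..<R} a
          = ennreal (indicator {x<..<R} a * (w a * speed x a))"
      proof (cases "x < a \<and> a < R")
        case True
        then have p: "0 < speed x a" "(speed x a)\<^sup>2 = 2 * (U a - U x)" using speed_pos[of x a] speed_sq[of x a] x by auto
        have "0 < A (U a)" using A_U_lower[of a] A0 True x by simp
        then have "ennreal ((speed x a)\<^sup>2 * A (U a)) * ennreal (U' a / speed x a) = ennreal (w a * speed x a)"
          using True p(1) x U'_nonneg[of a] by (simp add: w_def power2_eq_square flip: ennreal_mult)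
        moreover have "?E (speed x a) = U a" unfolding p(2) by (simp add: field_simps)
        ultimately show ?thesis using True by simp
      qed auto
    qed
    finally show ?thesis .
  qed
  have nonneg: "0 \<le> indicator {x<..<R} a * (w a * speed x a)" for a
    using w_nonneg[of a] speed_nonneg[of x a] x by (auto simp: indicator_def)
  have nonneg': "0 \<le> indicator {0<..<?m} v * (v\<^sup>2 * A (?E v))" for v
    using Apos by (auto simp: indicator_def)
  have meas: "(\<lambda>a. indicator {x<..<R} a * (w a * speed x a)) \<in> borel_measurable lborel" by measurable
  have "(\<integral>\<^sup>+v. ennreal (indicator {0<..<?m} v * (v\<^sup>2 * A (?E v))) \<partial>lborel) < \<infinity>"
    using FTC(1) nonneg' by (simp add: set_integrable_def integrable_iff_bounded)
  then show int: "integrable lborel (\<lambda>a. indicator {x<..<R} a * (w a * speed x a))"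
    unfolding nn using nonneg by (intro integrableI_nonneg meas) auto
  show "\<rho> x = 2 * (LINT a:{x<..<R}|lborel. w a * speed x a)"
    unfolding rho2 set_lebesgue_integral_def real_scaleR_def
    by (subst (1 2) integral_eq_nn_integral) (use meas nonneg nonneg' nn in auto)
qed

text \<open>The Green function of - d^2/dt^2 - c^2 on the quarter orbit with Dirichlet conditions at
  both ends, written in positions instead of times. It vanishes as soon as x or y passes the turning
  point, where \<open>time\<close> equals \<open>quarter a\<close>.\<close>

definition green :: "real \<Rightarrow> real \<Rightarrow> real \<Rightarrow> real \<Rightarrow> real" where
  "green c x y a = sn c (time (min x y) a) * sn c (quarter a - time (max x y) a) / sn c (quarter a)"

text \<open>The constant is 4 pi from the operator B times 2 for the two signs of v1.\<close>

definition kernel :: "real \<Rightarrow> real \<Rightarrow> real \<Rightarrow> real" where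
  "kernel c x y = 8 * pi * (LINT a|lborel. w a * green c x y a)"

lemma green_meas[measurable]:
  assumes [measurable]: "f \<in> borel_measurable M" "g \<in> borel_measurable M" "h \<in> borel_measurable M"
  shows "(\<lambda>z. green c (f z) (g z) (h z)) \<in> borel_measurable M"
  unfolding green_def by measurable

lemma green_sym: "green c x y a = green c y x a"
  by (simp add: green_def min.commute max.commute)

context
  fixes b :: real
  assumes b: "0 \<le> b" "b * quarter R < pi"
begin

lemma phase_less:
  assumes "0 \<le> c" "c \<le> b" "0 < a" "a \<le> R" "0 \<le> t" "t \<le> quarter a" shows "c * t < pi" "c * t \<le> b * quarter R"
proof -
  show "c * t \<le> b * quarter R" using assms quarter_mono[of a] b by (intro mult_mono) auto
  then show "c * t < pi" using b by simp
qed

lemma green_nonneg: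
  assumes "0 \<le> c" "c \<le> b" "0 < a" "a \<le> R"
  shows "0 \<le> green c x y a"
  unfolding green_def using assms time_nonneg time_le_quarter[OF assms(3,4)] quarter_pos[OF assms(3,4)]
  by (intro divide_nonneg_nonneg mult_nonneg_nonneg sn_nonneg phase_less(1)[OF assms]) auto

text \<open>All phases lie in the compact interval [0, b quarter R] below pi, on which sinc has a
  positive minimum.\<close>

lemma sn_quarter_lower:
  "\<exists>m>0. \<forall>c\<in>{0..b}. \<forall>a. 0 < a \<longrightarrow> a \<le> R \<longrightarrow> m * quarter a \<le> sn c (quarter a)"
proof -
  have "0 \<le> b * quarter R" using b quarter_pos[OF R_pos] by simp
  then obtain u where u: "u \<in> {0..b * quarter R}" "\<And>z. z \<in> {0..b * quarter R} \<Longrightarrow> sinc u \<le> sinc z"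
    using continuous_attains_inf[OF compact_Icc _ sinc_cont, of 0 "b * quarter R"] by fastforce
  have "0 < sinc u" using u b by (intro sinc_pos) auto
  moreover have "sinc u * quarter a \<le> sn c (quarter a)" if "c \<in> {0..b}" "0 < a" "a \<le> R" for c a
    using u(2)[of "c * quarter a"] phase_less(2)[of c a "quarter a"] that quarter_pos[of a]
    by (simp add: sn_def mult.commute)
  ultimately show ?thesis by blast
qed

text \<open>The numerator is at most (quarter a)^2 and the denominator at least m quarter a, so
  nothing degenerates for small orbits and a multiple of \<open>w\<close> is an integrable
  majorant.\<close>

lemma green_bound: "\<exists>B\<ge>0. \<forall>c\<in>{0..b}. \<forall>x y a. 0 < a \<longrightarrow> a \<le> R \<longrightarrow> \<bar>green c x y a\<bar> \<le> B"
proof -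
  obtain m where m: "0 < m" "\<And>c a. c \<in> {0..b} \<Longrightarrow> 0 < a \<Longrightarrow> a \<le> R \<Longrightarrow> m * quarter a \<le> sn c (quarter a)"
    using sn_quarter_lower by blast
  have "\<bar>green c x y a\<bar> \<le> quarter R / m" if c: "c \<in> {0..b}" and a: "0 < a" "a \<le> R" for c x y a
  proof -
    let ?L = "quarter a"
    have L: "0 < ?L" by (rule quarter_pos[OF a])
    have "green c x y a \<le> (?L * ?L) / (m * ?L)"
      unfolding green_def
    proof (rule frac_le)
      have t: "sn c t \<le> ?L" "0 \<le> sn c t" if "0 \<le> t" "t \<le> ?L" for t
        using sn_le[of c t] sn_nonneg[of c t] phase_less(1)[of c a t] c a that by auto
      show "sn c (time (min x y) a) * sn c (?L - time (max x y) a) \<le> ?L * ?L"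
        using time_nonneg time_le_quarter[OF a] L by (intro mult_mono t) auto
    qed (use m(2)[OF c a] m(1) L in auto)
    also have "\<dots> \<le> quarter R / m" using L m(1) quarter_mono[OF a] by (simp add: divide_right_mono)
    finally show ?thesis using green_nonneg[of c a x y] c a by simp
  qed
  moreover have "0 \<le> quarter R / m" using m(1) quarter_pos[OF R_pos] by simp
  ultimately show ?thesis by blast
qed

lemma w_green_integrable:
  assumes c: "c \<in> {0..b}" shows "integrable lborel (\<lambda>a. w a * green c x y a)"
proof -
  obtain B where B: "\<forall>c\<in>{0..b}. \<forall>x y a. 0 < a \<longrightarrow> a \<le> R \<longrightarrow> \<bar>green c x y a\<bar> \<le> B" using green_bound by blast
  show ?thesis
  proof (rule Bochner_Integration.integrable_bound[OF integrable_mult_right[OF w_integrable, of B]])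
    show "AE a in lborel. norm (w a * green c x y a) \<le> norm (B * w a)"
    proof (rule AE_I2)
      fix a show "norm (w a * green c x y a) \<le> norm (B * w a)"
      proof (cases "0 < a \<and> a < R")
        case True
        then have "\<bar>green c x y a\<bar> \<le> B" using B c by simp
        then have "\<bar>green c x y a\<bar> \<le> \<bar>B\<bar>" by linarith
        then show ?thesis using mult_left_mono[of "\<bar>green c x y a\<bar>" "\<bar>B\<bar>" "\<bar>w a\<bar>"] by (simp add: abs_mult mult.commute)
      qed (auto simp: w_def)
    qed
  qed measurable
qed

lemma kernel_nonneg: assumes "c \<in> {0..b}" shows "0 \<le> kernel c x y"
proof -
  have "0 \<le> w a * green c x y a" for a
    using w_nonneg[of a] green_nonneg[of c a x y] assms by (cases "0 < a \<and> a < R") (auto simp: w_def)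
  then have "0 \<le> (LINT a|lborel. w a * green c x y a)" by (intro integral_nonneg_AE AE_I2)
  then show ?thesis unfolding kernel_def by simp
qed

lemma green_cont:
  assumes a: "0 < a" "a \<le> R"
  shows "continuous_on ({0..b} \<times> {0..R} \<times> {0..R}) (\<lambda>(c, x, y). green c x y a)"
proof -
  have "continuous_on ({0..b} \<times> {0..R} \<times> {0..R}) (\<lambda>z. green (fst z) (fst (snd z)) (snd (snd z)) a)"
    unfolding green_def
  proof (intro continuous_intros sn_cont continuous_on_compose2[OF time_cont[OF a, of R]] ballI)
    fix z assume "z \<in> {0..b} \<times> {0..R} \<times> {0..R}"
    then show "sn (fst z) (quarter a) \<noteq> 0"
      using sn_pos[of "fst z" "quarter a"] phase_less(1)[of "fst z" a "quarter a"] quarter_pos[OF a] a by auto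
  qed auto
  then show ?thesis by (simp add: case_prod_beta)
qed

text \<open>Dominated convergence over the orbits. Continuity jointly in c, x and y is what the
  supremum over parameters relies on.\<close>

lemma kernel_cont: "continuous_on ({0..b} \<times> {0..R} \<times> {0..R}) (\<lambda>(c, x, y). kernel c x y)"
proof -
  obtain B where B: "\<forall>c\<in>{0..b}. \<forall>x y a. 0 < a \<longrightarrow> a \<le> R \<longrightarrow> \<bar>green c x y a\<bar> \<le> B" using green_bound by blast
  let ?S = "{0..b} \<times> {0..R} \<times> {0..R}"
  let ?g = "\<lambda>z a. w a * (case z of (c, x, y) \<Rightarrow> green c x y a)"
  have "continuous_on ?S (\<lambda>z. LINT a|lborel. ?g z a)"
    unfolding continuous_on_sequentially comp_def
  proof (intro allI ballI impI, elim conjE)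
    fix X z assume z: "z \<in> ?S" and X: "\<forall>n. X n \<in> ?S" and lim: "X \<longlonglongrightarrow> z"
    have meas: "(\<lambda>a. ?g z a) \<in> borel_measurable lborel" for z by (cases z) (auto intro!: borel_measurable_times green_meas)
    show "(\<lambda>n. LINT a|lborel. ?g (X n) a) \<longlonglongrightarrow> (LINT a|lborel. ?g z a)"
    proof (rule integral_dominated_convergence[where w = "\<lambda>a. B * w a"])
      show "AE a in lborel. (\<lambda>n. ?g (X n) a) \<longlonglongrightarrow> ?g z a"
      proof (rule AE_I2)
        fix a show "(\<lambda>n. ?g (X n) a) \<longlonglongrightarrow> ?g z a"
        proof (cases "0 < a \<and> a < R")
          case True
          then have "continuous_on ?S (\<lambda>(c, x, y). green c x y a)" by (intro green_cont) auto
          from continuous_on_tendsto_compose[OF this lim z] X show ?thesis by (intro tendsto_intros) auto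
        qed (auto simp: w_def)
      qed
      fix n show "AE a in lborel. norm (?g (X n) a) \<le> B * w a"
      proof (rule AE_I2)
        fix a show "norm (?g (X n) a) \<le> B * w a"
        proof (cases "0 < a \<and> a < R")
          case True
          obtain c x y where "X n = (c, x, y)" "c \<in> {0..b}" using X by (metis SigmaE)
          moreover from this have "\<bar>green c x y a\<bar> \<le> B" using True B by simp
          ultimately show ?thesis using mult_right_mono[of "\<bar>green c x y a\<bar>" B "w a"] w_nonneg[of a]
            by (simp add: abs_mult mult.commute)
        qed (auto simp: w_def)
      qed
    qed (use meas w_integrable in auto)
  qed
  from continuous_on_mult_left[OF this, of "8 * pi"] show ?thesis
    by (simp add: kernel_def case_prod_beta)
qed

end

end

section \<open>The reduced eigenvalue problem\<close>

context planar_steady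
begin

definition inner_part :: "real \<Rightarrow> (real \<Rightarrow> real) \<Rightarrow> real \<Rightarrow> real \<Rightarrow> real" where
  "inner_part c F a x = integral {0..x} (\<lambda>y. sn c (time y a) * F y)"

definition outer_part :: "real \<Rightarrow> (real \<Rightarrow> real) \<Rightarrow> real \<Rightarrow> real \<Rightarrow> real" where
  "outer_part c F a x = integral {x..a} (\<lambda>y. sn c (quarter a - time y a) * F y)"

text \<open>The Green potential of F on the quarter orbit, with the integral split at y = x where
  min and max change roles.\<close>

definition wave :: "real \<Rightarrow> (real \<Rightarrow> real) \<Rightarrow> real \<Rightarrow> real \<Rightarrow> real" where
  "wave c F a x = (sn c (quarter a - time x a) * inner_part c F a x
      + sn c (time x a) * outer_part c F a x) / sn c (quarter a)"

lemma sn_time_cont: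
  assumes "0 < a" "a \<le> R"
  shows "continuous_on {0..r} (\<lambda>y. sn c (time y a))" "continuous_on {0..r} (\<lambda>y. sn c (quarter a - time y a))"
  by (intro sn_cont continuous_intros time_cont assms)+

text \<open>Beyond the turning point \<open>quarter a - time\<close> is 0; this removes y in [a, R]
  and gives the value 0 for x \<ge> a.\<close>

lemma green_integral:
  assumes a: "0 < a" "a \<le> R" and F: "continuous_on {0..R} F" and x: "0 \<le> x" "x \<le> R"
  shows "integral {0..R} (\<lambda>y. green c x y a * F y) = (if x < a then wave c F a x else 0)"
proof (cases "x < a")
  case False
  have "green c x y a = 0" for y
    using False time_ge[of a "max x y"] by (simp add: green_def)
  then show ?thesis using False by simp
next
  case True
  have xa: "x \<le> a" using True by simp
  have c1: "continuous_on {0..x} (\<lambda>y. sn c (time y a) * F y)"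
    using x by (intro continuous_intros sn_time_cont a continuous_on_subset[OF F]) auto
  have c2: "continuous_on {x..a} (\<lambda>y. sn c (quarter a - time y a) * F y)"
    using x a by (intro continuous_intros continuous_on_subset[OF sn_time_cont(2)[OF a, of a]] continuous_on_subset[OF F]) auto
  let ?g = "\<lambda>y. green c x y a * F y"
  have 1: "(?g has_integral sn c (quarter a - time x a) / sn c (quarter a) * inner_part c F a x) {0..x}"
    unfolding inner_part_def
    by (rule has_integral_eq[OF _ has_integral_mult_right[OF integrable_integral[OF integrable_continuous_interval[OF c1]]]])
      (auto simp: green_def min_def max_def)
  have 2: "(?g has_integral sn c (time x a) / sn c (quarter a) * outer_part c F a x) {x..a}"
    unfolding outer_part_def
    by (rule has_integral_eq[OF _ has_integral_mult_right[OF integrable_integral[OF integrable_continuous_interval[OF c2]]]])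
      (auto simp: green_def min_def max_def)
  have 3: "(?g has_integral 0) {a..R}"
    by (rule has_integral_eq[of _ "\<lambda>_. 0"]) (use xa in \<open>auto simp: green_def max_def time_ge\<close>)
  show ?thesis
    using has_integral_combine[OF _ a(2) has_integral_combine[OF x(1) xa 1 2] 3] x a True
    by (simp add: integral_unique wave_def add_divide_distrib)
qed

context
  fixes b :: real
  assumes b: "0 \<le> b" "b * quarter R < pi"
begin

text \<open>Exchanging the integrals over y and a shows the image of F as a superposition of orbit
  solutions.\<close>

lemma kop_kernel:
  assumes c: "c \<in> {0..b}" and F: "continuous_on {0..R} F" and x: "0 \<le> x" "x \<le> R"
  shows "integrable lborel (\<lambda>a. indicator {x<..<R} a * (w a * wave c F a x))"
    "kop R (kernel c) F x = 8 * pi * (LINT a:{x<..<R}|lborel. w a * wave c F a x)"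
proof -
  obtain B where B: "\<forall>c\<in>{0..b}. \<forall>x y a. 0 < a \<longrightarrow> a \<le> R \<longrightarrow> \<bar>green c x y a\<bar> \<le> B" using green_bound[OF b] by blast
  let ?F = "\<lambda>y. indicator {0..R} y * F y"
  have Fi: "integrable lborel ?F"
    using borel_integrable_atLeastAtMost'[OF F] by (simp add: set_integrable_def)
  then have [measurable]: "?F \<in> borel_measurable borel" by auto
  let ?f = "\<lambda>y a. w a * green c x y a * ?F y"
  have int: "integrable (lborel \<Otimes>\<^sub>M lborel) (case_prod ?f)"
  proof (rule Bochner_Integration.integrable_bound[OF integrable_mult_right[OF lborel_pair.integrable_times[OF Fi w_integrable], of B]])
    show "AE z in lborel \<Otimes>\<^sub>M lborel. norm (case_prod ?f z) \<le> norm (B * (case z of (y, a) \<Rightarrow> ?F y * w a))"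
    proof (rule AE_I2)
      fix z :: "real \<times> real"
      obtain y a where z: "z = (y, a)" by force
      show "norm (case_prod ?f z) \<le> norm (B * (case z of (y, a) \<Rightarrow> ?F y * w a))"
      proof (cases "0 < a \<and> a < R")
        case True
        then have "\<bar>green c x y a\<bar> \<le> B" using B c by simp
        then have "\<bar>green c x y a\<bar> * \<bar>?F y * w a\<bar> \<le> \<bar>B\<bar> * \<bar>?F y * w a\<bar>" by (intro mult_right_mono) auto
        then show ?thesis by (simp add: z abs_mult ac_simps)
      qed (auto simp: z w_def)
    qed
    have "(\<lambda>z. w (snd z) * green c x (fst z) (snd z) * ?F (fst z)) \<in> borel_measurable (lborel \<Otimes>\<^sub>M lborel)"
      by measurable
    then show "case_prod ?f \<in> borel_measurable (lborel \<Otimes>\<^sub>M lborel)" by (simp add: case_prod_beta)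
  qed
  have inner: "(LINT y|lborel. ?f y a) = indicator {x<..<R} a * (w a * wave c F a x)" for a
  proof (cases "0 < a \<and> a < R")
    case True
    then have a: "0 < a" "a \<le> R" by auto
    have gc: "continuous_on {0..R} (\<lambda>y. green c x y a * F y)"
    proof -
      have "continuous_on {0..R} (\<lambda>y. (\<lambda>(c, x, y). green c x y a) (c, x, y))"
        by (rule continuous_on_compose2[OF green_cont[OF b a]]) (use c x in \<open>auto intro!: continuous_intros\<close>)
      then show ?thesis by (intro continuous_intros F) simp
    qed
    have "(LINT y|lborel. ?f y a) = (LINT y|lborel. w a * (indicator {0..R} y * (green c x y a * F y)))"
      by (simp add: ac_simps)
    also have "\<dots> = w a * (LINT y:{0..R}|lborel. green c x y a * F y)"
      by (simp add: set_lebesgue_integral_def)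
    also have "(LINT y:{0..R}|lborel. green c x y a * F y) = integral {0..R} (\<lambda>y. green c x y a * F y)"
      by (intro set_borel_integral_eq_integral(2) borel_integrable_atLeastAtMost' gc)
    also have "\<dots> = (if x < a then wave c F a x else 0)" by (rule green_integral[OF a F x])
    finally show ?thesis using True by (auto simp: indicator_def)
  next
    case False
    then show ?thesis using x by (auto simp: w_def indicator_def)
  qed
  have "integrable lborel (\<lambda>a. LINT y|lborel. ?f y a)"
    using lborel_pair.integrable_fst'[OF lborel_pair.integrable_product_swap[OF int]] by simp
  then show "integrable lborel (\<lambda>a. indicator {x<..<R} a * (w a * wave c F a x))" by (simp only: inner)
  have kc: "continuous_on {0..R} (\<lambda>y. kernel c x y * F y)"
  proof -
    have "continuous_on {0..R} (\<lambda>y. (\<lambda>(c, x, y). kernel c x y) (c, x, y))"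
      by (rule continuous_on_compose2[OF kernel_cont[OF b]]) (use c x in \<open>auto intro!: continuous_intros\<close>)
    then show ?thesis by (intro continuous_intros F) simp
  qed
  have "kop R (kernel c) F x = (LINT y:{0..R}|lborel. kernel c x y * F y)"
    unfolding kop_def by (intro set_borel_integral_eq_integral(2)[symmetric] borel_integrable_atLeastAtMost' kc)
  also have "\<dots> = (LINT y|lborel. 8 * pi * (LINT a|lborel. ?f y a))"
    unfolding set_lebesgue_integral_def kernel_def
    by (rule Bochner_Integration.integral_cong) (auto simp: ac_simps)
  also have "\<dots> = 8 * pi * (LINT y|lborel. (LINT a|lborel. ?f y a))" by simp
  also have "(LINT y|lborel. (LINT a|lborel. ?f y a)) = (LINT a|lborel. (LINT y|lborel. ?f y a))"
    by (rule lborel_pair.Fubini_integral[OF int, symmetric])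
  also have "\<dots> = (LINT a:{x<..<R}|lborel. w a * wave c F a x)"
    by (simp only: inner set_lebesgue_integral_def real_scaleR_def)
  finally show "kop R (kernel c) F x = 8 * pi * (LINT a:{x<..<R}|lborel. w a * wave c F a x)" .
qed

end

text \<open>At \<open>c = 0\<close> the velocity \<open>v\<close> solves the inhomogeneous equation with right-hand side
  \<open>4 \<pi> \<rho> v\<close>; subtracting its linear interpolant restores the boundary condition at \<open>x = 0\<close>.\<close>
lemma wave_zero_rho:
  assumes a: "0 < a" "a \<le> R" and x: "0 \<le> x" "x < a"
  shows "4 * pi * wave 0 \<rho> a x = speed x a - speed 0 a * (1 - time x a / quarter a)"
proof -
  let ?t = "\<lambda>y. time y a" and ?L = "quarter a"
  have L: "0 < ?L" by (rule quarter_pos[OF a])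
  have i1: "4 * pi * inner_part 0 \<rho> a x = ?t x * U' x + speed x a - speed 0 a"
  proof -
    \<comment> \<open>t U' + v is a primitive of 4 pi t \<rho>: the terms U' / v arising from dt/dy
      and dv/dy cancel.\<close>
    have "((\<lambda>y. 4 * pi * (?t y * \<rho> y)) has_integral (?t x * U' x + speed x a) - (?t 0 * U' 0 + speed 0 a)) {0..x}"
    proof (rule fundamental_theorem_of_calculus_interior[OF x(1)])
      show "continuous_on {0..x} (\<lambda>y. ?t y * U' y + speed y a)"
        by (intro continuous_intros time_cont[OF a] U'_cont speed_cont)
      fix y assume "y \<in> {0<..<x}"
      then have y: "0 < y" "y < a" using x by auto
      have "((\<lambda>y. ?t y * U' y + speed y a) has_real_derivative
          (1 / speed y a * U' y + 4 * pi * \<rho> y * ?t y) + (- U' y / speed y a)) (at y)"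
        using y by (intro DERIV_add DERIV_mult time_deriv[OF a] U'_deriv speed_deriv) auto
      then show "((\<lambda>y. ?t y * U' y + speed y a) has_vector_derivative 4 * pi * (?t y * \<rho> y)) (at y)"
        by (simp add: has_real_derivative_iff_has_vector_derivative[symmetric] ac_simps)
    qed
    then show ?thesis by (simp add: inner_part_def integral_unique flip: integral_mult_right)
  qed
  have i2: "4 * pi * outer_part 0 \<rho> a x = - (?L - ?t x) * U' x + speed x a"
  proof -
    have "((\<lambda>y. 4 * pi * ((?L - ?t y) * \<rho> y)) has_integral ((?L - ?t a) * U' a - speed a a) - ((?L - ?t x) * U' x - speed x a)) {x..a}"
    proof (rule fundamental_theorem_of_calculus_interior[OF less_imp_le[OF x(2)]])
      show "continuous_on {x..a} (\<lambda>y. (?L - ?t y) * U' y - speed y a)"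
        by (intro continuous_intros continuous_on_subset[OF time_cont[OF a, of a]] U'_cont speed_cont) (use x in auto)
      fix y assume "y \<in> {x<..<a}"
      then have y: "0 < y" "y < a" using x by auto
      have "((\<lambda>y. (?L - ?t y) * U' y - speed y a) has_real_derivative
          ((0 - 1 / speed y a) * U' y + 4 * pi * \<rho> y * (?L - ?t y)) - (- U' y / speed y a)) (at y)"
        using y by (intro DERIV_diff DERIV_mult time_deriv[OF a] U'_deriv speed_deriv DERIV_const) auto
      then show "((\<lambda>y. (?L - ?t y) * U' y - speed y a) has_vector_derivative 4 * pi * ((?L - ?t y) * \<rho> y)) (at y)"
        by (simp add: has_real_derivative_iff_has_vector_derivative[symmetric] ac_simps)
    qed
    then show ?thesis
      by (simp add: outer_part_def integral_unique time_ge algebra_simps flip: integral_mult_right)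
  qed
  have "4 * pi * wave 0 \<rho> a x = ((?L - ?t x) * (4 * pi * inner_part 0 \<rho> a x) + ?t x * (4 * pi * outer_part 0 \<rho> a x)) / ?L"
    by (simp add: wave_def algebra_simps add_divide_distrib)
  also have "\<dots> = speed x a - speed 0 a * (1 - ?t x / ?L)"
    unfolding i1 i2 using L by (simp add: field_simps)
  finally show ?thesis .
qed

text \<open>On every orbit with a > x the solution 4 pi \<open>wave 0 \<rho> a x\<close> stays below
  the speed by the positive interpolant. Integrated against 2 w, the speed gives \<rho> x by
  \<open>rho_speed\<close>.\<close>

lemma kernel_zero_supersolution:
  assumes x: "0 < x" "x < R"
  shows "kop R (kernel 0) \<rho> x < \<rho> x"
proof -
  let ?s = "\<lambda>a. indicator {x<..<R} a * (w a * speed x a)"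
  let ?h = "\<lambda>a. indicator {x<..<R} a * (w a * wave 0 \<rho> a x)"
  have rc: "continuous_on {0..R} \<rho>" by (rule continuous_on_subset[OF rho_cont]) auto
  have b: "0 \<le> (0::real)" "0 * quarter R < pi" by auto
  note K = kop_kernel[OF b _ rc, of 0 x]
  have hi: "integrable lborel ?h" using K(1) x by simp
  have si: "integrable lborel ?s" using rho_speed(1)[of x] x by simp
  have lt: "4 * pi * ?h a < ?s a" if a: "x < a" "a < R" for a
  proof -
    have "time x a < quarter a" "0 < quarter a" using time_less_quarter[of a x] quarter_pos[of a] a x by auto
    then have "0 < speed 0 a * (1 - time x a / quarter a)" using speed_pos[of 0 a] a x by simp
    then have "4 * pi * wave 0 \<rho> a x < speed x a" using wave_zero_rho[of a x] a x by simp
    from mult_strict_left_mono[OF this w_pos[of a]] show ?thesis using a x by (simp add: ac_simps)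
  qed
  let ?d = "\<lambda>a. ?s a - 4 * pi * ?h a"
  have di: "integrable lborel ?d" by (intro Bochner_Integration.integrable_diff si integrable_mult_right hi)
  have d0: "0 \<le> ?d a" for a using lt[of a] by (cases "x < a \<and> a < R") (auto simp: indicator_def)
  \<comment> \<open>Equal integrals would make the pointwise gap vanish almost everywhere, and (x,
    R) would be a null set.\<close>
  have "(LINT a|lborel. ?d a) \<noteq> 0"
  proof
    assume "(LINT a|lborel. ?d a) = 0"
    then have "AE a in lborel. ?d a = 0" using integral_nonneg_eq_0_iff_AE[OF di] d0 by simp
    then have "AE a in lborel. a \<notin> {x<..<R}" by eventually_elim (use lt in force)
    then have "emeasure lborel {a. \<not> a \<notin> {x<..<R}} = 0"
      by (subst (asm) AE_iff_measurable[OF _ refl]) auto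
    also have "{a. \<not> a \<notin> {x<..<R}} = {x<..<R}" by auto
    finally show False using x by simp
  qed
  moreover have "0 \<le> (LINT a|lborel. ?d a)" using d0 by simp
  ultimately have "0 < (LINT a|lborel. ?d a)" by simp
  also have "(LINT a|lborel. ?d a) = (LINT a|lborel. ?s a) - (LINT a|lborel. 4 * pi * ?h a)"
    by (intro Bochner_Integration.integral_diff si integrable_mult_right hi)
  finally have "4 * pi * (LINT a|lborel. ?h a) < (LINT a|lborel. ?s a)" by simp
  then show ?thesis using K(2) rho_speed(2)[of x] x by (simp add: set_lebesgue_integral_def)
qed

section \<open>Divergence of the kernel at the edge of the gap\<close>

lemma sin_lower:
  assumes "0 \<le> \<theta>" "\<theta> \<le> u" "u \<le> pi - \<theta>" shows "sin \<theta> \<le> sin u"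
proof (cases "u \<le> pi / 2")
  case True
  then show ?thesis using assms by (intro sin_monotone_2pi_le) auto
next
  case False
  have "sin \<theta> \<le> sin (pi - u)" using assms False by (intro sin_monotone_2pi_le) auto
  then show ?thesis by simp
qed

text \<open>Near the boundary energy the Green function has a factor \<open>1 / sin (b L a)\<close>, which is
  at least \<open>1 / (\<eta> + C (R - a))\<close> for \<open>b = (pi - \<eta>) / L R\<close>: a logarithmic divergence.\<close>
lemma kernel_blow_up:
  "\<exists>b. 0 < b \<and> b * quarter R < pi \<and> ip R (\<lambda>_. 1) (\<lambda>_. 1) < ip R (\<lambda>_. 1) (kop R (kernel b) (\<lambda>_. 1))"
proof -
  let ?L = "quarter R"
  have L: "0 < ?L" by (rule quarter_pos[OF R_pos order_refl])
  obtain C where C: "0 < C" "\<And>a. R / 2 \<le> a \<Longrightarrow> a \<le> R \<Longrightarrow> ?L - quarter a \<le> C * (R - a)"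
    using quarter_lipschitz by blast
  define D where "D = pi * C / ?L"
  have D: "0 < D" using C L by (simp add: D_def)
  \<comment> \<open>A lower bound for the travel time from 0 to R / 4 and from R / 2 to 3 R / 4. For
    x and y in [R / 4, R / 2] and a > 3 R / 4, both sine factors in the numerator therefore have
    phases between \<theta> and pi - \<theta>.\<close>
  define d where "d = R / 4 / vmax"
  have d: "0 < d" using R_pos vmax_pos by (simp add: d_def)
  define \<theta> where "\<theta> = pi / (2 * ?L) * d"
  have th: "0 < \<theta>" using L d by (simp add: \<theta>_def)
  have dL: "2 * d < ?L"
    using time_increase[OF R_pos order_refl, of 0 "R"] R_pos vmax_pos time_ge[of R R]
    by (simp add: d_def field_simps)
  have th2: "\<theta> \<le> pi / 4" using dL L by (simp add: \<theta>_def field_simps)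
  define s where "s = sin \<theta>"
  have s: "0 < s" unfolding s_def using th th2 by (intro sin_gt_zero) auto
  define W where "W = A0 * U' (R / 2)"
  have W: "0 < W" using A0 U'_pos[of "R / 2"] R_pos by (simp add: W_def)
  define Q where "Q = W * (s * s * ?L / pi)"
  have Q: "0 < Q" using W s L by (simp add: Q_def)
  \<comment> \<open>Chosen so that 8 pi Q N / D = 17 / R. A kernel of at least 17 / R on the square
    over [R / 4, R / 2] gives the constant 1 a form of at least 17 R / 16, more than its squared
    norm R.\<close>
  define N where "N = 17 * D / (8 * pi * Q * R)"
  \<comment> \<open>The factor exp (- N) makes ln (D R / 4) - ln \<eta> at least N, and the bound pi
    / 2 keeps b above pi / (2 quarter R).\<close>
  define \<eta> where "\<eta> = min (pi / 2) (D * (R / 4) * exp (- N))"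
  have eta: "0 < \<eta>" "\<eta> \<le> pi / 2" using D R_pos by (auto simp: \<eta>_def)
  define b where "b = (pi - \<eta>) / ?L"
  have bL: "b * ?L = pi - \<eta>" using L by (simp add: b_def)
  have b0: "pi / (2 * ?L) \<le> b" using eta L by (simp add: b_def field_simps)
  have bpi: "b \<le> pi / ?L" using eta L by (simp add: b_def divide_right_mono)
  have bpos: "0 < b" using b0 L by (smt (verit) divide_pos_pos pi_gt_zero)
  have b: "0 \<le> b" "b * ?L < pi" using bpos bL eta by auto
  let ?g = "\<lambda>a. 1 / (\<eta> + D * (R - a))"
  have green_lower: "s * s * ?L / pi * ?g a \<le> green b x y a"
    if x: "R / 4 \<le> x" "x \<le> y" "y \<le> R / 2" and a: "3 * R / 4 < a" "a < R" for x y a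
  proof -
    let ?l = "quarter a"
    have a0: "0 < a" "a \<le> R" using a R_pos by auto
    have l: "0 < ?l" "?l \<le> ?L" using quarter_pos[OF a0] quarter_mono[OF a0] by auto
    have t: "d \<le> time z a" "d \<le> ?l - time z a" if z: "R / 4 \<le> z" "z \<le> R / 2" for z
    proof -
      have "d \<le> (z - 0) / vmax" unfolding d_def using z vmax_pos by (intro divide_right_mono) auto
      also have "\<dots> \<le> time z a - time 0 a" using z a R_pos by (intro time_increase[OF a0]) auto
      finally show "d \<le> time z a" by simp
      have "d \<le> (a - z) / vmax" unfolding d_def using z a vmax_pos by (intro divide_right_mono) auto
      also have "\<dots> \<le> time a a - time z a" using z a R_pos by (intro time_increase[OF a0]) auto
      finally show "d \<le> ?l - time z a" by (simp add: time_ge)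
    qed
    have sl: "s \<le> sin (b * z)" if z: "d \<le> z" "d \<le> ?l - z" for z
      unfolding s_def
    proof (rule sin_lower)
      have bd: "\<theta> \<le> b * d" unfolding \<theta>_def using b0 d by (intro mult_right_mono) auto
      have "b * d \<le> b * z" using z bpos by simp
      then show "\<theta> \<le> b * z" using bd by simp
      have "b * z \<le> b * (?L - d)" using z l bpos by (intro mult_left_mono) auto
      also have "\<dots> = pi - \<eta> - b * d" using bL by (simp add: algebra_simps)
      finally show "b * z \<le> pi - \<theta>" using bd eta by simp
    qed (use th in simp)
    have bl: "0 < b * ?l" "b * ?l < pi" using bpos l phase_less(1)[OF b _ _ a0, of b ?l] by auto
    have sp: "0 < sin (b * ?l)" using bl by (rule sin_gt_zero)
    \<comment> \<open>The denominator is small near the edge: the distance of its phase from pi is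
      \<eta> plus b times the deficit of the quarter period.\<close>
    have "sin (b * ?l) = sin (pi - b * ?l)" by simp
    also have "\<dots> \<le> pi - b * ?l" using bl by (intro sin_x_le_x) auto
    also have "\<dots> = \<eta> + b * (?L - ?l)" using bL by (simp add: algebra_simps)
    also have "b * (?L - ?l) \<le> pi / ?L * (C * (R - a))"
      using bpi bpos C(2)[of a] a R_pos l L by (intro mult_mono) auto
    finally have su: "sin (b * ?l) \<le> \<eta> + D * (R - a)" by (simp add: D_def)
    have "s * s * ?L / pi * ?g a = (s * s) / (pi / ?L * (\<eta> + D * (R - a)))" using L by simp
    also have "\<dots> \<le> (sin (b * time x a) * sin (b * (?l - time y a))) / (b * sin (b * ?l))"
    proof (rule frac_le)
      show "s * s \<le> sin (b * time x a) * sin (b * (?l - time y a))"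
        using t[of x] t[of y] x s by (intro mult_mono sl) (auto intro: order_trans[OF less_imp_le sl])
      show "0 \<le> sin (b * time x a) * sin (b * (?l - time y a))"
        using t[of x] t[of y] x s by (intro mult_nonneg_nonneg order_trans[OF less_imp_le sl]) auto
      show "b * sin (b * ?l) \<le> pi / ?L * (\<eta> + D * (R - a))"
        using bpi su sp bpos by (intro mult_mono) auto
    qed (use bpos sp in auto)
    also have "\<dots> = green b x y a"
      using x bpos by (simp add: green_def sn_eq min_absorb1 max_absorb2)
    finally show ?thesis .
  qed
  have green_lower': "s * s * ?L / pi * ?g a \<le> green b x y a"
    if "R / 4 \<le> x" "x \<le> R / 2" "R / 4 \<le> y" "y \<le> R / 2" "3 * R / 4 < a" "a < R" for x y a
    using green_lower[of x y a] green_lower[of y x a] green_sym[of b x y a] that by (cases "x \<le> y") auto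
  have gpos: "0 < \<eta> + D * (R - a)" if "a \<le> R" for a using eta D that by (simp add: add_pos_nonneg)
  have "continuous_on {3 * R / 4..R} (\<lambda>a. - ln (\<eta> + D * (R - a)) / D)"
    by (intro continuous_intros) (use gpos D in force)+
  note FTC = FTC_open_nonneg[OF _ this, of ?g]
  have der: "((\<lambda>a. - ln (\<eta> + D * (R - a)) / D) has_real_derivative ?g a) (at a)" if "a < R" for a
  proof -
    have "((\<lambda>a. - ln (\<eta> + D * (R - a)) / D) has_real_derivative - (1 / (\<eta> + D * (R - a)) * (0 + D * (0 - 1))) / D) (at a)"
      using gpos[of a] that
      by (intro DERIV_cdivide DERIV_minus DERIV_chain2[OF DERIV_ln_divide] DERIV_add DERIV_cmult DERIV_diff
          DERIV_const DERIV_ident) auto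
    then show ?thesis using D by simp
  qed
  have gi: "set_integrable lborel {3 * R / 4<..<R} ?g"
    using R_pos gpos by (intro FTC der) (auto intro: less_imp_le)
  have gv: "(LINT a:{3 * R / 4<..<R}|lborel. ?g a) = (ln (\<eta> + D * (R / 4)) - ln \<eta>) / D"
  proof -
    have "(LINT a:{3 * R / 4<..<R}|lborel. ?g a) = - ln (\<eta> + D * (R - R)) / D - (- ln (\<eta> + D * (R - 3 * R / 4)) / D)"
      using R_pos gpos by (intro FTC der) (auto intro: less_imp_le)
    then show ?thesis by (simp add: diff_divide_distrib)
  qed
  have "N \<le> ln (\<eta> + D * (R / 4)) - ln \<eta>"
  proof -
    have "N + ln \<eta> \<le> N + ln (D * (R / 4) * exp (- N))"
      using eta(1) by (simp add: \<eta>_def)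
    also have "\<dots> = ln (D * (R / 4))"
      using D R_pos by (subst ln_mult) auto
    also have "\<dots> \<le> ln (\<eta> + D * (R / 4))"
      using D R_pos eta by (intro ln_mono) (auto intro: add_pos_pos)
    finally show ?thesis by simp
  qed
  then have gN: "N / D \<le> (LINT a:{3 * R / 4<..<R}|lborel. ?g a)"
    unfolding gv using D by (simp add: divide_right_mono)
  have kl: "17 / R \<le> kernel b x y" if xy: "x \<in> {R / 4..R / 2}" "y \<in> {R / 4..R / 2}" for x y
  proof -
    have "17 / R = 8 * pi * (Q * (N / D))" using Q D R_pos by (simp add: N_def field_simps)
    also have "\<dots> \<le> 8 * pi * (Q * (LINT a:{3 * R / 4<..<R}|lborel. ?g a))"
      using gN Q by (intro mult_left_mono) auto
    also have "Q * (LINT a:{3 * R / 4<..<R}|lborel. ?g a) = (LINT a|lborel. Q * (indicator {3 * R / 4<..<R} a * ?g a))"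
      unfolding set_lebesgue_integral_def real_scaleR_def by (rule integral_mult_right_zero[symmetric])
    also have "\<dots> \<le> (LINT a|lborel. w a * green b x y a)"
    proof (rule integral_mono)
      show "integrable lborel (\<lambda>a. Q * (indicator {3 * R / 4<..<R} a * ?g a))"
        using gi unfolding set_integrable_def real_scaleR_def by (rule integrable_mult_right)
      show "integrable lborel (\<lambda>a. w a * green b x y a)"
        using bpos by (intro w_green_integrable[OF b]) auto
      fix a
      show "Q * (indicator {3 * R / 4<..<R} a * ?g a) \<le> w a * green b x y a"
      proof (cases "3 * R / 4 < a \<and> a < R")
        case True
        have "U' (R / 2) \<le> U' a" using True R_pos by (intro U'_mono) auto
        then have "W \<le> w a"
          unfolding W_def using True R_pos A_U_lower[of a] A0 U'_nonneg[of "R / 2"]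
          by (auto simp: w_def intro!: mult_mono)
        then have "W * (s * s * ?L / pi * ?g a) \<le> w a * green b x y a"
          using green_lower'[of x y a] xy True W s L gpos[of a] w_nonneg[of a] by (intro mult_mono) auto
        then show ?thesis using True by (simp add: Q_def ac_simps)
      next
        case False
        have "0 \<le> w a * green b x y a"
          using w_nonneg[of a] green_nonneg[OF b, of b a x y] bpos by (cases "0 < a \<and> a < R") (auto simp: w_def)
        then show ?thesis using False by (auto simp: indicator_def)
      qed
    qed
    finally show ?thesis by (simp add: kernel_def)
  qed
  have bb: "b \<in> {0..b}" using bpos by simp
  have kc: "continuous_on ({0..R} \<times> {0..R}) (\<lambda>(x, y). kernel b x y)"
  proof -
    have "continuous_on ({0..R} \<times> {0..R}) (\<lambda>z. (\<lambda>(c, x, y). kernel c x y) (b, z))"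
      by (rule continuous_on_compose2[OF kernel_cont[OF b]]) (use bpos in \<open>auto intro!: continuous_intros\<close>)
    then show ?thesis by (simp add: case_prod_beta)
  qed
  have one: "continuous_on {0..R} (\<lambda>_. 1 :: real)" by simp
  note Kc = kop_continuous[OF R_pos kc one]
  have sub: "{R / 4..R / 2} \<subseteq> {0..R}" using R_pos by auto
  have K1: "17 / 4 \<le> kop R (kernel b) (\<lambda>_. 1) x" if x: "x \<in> {R / 4..R / 2}" for x
  proof -
    have x': "x \<in> {0..R}" using x sub by auto
    note i = kop_integrable[OF R_pos kc one x']
    have "17 / 4 = integral {R / 4..R / 2} (\<lambda>y. 17 / R)" using R_pos by (simp add: field_simps)
    also have "\<dots> \<le> integral {R / 4..R / 2} (\<lambda>y. kernel b x y * 1)"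
      by (intro integral_le integrable_on_subinterval[OF i sub]) (use kl[OF x] in auto)
    also have "\<dots> \<le> kop R (kernel b) (\<lambda>_. 1) x"
      unfolding kop_def
      by (intro integral_subset_le[OF sub integrable_on_subinterval[OF i sub] i])
        (use kernel_nonneg[OF b bb] in auto)
    finally show ?thesis .
  qed
  have Ki: "kop R (kernel b) (\<lambda>_. 1) integrable_on {0..R}" by (rule integrable_continuous_interval[OF Kc])
  have "R < 17 / 16 * R" using R_pos by simp
  also have "\<dots> = integral {R / 4..R / 2} (\<lambda>x. 17 / 4)" using R_pos by (simp add: field_simps)
  also have "\<dots> \<le> integral {R / 4..R / 2} (kop R (kernel b) (\<lambda>_. 1))"
    by (intro integral_le integrable_on_subinterval[OF Ki sub] K1) auto
  also have "\<dots> \<le> integral {0..R} (kop R (kernel b) (\<lambda>_. 1))"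
  proof (rule integral_subset_le[OF sub integrable_on_subinterval[OF Ki sub] Ki], intro ballI)
    fix x assume x: "x \<in> {0..R}"
    show "0 \<le> kop R (kernel b) (\<lambda>_. 1) x"
      unfolding kop_def by (rule integral_nonneg[OF kop_integrable[OF R_pos kc one x]])
        (use kernel_nonneg[OF b bb] in auto)
  qed
  finally have "ip R (\<lambda>_. 1) (\<lambda>_. 1) < ip R (\<lambda>_. 1) (kop R (kernel b) (\<lambda>_. 1))"
    using R_pos by (simp add: ip_def)
  with bpos b show ?thesis by blast
qed

lemma reduced_eigenfunction_exists:
  "\<exists>c F. 0 < c \<and> c * quarter R < pi \<and> continuous_on UNIV F \<and> (\<exists>x\<in>{0..R}. F x \<noteq> 0) \<and>
     (\<forall>x\<in>{0..R}. F x = 8 * pi * (LINT a:{x<..<R}|lborel. w a * wave c F a x))"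
proof -
  obtain b where b: "0 < b" "b * quarter R < pi"
      and big: "ip R (\<lambda>_. 1) (\<lambda>_. 1) < ip R (\<lambda>_. 1) (kop R (kernel b) (\<lambda>_. 1))"
    using kernel_blow_up by blast
  have b0: "0 \<le> b" using b by simp
  have "\<exists>c G. 0 < c \<and> c < b \<and> continuous_on {0..R} G \<and> (\<exists>x\<in>{0..R}. G x \<noteq> 0) \<and>
     (\<forall>x\<in>{0..R}. kop R (kernel c) G x = G x)"
  proof (rule unit_eigenfunction_exists[OF R_pos b0 kernel_cont[OF b0 b(2)] _ _ _ _ _ _ big])
    show "kernel c x y = kernel c y x" for c x y by (simp add: kernel_def green_sym[of c x])
    show "0 \<le> kernel c x y" if "c \<in> {0..b}" for c x y by (rule kernel_nonneg[OF b0 b(2) that])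
    show "continuous_on {0..R} \<rho>" by (rule continuous_on_subset[OF rho_cont]) auto
    show "0 < \<rho> x" if "x \<in> {0<..<R}" for x using rho_pos that by simp
    show "kop R (kernel 0) \<rho> x < \<rho> x" if "x \<in> {0<..<R}" for x using kernel_zero_supersolution that by simp
  qed simp
  then obtain c G where c: "0 < c" "c < b" and G: "continuous_on {0..R} G" "\<exists>x\<in>{0..R}. G x \<noteq> 0"
    "\<forall>x\<in>{0..R}. kop R (kernel c) G x = G x" by blast
  \<comment> \<open>Constant continuation beyond [0, R]. Continuity on the whole line makes F
    measurable and its nonvanishing set open.\<close>
  define F where "F x = G (max 0 (min R x))" for x
  have FG: "F x = G x" if "x \<in> {0..R}" for x using that by (simp add: F_def)
  have Fc: "continuous_on UNIV F"
    unfolding F_def[abs_def] using R_pos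
    by (intro continuous_on_compose2[OF G(1)] continuous_intros) auto
  have kF: "kop R (kernel c) G x = kop R (kernel c) F x" for x
    unfolding kop_def by (rule integral_cong) (simp add: FG)
  have "F x = 8 * pi * (LINT a:{x<..<R}|lborel. w a * wave c F a x)" if x: "x \<in> {0..R}" for x
  proof -
    have "F x = kop R (kernel c) F x" using G(3) x kF FG[OF x] by simp
    also have "\<dots> = 8 * pi * (LINT a:{x<..<R}|lborel. w a * wave c F a x)"
      by (rule kop_kernel(2)[OF b0 b(2)]) (use c x in \<open>auto intro: continuous_on_subset[OF Fc]\<close>)
    finally show ?thesis .
  qed
  moreover have "c * quarter R < pi"
    using mult_strict_right_mono[OF c(2) quarter_pos[OF R_pos order_refl]] b(2) by simp
  moreover have "\<exists>x\<in>{0..R}. F x \<noteq> 0" using G(2) FG by force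
  ultimately show ?thesis using c(1) Fc by blast
qed

end

section \<open>Integration over phase space along orbits\<close>

lemma nn_integral_reflect:
  fixes f :: "real \<Rightarrow> ennreal"
  assumes f[measurable]: "f \<in> borel_measurable borel"
  shows "(\<integral>\<^sup>+x. f x \<partial>lborel) = (\<integral>\<^sup>+x. (f x + f (- x)) * indicator {0<..} x \<partial>lborel)"
proof -
  have "(\<integral>\<^sup>+x. f x \<partial>lborel) = (\<integral>\<^sup>+x. f x * indicator {0<..} x + f x * indicator {..<0} x \<partial>lborel)"
  proof (rule nn_integral_cong_AE)
    have "AE x in lborel. x \<noteq> (0::real)" by (rule AE_lborel_singleton)
    then show "AE x in lborel. f x = f x * indicator {0<..} x + f x * indicator {..<0} x"
      by eventually_elim (auto simp: indicator_def)
  qed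
  also have "\<dots> = (\<integral>\<^sup>+x. f x * indicator {0<..} x \<partial>lborel) + (\<integral>\<^sup>+x. f x * indicator {..<0} x \<partial>lborel)"
    by (rule nn_integral_add) auto
  also have "(\<integral>\<^sup>+x. f x * indicator {..<0} x \<partial>lborel) = (\<integral>\<^sup>+x. f (- x) * indicator {0<..} x \<partial>lborel)"
    using nn_integral_real_affine[of "\<lambda>x. f x * indicator {..<0} x" "-1" 0] by (simp add: indicator_def)
  also have "(\<integral>\<^sup>+x. f x * indicator {0<..} x \<partial>lborel) + \<dots> =
      (\<integral>\<^sup>+x. f x * indicator {0<..} x + f (- x) * indicator {0<..} x \<partial>lborel)"
    by (rule nn_integral_add[symmetric]) auto
  finally show ?thesis by (simp add: distrib_right)
qed

context planar_potential
begin

text \<open>The derivative dv / da of v = speed x a at fixed x, on the triangle 0 < x < a <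
  R.\<close>

definition jac :: "real \<Rightarrow> real \<Rightarrow> real" where
  "jac a x = (if 0 < x \<and> x < a \<and> a < R then U' a / speed x a else 0)"

lemma jac_nonneg: "0 \<le> jac a x"
  using U'_nonneg[of a] speed_pos[of x a] by (simp add: jac_def less_imp_le)

lemma jac_meas[measurable]: "case_prod jac \<in> borel_measurable (borel \<Otimes>\<^sub>M borel)"
  unfolding jac_def[abs_def] by measurable

text \<open>The four points of an orbit over |x|. The value type is general so as to serve
  nonnegative extended and real integrands alike.\<close>

definition orbit_sum :: "(ph \<Rightarrow> 'b::comm_monoid_add) \<Rightarrow> (real \<times> real) \<Rightarrow> real \<Rightarrow> real \<Rightarrow> 'b" where
  "orbit_sum f vb a x = f (x, speed x a, vb) + f (- x, speed x a, vb)
     + (f (x, - speed x a, vb) + f (- x, - speed x a, vb))"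

lemma speed_less_iff:
  assumes "0 < x" "0 < v"
  shows "v\<^sup>2 / 2 + U x < U R \<longleftrightarrow> x < R \<and> v < speed x R"
proof (cases "x < R")
  case True
  then have s: "0 < speed x R" "(speed x R)\<^sup>2 = 2 * (U R - U x)" using speed_pos[of x R] speed_sq[of x R] assms by auto
  have "v < speed x R \<longleftrightarrow> v\<^sup>2 < (speed x R)\<^sup>2"
    using s(1) assms by (meson less_imp_le power2_less_imp_less power_strict_mono zero_less_numeral)
  then show ?thesis using True s(2) by auto
next
  case False
  then have "U R \<le> U x" using U_le_iff[of R x] R_pos by simp
  then show ?thesis using False assms by (auto simp: add_pos_nonneg not_less intro: add_increasing)
qed

text \<open>Reflections in x and v fold phase space onto the quadrant x, v > 0, where the turning
  point replaces the velocity. In this form for nonnegative integrands it can also establish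
  integrability.\<close>

lemma nn_integral_phase:
  fixes f :: "ph \<Rightarrow> ennreal"
  assumes f: "f \<in> borel_measurable borel"
  shows "(\<integral>\<^sup>+z. f z * indicator {z. energy U z < U R} z \<partial>lborel) =
    (\<integral>\<^sup>+vb. (\<integral>\<^sup>+p. ennreal (jac (fst p) (snd p)) * orbit_sum f vb (fst p) (snd p) \<partial>lborel) \<partial>lborel)"
proof -
  have [measurable]: "f \<in> borel_measurable (borel \<Otimes>\<^sub>M (borel \<Otimes>\<^sub>M borel))"
    using f by (simp add: borel_prod)
  let ?I = "\<lambda>x v. indicator {v. v\<^sup>2 / 2 + U x < U R} v :: ennreal"
  have [measurable]: "(\<lambda>z. ?I (g z) (h z)) \<in> borel_measurable M"
    if [measurable]: "g \<in> borel_measurable M" "h \<in> borel_measurable M" for g h :: "'c \<Rightarrow> real" and M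
    unfolding indicator_def by measurable
  have I_even: "?I x (- v) = ?I x v" "?I (- x) v = ?I x v" for x v by (simp_all add: indicator_def U_even)
  define H where "H x v = (\<integral>\<^sup>+vb. f (x, v, vb) \<partial>lborel)" for x v
  have [measurable]: "case_prod H \<in> borel_measurable (borel \<Otimes>\<^sub>M borel)"
    unfolding H_def[abs_def] by measurable
  let ?S = "\<lambda>x v. H x v + H (- x) v + (H x (- v) + H (- x) (- v))"
  have "(\<integral>\<^sup>+z. f z * indicator {z. energy U z < U R} z \<partial>lborel)
     = (\<integral>\<^sup>+z. f z * ?I (fst z) (fst (snd z)) \<partial>(lborel \<Otimes>\<^sub>M (lborel \<Otimes>\<^sub>M lborel)))"
    unfolding lborel_prod by (rule nn_integral_cong) (auto simp: energy_def indicator_def split: prod.split)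
  also have "\<dots> = (\<integral>\<^sup>+x. \<integral>\<^sup>+u. f (x, u) * ?I x (fst u) \<partial>(lborel \<Otimes>\<^sub>M lborel) \<partial>lborel)"
  proof -
    have "(\<lambda>z. f z * ?I (fst z) (fst (snd z))) \<in> borel_measurable (borel \<Otimes>\<^sub>M (borel \<Otimes>\<^sub>M borel))"
      by measurable
    then have "(\<lambda>z. f z * ?I (fst z) (fst (snd z))) \<in> borel_measurable (lborel \<Otimes>\<^sub>M lborel)"
      by (simp add: borel_prod lborel_prod)
    from lborel.nn_integral_fst[OF this] show ?thesis by (simp add: lborel_prod)
  qed
  also have "\<dots> = (\<integral>\<^sup>+x. \<integral>\<^sup>+v. \<integral>\<^sup>+vb. f (x, v, vb) * ?I x v \<partial>lborel \<partial>lborel \<partial>lborel)"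
    by (subst lborel.nn_integral_fst[symmetric]) simp_all
  also have "\<dots> = (\<integral>\<^sup>+x. \<integral>\<^sup>+v. H x v * ?I x v \<partial>lborel \<partial>lborel)"
    by (simp add: H_def nn_integral_multc)
  also have "\<dots> = (\<integral>\<^sup>+x. \<integral>\<^sup>+v. (H x v + H x (- v)) * ?I x v * indicator {0<..} v \<partial>lborel \<partial>lborel)"
    by (rule nn_integral_cong, subst nn_integral_reflect) (auto simp: distrib_right I_even(1) intro!: nn_integral_cong)
  also have "\<dots> = (\<integral>\<^sup>+x. (\<integral>\<^sup>+v. (H x v + H x (- v)) * ?I x v * indicator {0<..} v \<partial>lborel)
      * indicator {0<..} x + (\<integral>\<^sup>+v. (H (- x) v + H (- x) (- v)) * ?I x v * indicator {0<..} v \<partial>lborel) * indicator {0<..} x \<partial>lborel)"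
    by (subst nn_integral_reflect) (auto simp: distrib_right I_even(2) intro!: nn_integral_cong)
  also have "\<dots> = (\<integral>\<^sup>+x. (\<integral>\<^sup>+v. ?S x v * ?I x v * indicator {0<..} v \<partial>lborel) * indicator {0<..} x \<partial>lborel)"
    by (intro nn_integral_cong, subst distrib_right[symmetric], subst nn_integral_add[symmetric])
      (auto simp: distrib_right add_ac intro!: arg_cong2[where f = "(*)"] nn_integral_cong)
  also have "\<dots> = (\<integral>\<^sup>+x. \<integral>\<^sup>+a. ennreal (jac a x) * ?S x (speed x a) \<partial>lborel \<partial>lborel)"
  proof (rule nn_integral_cong)
    fix x :: real
    show "(\<integral>\<^sup>+v. ?S x v * ?I x v * indicator {0<..} v \<partial>lborel) * indicator {0<..} x
       = (\<integral>\<^sup>+a. ennreal (jac a x) * ?S x (speed x a) \<partial>lborel)"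
    proof (cases "0 < x \<and> x < R")
      case True
      then have "(\<integral>\<^sup>+v. ?S x v * ?I x v * indicator {0<..} v \<partial>lborel) = (\<integral>\<^sup>+v. ?S x v * indicator {0<..<speed x R} v \<partial>lborel)"
        by (intro nn_integral_cong) (use speed_less_iff[of x] in \<open>auto simp: indicator_def\<close>)
      also have "\<dots> = (\<integral>\<^sup>+a. ?S x (speed x a) * ennreal (U' a / speed x a) * indicator {x<..<R} a \<partial>lborel)"
        using True by (intro speed_substitution_open) auto
      also have "\<dots> = (\<integral>\<^sup>+a. ennreal (jac a x) * ?S x (speed x a) \<partial>lborel)"
        using True by (intro nn_integral_cong) (auto simp: jac_def indicator_def mult.commute)
      finally show ?thesis using True by simp
    next
      case False
      have "jac a x = 0" for a using False by (auto simp: jac_def)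
      moreover have "?S x v * ?I x v * indicator {0<..} v * indicator {0<..} x = 0" for v
        using False speed_less_iff[of x v] by (auto simp: indicator_def)
      then have "(\<integral>\<^sup>+v. ?S x v * ?I x v * indicator {0<..} v * indicator {0<..} x \<partial>lborel)
          = (\<integral>\<^sup>+v. 0 \<partial>(lborel :: real measure))" by (intro nn_integral_cong)
      ultimately show ?thesis by (simp add: nn_integral_multc)
    qed
  qed
  also have "\<dots> = (\<integral>\<^sup>+a. \<integral>\<^sup>+x. ennreal (jac a x) * ?S x (speed x a) \<partial>lborel \<partial>lborel)"
    by (rule lborel_pair.Fubini') simp
  also have "\<dots> = (\<integral>\<^sup>+a. \<integral>\<^sup>+x. (\<integral>\<^sup>+vb. ennreal (jac a x) * orbit_sum f vb a x \<partial>lborel) \<partial>lborel \<partial>lborel)"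
    by (simp add: H_def orbit_sum_def nn_integral_add nn_integral_cmult)
  also have "\<dots> = (\<integral>\<^sup>+p. (\<integral>\<^sup>+vb. ennreal (jac (fst p) (snd p)) * orbit_sum f vb (fst p) (snd p) \<partial>lborel) \<partial>(lborel \<Otimes>\<^sub>M lborel))"
    unfolding orbit_sum_def
    by (subst lborel.nn_integral_fst[symmetric]) simp_all
  also have "\<dots> = (\<integral>\<^sup>+vb. (\<integral>\<^sup>+p. ennreal (jac (fst p) (snd p)) * orbit_sum f vb (fst p) (snd p) \<partial>(lborel \<Otimes>\<^sub>M lborel)) \<partial>lborel)"
  proof -
    have "(\<lambda>(p, vb). ennreal (jac (fst p) (snd p)) * orbit_sum f vb (fst p) (snd p))
        \<in> borel_measurable ((borel \<Otimes>\<^sub>M borel) \<Otimes>\<^sub>M borel)"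
      unfolding orbit_sum_def by measurable
    then have "(\<lambda>(p, vb). ennreal (jac (fst p) (snd p)) * orbit_sum f vb (fst p) (snd p))
        \<in> borel_measurable (lborel \<Otimes>\<^sub>M lborel)"
      by (simp add: borel_prod lborel_prod)
    from lborel_pair.Fubini'[OF this] show ?thesis by (simp add: lborel_prod)
  qed
  finally show ?thesis by (simp add: lborel_prod)
qed

end

text \<open>In the integrable case this is Fubini; otherwise the integral is 0 by
  convention.\<close>

lemma (in pair_sigma_finite) integral_zero_of_sections:
  fixes f :: "'a \<times> 'b \<Rightarrow> real"
  assumes "\<And>x. (LINT y|M2. f (x, y)) = 0"
  shows "(LINT z|(M1 \<Otimes>\<^sub>M M2). f z) = 0"
proof (cases "integrable (M1 \<Otimes>\<^sub>M M2) f")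
  case True
  from integral_fst'[OF this] assms show ?thesis by simp
qed (simp add: not_integrable_integral_eq)

text \<open>No integrability hypothesis: a non-integrable function has integral 0 by convention.\<close>
lemma FTC_loop:
  fixes F f :: "real \<Rightarrow> real"
  assumes cd: "c \<le> d" and F: "continuous_on {c..d} F" "F c = F d"
    and F': "\<And>x. c < x \<Longrightarrow> x < d \<Longrightarrow> (F has_real_derivative f x) (at x)"
  shows "(LINT x:{c<..<d}|lborel. f x) = 0"
proof (cases "set_integrable lborel {c<..<d} f")
  case True
  then show ?thesis using FTC_open[OF cd F(1) F' True] F(2) by simp
qed (simp add: set_integrable_def set_lebesgue_integral_def not_integrable_integral_eq)

context planar_potential
begin

text \<open>Reduces an identity on phase space to one identity per orbit. The transformation formula
  is applied to the positive and the negative part separately, and the two are recombined before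
  sections are taken.\<close>

lemma integral_phase_zero:
  fixes f :: "ph \<Rightarrow> real"
  assumes f: "integrable lborel f" and supp: "\<And>z. U R \<le> energy U z \<Longrightarrow> f z = 0"
    and zero: "\<And>vb a. 0 < a \<Longrightarrow> a < R \<Longrightarrow> (LINT x:{0<..<a}|lborel. jac a x * orbit_sum f vb a x) = 0"
  shows "(LINT z|lborel. f z) = 0"
proof -
  let ?G = "\<lambda>f z. jac (fst (snd z)) (snd (snd z)) * orbit_sum f (fst z) (fst (snd z)) (snd (snd z))"
  have part: "integrable (lborel \<Otimes>\<^sub>M lborel) (?G g)" "enn2real (\<integral>\<^sup>+z. ennreal (g z) \<partial>lborel) = (LINT z|(lborel \<Otimes>\<^sub>M lborel). ?G g z)"
    if g: "integrable lborel g" "\<And>z. 0 \<le> g z" "\<And>z. U R \<le> energy U z \<Longrightarrow> g z = 0" for g :: "ph \<Rightarrow> real"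
  proof -
    have [measurable]: "g \<in> borel_measurable (borel \<Otimes>\<^sub>M (borel \<Otimes>\<^sub>M borel))"
      using g(1) by (simp add: borel_prod)
    have "?G g \<in> borel_measurable (borel \<Otimes>\<^sub>M (borel \<Otimes>\<^sub>M borel))"
      unfolding orbit_sum_def by measurable
    then have meas: "?G g \<in> borel_measurable (lborel \<Otimes>\<^sub>M lborel)" by (simp add: borel_prod lborel_prod)
    have nonneg: "0 \<le> ?G g z" for z
      using jac_nonneg g(2) by (simp add: orbit_sum_def)
    have "(\<integral>\<^sup>+z. ennreal (g z) \<partial>lborel) = (\<integral>\<^sup>+z. ennreal (g z) * indicator {z. energy U z < U R} z \<partial>lborel)"
      by (rule nn_integral_cong) (use g(3) in \<open>auto simp: indicator_def not_less\<close>)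
    also have "\<dots> = (\<integral>\<^sup>+vb. (\<integral>\<^sup>+p. ennreal (jac (fst p) (snd p)) * orbit_sum (\<lambda>z. ennreal (g z)) vb (fst p) (snd p) \<partial>lborel) \<partial>lborel)"
      by (rule nn_integral_phase) (use g(1) in simp)
    also have "\<dots> = (\<integral>\<^sup>+vb. (\<integral>\<^sup>+p. ennreal (?G g (vb, p)) \<partial>lborel) \<partial>lborel)"
    proof (intro nn_integral_cong)
      fix vb p
      have "orbit_sum (\<lambda>z. ennreal (g z)) vb (fst p) (snd p) = ennreal (orbit_sum g vb (fst p) (snd p))"
        by (simp only: orbit_sum_def ennreal_plus g(2) add_nonneg_nonneg)
      moreover have "0 \<le> orbit_sum g vb (fst p) (snd p)" by (simp only: orbit_sum_def g(2) add_nonneg_nonneg)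
      ultimately show "ennreal (jac (fst p) (snd p)) * orbit_sum (\<lambda>z. ennreal (g z)) vb (fst p) (snd p) = ennreal (?G g (vb, p))"
        by (simp only: fst_conv snd_conv ennreal_mult[OF jac_nonneg])
    qed
    also have "\<dots> = (\<integral>\<^sup>+z. ennreal (?G g z) \<partial>(lborel \<Otimes>\<^sub>M lborel))"
      by (rule lborel.nn_integral_fst) (use meas in simp)
    finally have eq: "(\<integral>\<^sup>+z. ennreal (g z) \<partial>lborel) = (\<integral>\<^sup>+z. ennreal (?G g z) \<partial>(lborel \<Otimes>\<^sub>M lborel))" .
    have "(\<integral>\<^sup>+z. ennreal (g z) \<partial>lborel) < \<infinity>"
      using g(1,2) by (simp add: integrable_iff_bounded)
    then show "integrable (lborel \<Otimes>\<^sub>M lborel) (?G g)"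
      unfolding eq by (intro integrableI_nonneg meas AE_I2 nonneg)
    show "enn2real (\<integral>\<^sup>+z. ennreal (g z) \<partial>lborel) = (LINT z|(lborel \<Otimes>\<^sub>M lborel). ?G g z)"
      unfolding eq by (rule integral_eq_nn_integral[symmetric, OF meas AE_I2[OF nonneg]])
  qed
  define p where "p z = max 0 (f z)" for z
  define n where "n z = max 0 (- f z)" for z
  have pn: "0 \<le> p z" "0 \<le> n z" "p z - n z = f z" "ennreal (p z) = ennreal (f z)" "ennreal (n z) = ennreal (- f z)" for z
    by (auto simp: p_def n_def max_def ennreal_neg)
  have z: "p z = 0" "n z = 0" if "U R \<le> energy U z" for z using supp[OF that] by (simp_all add: p_def n_def)
  have i: "integrable lborel p" "integrable lborel n"
    unfolding p_def[abs_def] n_def[abs_def] using f by (auto intro: integrable_max)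
  note P = part[OF i(1) pn(1) z(1)] and N = part[OF i(2) pn(2) z(2)]
  have "(LINT z|lborel. f z) = enn2real (\<integral>\<^sup>+z. ennreal (p z) \<partial>lborel) - enn2real (\<integral>\<^sup>+z. ennreal (n z) \<partial>lborel)"
    unfolding pn by (rule real_lebesgue_integral_def[OF f])
  also have "\<dots> = (LINT z|(lborel \<Otimes>\<^sub>M lborel). ?G p z) - (LINT z|(lborel \<Otimes>\<^sub>M lborel). ?G n z)"
    by (simp only: P(2) N(2))
  also have "\<dots> = (LINT z|(lborel \<Otimes>\<^sub>M lborel). ?G p z - ?G n z)"
    by (rule Bochner_Integration.integral_diff[symmetric, OF P(1) N(1)])
  also have "(\<lambda>z. ?G p z - ?G n z) = ?G f"
  proof
    fix z
    have "orbit_sum p u a x - orbit_sum n u a x = orbit_sum f u a x" for u a x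
      unfolding orbit_sum_def pn(3)[symmetric] by (simp only: add_diff_add)
    then show "?G p z - ?G n z = ?G f z" by (simp only: right_diff_distrib[symmetric])
  qed
  also have "(LINT z|(lborel \<Otimes>\<^sub>M lborel). ?G f z) = 0"
  proof (rule lborel_pair.integral_zero_of_sections)
    fix vb :: "real \<times> real"
    have "(LINT p|(lborel \<Otimes>\<^sub>M lborel). ?G f (vb, p)) = 0"
    proof (rule lborel_pair.integral_zero_of_sections)
      fix a :: real
      show "(LINT x|lborel. ?G f (vb, (a, x))) = 0"
      proof (cases "0 < a \<and> a < R")
        case True
        have "(LINT x|lborel. ?G f (vb, (a, x))) = (LINT x:{0<..<a}|lborel. jac a x * orbit_sum f vb a x)"
          unfolding set_lebesgue_integral_def
          by (rule Bochner_Integration.integral_cong) (auto simp: indicator_def jac_def)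
        then show ?thesis using zero True by simp
      next
        case False
        then have "?G f (vb, (a, x)) = 0" for x by (auto simp: jac_def)
        then have "(LINT x|lborel. ?G f (vb, (a, x))) = (LINT x|(lborel :: real measure). 0)"
          by (intro Bochner_Integration.integral_cong refl)
        then show ?thesis by simp
      qed
    qed
    then show "(LINT p|lborel. ?G f (vb, p)) = 0" by (simp add: lborel_prod)
  qed
  finally show ?thesis .
qed

text \<open>The turning point as a function of the energy, inverse to U on [0, R]. Being a supremum
  of growing sets it is monotone, hence measurable; the maximum with U 0 keeps the set nonempty for
  every E.\<close>

definition radius :: "real \<Rightarrow> real" where
  "radius E = Sup {a \<in> {0..R}. U a \<le> max (U 0) E}"

lemma radius_U: assumes a: "0 \<le> a" "a \<le> R" shows "radius (U a) = a"
proof -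
  have "{b \<in> {0..R}. U b \<le> max (U 0) (U a)} = {0..a}"
  proof -
    have "max (U 0) (U a) = U a" using U_le_iff[of 0 a] a by simp
    moreover have "b \<in> {0..R} \<and> U b \<le> U a \<longleftrightarrow> b \<in> {0..a}" for b
      using U_le_iff[of b a] a by auto
    ultimately show ?thesis by (intro set_eqI) (simp only: mem_Collect_eq)
  qed
  then show ?thesis using a by (simp add: radius_def)
qed

lemma radius_meas[measurable]: "radius \<in> borel_measurable borel"
proof (rule borel_measurable_mono, rule monoI)
  fix E E' :: real assume E: "E \<le> E'"
  have "0 \<in> {a \<in> {0..R}. U a \<le> max (U 0) E}" using R_pos by simp
  moreover have "bdd_above {a \<in> {0..R}. U a \<le> max (U 0) E'}" by (rule bdd_aboveI[of _ R]) simp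
  moreover have "{a \<in> {0..R}. U a \<le> max (U 0) E} \<subseteq> {a \<in> {0..R}. U a \<le> max (U 0) E'}"
    using order_trans[OF _ max.mono[OF order_refl E, of "U 0"]] by (intro Collect_mono impI conjI) auto
  ultimately show "radius E \<le> radius E'"
    unfolding radius_def by (intro cSup_subset_mono) blast+
qed

lemma radius_exists:
  assumes "energy U (x, v, vb) < U R"
  shows "\<exists>a. \<bar>x\<bar> \<le> a \<and> a < R \<and> energy U (x, v, vb) = U a"
proof -
  have Ux: "U x = U \<bar>x\<bar>" using U_even by (simp add: abs_if)
  have E: "U \<bar>x\<bar> \<le> energy U (x, v, vb)" by (simp add: energy_def Ux)
  then have "\<bar>x\<bar> < R" using assms U_less_iff[of "\<bar>x\<bar>" R] R_pos by simp
  then obtain a where a: "\<bar>x\<bar> \<le> a" "a \<le> R" "U a = energy U (x, v, vb)"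
    using IVT'[of U "\<bar>x\<bar>" "energy U (x, v, vb)" R] E assms U_cont by auto
  moreover have "a \<noteq> R" using a(3) assms by auto
  ultimately show ?thesis by force
qed

lemma energy_cont: "continuous_on S (energy U)"
proof -
  have "continuous_on S (\<lambda>z :: ph. (fst (snd z))\<^sup>2 / 2 + U (fst z))"
    by (intro continuous_intros continuous_on_compose2[OF U_cont[of UNIV]]) auto
  then show ?thesis by (simp add: energy_def[abs_def] case_prod_beta)
qed

lemma energy_meas[measurable]: "energy U \<in> borel_measurable borel"
  by (intro borel_measurable_continuous_onI energy_cont)

lemma energy_orbit:
  assumes "0 \<le> x" "x \<le> a" "\<sigma> = 1 \<or> \<sigma> = -1" "\<tau> = 1 \<or> \<tau> = -1"
  shows "energy U (\<sigma> * x, \<tau> * speed x a, vb) = U a"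
proof -
  have "(\<tau> * speed x a)\<^sup>2 = 2 * (U a - U x)" "U (\<sigma> * x) = U x"
    using speed_sq[OF assms(1,2)] assms(3,4) U_even by (auto simp: power_mult_distrib)
  then show ?thesis by (simp only: energy_def prod.case) (simp add: field_simps)
qed

text \<open>The value 0 outside the meaningful triangle lets bounds and measurability be stated on
  the whole plane.\<close>

definition cut :: "(real \<Rightarrow> real \<Rightarrow> real) \<Rightarrow> real \<Rightarrow> real \<Rightarrow> real" where
  "cut P a x = (if 0 < a \<and> a \<le> R \<and> 0 \<le> x \<and> x \<le> a then P a x else 0)"

text \<open>Carries data in the orbit coordinates (a, x) to phase space, symmetrically in the signs
  of x and v1.\<close>

definition lift :: "(real \<Rightarrow> real \<Rightarrow> real) \<Rightarrow> ph \<Rightarrow> real" where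
  "lift P z = cut P (radius (energy U z)) \<bar>fst z\<bar>"

lemma lift_orbit:
  assumes "0 < x" "x < a" "a < R" "\<sigma> = 1 \<or> \<sigma> = -1" "\<tau> = 1 \<or> \<tau> = -1"
  shows "lift P (\<sigma> * x, \<tau> * speed x a, vb) = P a x"
  using assms energy_orbit[of x a \<sigma> \<tau> vb] radius_U[of a] by (auto simp: lift_def cut_def abs_mult)

lemma fst_snd_meas[measurable]:
  "(fst :: ph \<Rightarrow> real) \<in> borel_measurable borel" "(\<lambda>z :: ph. fst (snd z)) \<in> borel_measurable borel"
  "(\<lambda>z :: ph. snd (snd z)) \<in> borel_measurable borel"
  by (intro borel_measurable_continuous_onI continuous_intros)+

lemma lift_meas[measurable]:
  assumes [measurable]: "case_prod (cut P) \<in> borel_measurable (borel \<Otimes>\<^sub>M borel)"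
  shows "lift P \<in> borel_measurable borel"
proof -
  have "(\<lambda>z. cut P (radius (energy U z)) \<bar>fst z\<bar>) \<in> borel_measurable borel" by measurable
  then show ?thesis by (simp add: lift_def[abs_def])
qed

text \<open>Along the flow \<sigma> x moves with velocity \<tau> speed, so dx/dt = \<sigma> \<tau>
  speed on the arc with these signs. As the transport operator is d/dt, this accounts for both the
  sign and the divisor.\<close>

lemma curve_deriv:
  assumes \<xi>: "(\<xi> has_derivative D) (at (\<sigma> * x, \<tau> * speed x a, vb))"
    and x: "0 < x" "x < a" and s: "\<sigma> = 1 \<or> \<sigma> = -1" "\<tau> = 1 \<or> \<tau> = -1"
  shows "((\<lambda>x. \<xi> (\<sigma> * x, \<tau> * speed x a, vb)) has_real_derivative
     \<sigma> * \<tau> * Dtrans U \<xi> (\<sigma> * x, \<tau> * speed x a, vb) / speed x a) (at x)"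
proof -
  let ?z = "(\<sigma> * x, \<tau> * speed x a, vb)" and ?u = "- U' x / speed x a"
  have sp: "0 < speed x a" using speed_pos x by simp
  have fr: "frechet_derivative \<xi> (at ?z) = D" by (rule frechet_derivative_at[OF \<xi>, symmetric])
  have dU: "deriv U (\<sigma> * x) = \<sigma> * U' x"
    unfolding DERIV_imp_deriv[OF U_deriv] using s(1) by (auto simp: U'_odd)
  interpret D: linear D using \<xi> by (rule has_derivative_linear)
  have 1: "((\<lambda>x. \<sigma> * x) has_vector_derivative \<sigma>) (at x)"
    by (auto intro!: derivative_eq_intros simp: has_real_derivative_iff_has_vector_derivative[symmetric])
  have 2: "((\<lambda>x. \<tau> * speed x a) has_vector_derivative \<tau> * ?u) (at x)"
    unfolding has_real_derivative_iff_has_vector_derivative[symmetric]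
    by (rule DERIV_cmult[OF speed_deriv(1)[OF less_imp_le[OF x(1)] x(2)]])
  have "((\<lambda>x. (\<sigma> * x, \<tau> * speed x a, vb)) has_vector_derivative (\<sigma>, \<tau> * ?u, 0)) (at x)"
    by (intro has_vector_derivative_Pair 1 2 has_vector_derivative_const)
  then have "((\<lambda>x. (\<sigma> * x, \<tau> * speed x a, vb)) has_derivative (\<lambda>h. h *\<^sub>R (\<sigma>, \<tau> * ?u, 0))) (at x)"
    by (simp only: has_vector_derivative_def)
  from has_derivative_compose[OF this \<xi>]
  have "((\<lambda>x. \<xi> (\<sigma> * x, \<tau> * speed x a, vb)) has_real_derivative D (\<sigma>, \<tau> * ?u, 0)) (at x)"
    by (simp only: has_field_derivative_def D.scaleR real_scaleR_def mult_commute_abs)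
  moreover have "D (\<sigma>, \<tau> * ?u, 0) = \<sigma> * \<tau> * Dtrans U \<xi> ?z / speed x a"
  proof -
    have "(r, t, 0) = r *\<^sub>R (1, 0, (0, 0)) + t *\<^sub>R (0, 1, (0, 0 :: real))" for r t :: real
      by (simp add: zero_prod_def)
    then have "D (\<sigma>, \<tau> * ?u, 0) = D (\<sigma> *\<^sub>R (1, 0, (0, 0)) + (\<tau> * ?u) *\<^sub>R (0, 1, (0, 0)))"
      by (rule arg_cong[where f = D])
    also have "\<dots> = \<sigma> * D (1, 0, (0, 0)) + \<tau> * ?u * D (0, 1, (0, 0))"
      by (simp only: D.add D.scaleR real_scaleR_def)
    also have "\<dots> = \<sigma> * \<tau> * Dtrans U \<xi> ?z / speed x a"
    proof -
      have alg: "\<sigma> * k + \<tau> * (- u / v) * l = \<sigma> * \<tau> * (\<tau> * v * k - \<sigma> * u * l) / v"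
        if "v \<noteq> 0" for k l u v :: real
        using s that by (auto simp: divide_simps)
      show ?thesis unfolding Dtrans_def prod.case fr dU by (rule alg) (use sp in simp)
    qed
    finally show ?thesis .
  qed
  ultimately show ?thesis by (rule DERIV_cong)
qed

end

section \<open>Weak derivatives in the weighted space\<close>

locale planar_phase = planar_steady +
  fixes \<beta> :: "real \<times> real \<Rightarrow> real"
  assumes beta_cont: "continuous_on UNIV \<beta>"
    and beta_nonneg: "\<And>u. 0 \<le> \<beta> u"
    and beta_int: "integrable lborel \<beta>"
    and beta_one: "(LINT u|lborel. \<beta> u) = 1"
    and alpha_pos: "\<And>E. E < U R \<Longrightarrow> 0 < \<alpha> E"
begin

abbreviation \<Omega> :: "ph set" where "\<Omega> \<equiv> Omega0 \<alpha> \<beta> U"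

lemma Omega_iff: "z \<in> \<Omega> \<longleftrightarrow> energy U z < U R \<and> 0 < \<beta> (snd (snd z))"
  using alpha_pos[of "energy U z"] alpha_zero[of "energy U z"] beta_nonneg[of "snd (snd z)"]
  by (cases "energy U z < U R") (auto simp: Omega0_def fzero_def case_prod_beta zero_less_mult_iff)

lemma beta_meas[measurable]: "\<beta> \<in> borel_measurable borel"
  by (intro borel_measurable_continuous_onI beta_cont)

lemma Omega_sets[measurable]: "\<Omega> \<in> sets borel"
proof -
  have "\<Omega> = {z \<in> space borel. energy U z < U R \<and> 0 < \<beta> (snd (snd z))}" by (auto simp: Omega_iff)
  also have "\<dots> \<in> sets borel" by measurable
  finally show ?thesis .
qed

text \<open>Agrees with |\<phi>'| on \<Omega>, but avoids \<open>deriv\<close> and is measurable on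
  all of phase space.\<close>

definition dens :: "ph \<Rightarrow> real" where "dens z = A (energy U z) * \<beta> (snd (snd z))"

lemma dens_meas[measurable]: "dens \<in> borel_measurable borel"
  unfolding dens_def[abs_def] by measurable

lemma energy_ge: "U 0 \<le> energy U z"
proof -
  have "U 0 \<le> U \<bar>fst z\<bar>" using U_le_iff[of 0 "\<bar>fst z\<bar>"] by simp
  also have "U \<bar>fst z\<bar> = U (fst z)" using U_even by (simp add: abs_if)
  finally show ?thesis by (simp add: energy_def case_prod_beta add_increasing)
qed

lemma dens_pos: "z \<in> \<Omega> \<Longrightarrow> 0 < dens z"
  using A_lower[OF energy_ge[of z]] A0 by (simp add: Omega_iff dens_def)

lemma phid_dens: "z \<in> \<Omega> \<Longrightarrow> \<bar>phid \<alpha> \<beta> U z\<bar> = dens z"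
  using dens_pos[of z] DERIV_imp_deriv[OF alpha_deriv, of "energy U z"]
  by (simp add: Omega_iff phid_def dens_def case_prod_beta abs_minus_commute)

text \<open>In orbit coordinates the mass is at most 4 times the integral of \<beta> times that of w
  a quarter a, and quarter a \<le> quarter R. Finite mass places every bounded measurable function
  times |\<phi>'| in the weighted space; the eigenfunction and its derivatives have this
  shape.\<close>

lemma dens_integrable: "integrable lborel (\<lambda>z. indicator \<Omega> z * dens z)"
proof (rule integrableI_nonneg)
  let ?f = "\<lambda>z. indicator \<Omega> z * dens z"
  show "?f \<in> borel_measurable lborel" by measurable
  show "AE z in lborel. 0 \<le> ?f z"
    using dens_pos by (intro AE_I2) (auto simp: indicator_def intro: less_imp_le)
  have "(\<integral>\<^sup>+z. ennreal (?f z) \<partial>lborel) = (\<integral>\<^sup>+z. ennreal (?f z) * indicator {z. energy U z < U R} z \<partial>lborel)"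
    by (rule nn_integral_cong) (auto simp: indicator_def Omega_iff)
  also have "\<dots> = (\<integral>\<^sup>+vb. (\<integral>\<^sup>+p. ennreal (jac (fst p) (snd p)) * orbit_sum (\<lambda>z. ennreal (?f z)) vb (fst p) (snd p) \<partial>lborel) \<partial>lborel)"
    by (rule nn_integral_phase) simp
  also have "\<dots> \<le> (\<integral>\<^sup>+vb. (\<integral>\<^sup>+p. ennreal (4 * \<beta> vb) * ennreal (w (fst p) * slow (fst p) (snd p)) \<partial>lborel) \<partial>lborel)"
  proof (intro nn_integral_mono)
    fix vb :: "real \<times> real" and p :: "real \<times> real"
    obtain a x where p: "p = (a, x)" by force
    show "ennreal (jac (fst p) (snd p)) * orbit_sum (\<lambda>z. ennreal (?f z)) vb (fst p) (snd p)
       \<le> ennreal (4 * \<beta> vb) * ennreal (w (fst p) * slow (fst p) (snd p))"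
    proof (cases "0 < x \<and> x < a \<and> a < R")
      case True
      have e: "energy U (x, speed x a, vb) = U a" "energy U (- x, speed x a, vb) = U a"
          "energy U (x, - speed x a, vb) = U a" "energy U (- x, - speed x a, vb) = U a"
        using energy_orbit[of x a 1 1 vb] energy_orbit[of x a "-1" 1 vb]
          energy_orbit[of x a 1 "-1" vb] energy_orbit[of x a "-1" "-1" vb] True by auto
      have A: "0 < A (U a)" using A_U_lower[of a] A0 True by simp
      have le: "?f z \<le> A (U a) * \<beta> vb" if "energy U z = U a" "snd (snd z) = vb" for z
        using that A beta_nonneg[of vb] by (auto simp: indicator_def dens_def)
      have "orbit_sum (\<lambda>z. ennreal (?f z)) vb a x \<le>
          (ennreal (A (U a) * \<beta> vb) + ennreal (A (U a) * \<beta> vb)) + (ennreal (A (U a) * \<beta> vb) + ennreal (A (U a) * \<beta> vb))"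
        unfolding orbit_sum_def by (intro add_mono ennreal_leI le e) auto
      also have "\<dots> = ennreal (4 * (A (U a) * \<beta> vb))" using A beta_nonneg by (simp flip: ennreal_plus)
      finally have "ennreal (jac a x) * orbit_sum (\<lambda>z. ennreal (?f z)) vb a x \<le> ennreal (jac a x) * ennreal (4 * (A (U a) * \<beta> vb))"
        by (rule mult_left_mono) simp
      also have "\<dots> = ennreal (jac a x * (4 * (A (U a) * \<beta> vb)))"
        using A beta_nonneg jac_nonneg by (intro ennreal_mult[symmetric]) auto
      also have "jac a x * (4 * (A (U a) * \<beta> vb)) = 4 * \<beta> vb * (w a * slow a x)"
        using True by (simp add: jac_def w_def slow_def)
      also have "ennreal \<dots> = ennreal (4 * \<beta> vb) * ennreal (w a * slow a x)"
        using beta_nonneg w_nonneg slow_nonneg by (intro ennreal_mult) auto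
      finally show ?thesis by (simp add: p)
    qed (auto simp: p jac_def)
  qed
  also have "\<dots> = (\<integral>\<^sup>+vb. ennreal (4 * \<beta> vb) \<partial>lborel) * (\<integral>\<^sup>+p. ennreal (w (fst p) * slow (fst p) (snd p)) \<partial>(lborel \<Otimes>\<^sub>M lborel))"
  proof -
    have "(\<lambda>p. ennreal (w (fst p) * slow (fst p) (snd p))) \<in> borel_measurable (borel \<Otimes>\<^sub>M borel)" by measurable
    then have "(\<lambda>p. ennreal (w (fst p) * slow (fst p) (snd p))) \<in> borel_measurable borel" by (simp add: borel_prod)
    then show ?thesis by (simp add: nn_integral_cmult nn_integral_multc lborel_prod)
  qed
  also have "(\<integral>\<^sup>+p. ennreal (w (fst p) * slow (fst p) (snd p)) \<partial>(lborel \<Otimes>\<^sub>M lborel))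
      = (\<integral>\<^sup>+a. \<integral>\<^sup>+x. ennreal (w a * slow a x) \<partial>lborel \<partial>lborel)"
    by (subst lborel.nn_integral_fst[symmetric]) auto
  also have "\<dots> \<le> (\<integral>\<^sup>+a. ennreal (w a * quarter R) \<partial>lborel)"
  proof (rule nn_integral_mono)
    fix a
    show "(\<integral>\<^sup>+x. ennreal (w a * slow a x) \<partial>lborel) \<le> ennreal (w a * quarter R)"
    proof (cases "0 < a \<and> a < R")
      case True
      then have a: "0 < a" "a \<le> R" by auto
      have "(\<integral>\<^sup>+x. ennreal (w a * slow a x) \<partial>lborel) = ennreal (LINT x|lborel. w a * slow a x)"
        using slow_integrable[OF a] w_nonneg slow_nonneg by (intro nn_integral_eq_integral) auto
      also have "\<dots> = ennreal (w a * quarter a)" by (simp add: quarter_def)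
      finally show ?thesis using quarter_mono[OF a] w_nonneg[of a] by (simp add: mult_left_mono ennreal_leI)
    qed (auto simp: w_def)
  qed
  also have "\<dots> = ennreal (LINT a|lborel. w a * quarter R)"
    using w_integrable w_nonneg quarter_pos[OF R_pos] by (intro nn_integral_eq_integral) auto
  also have "(\<integral>\<^sup>+vb. ennreal (4 * \<beta> vb) \<partial>lborel) = ennreal (LINT vb|lborel. 4 * \<beta> vb)"
    using beta_int beta_nonneg by (intro nn_integral_eq_integral) auto
  finally have "(\<integral>\<^sup>+z. ennreal (?f z) \<partial>lborel) \<le> ennreal (LINT vb|lborel. 4 * \<beta> vb) * ennreal (LINT a|lborel. w a * quarter R)"
    by (simp add: mult_left_mono)
  also have "\<dots> < \<infinity>" by (simp add: ennreal_mult_less_top)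
  finally show "(\<integral>\<^sup>+z. ennreal (?f z) \<partial>lborel) < \<infinity>" .
qed

lemma dens_mult_integrable:
  assumes [measurable]: "b \<in> borel_measurable borel" and C: "\<And>z. z \<in> \<Omega> \<Longrightarrow> \<bar>b z\<bar> \<le> C"
  shows "integrable lborel (\<lambda>z. indicator \<Omega> z * (dens z * b z))"
proof (rule Bochner_Integration.integrable_bound[OF integrable_mult_right[OF dens_integrable, of C]])
  show "(\<lambda>z. indicator \<Omega> z * (dens z * b z)) \<in> borel_measurable lborel" by measurable
  show "AE z in lborel. norm (indicator \<Omega> z * (dens z * b z)) \<le> norm (C * (indicator \<Omega> z * dens z))"
  proof (rule AE_I2)
    fix z
    show "norm (indicator \<Omega> z * (dens z * b z)) \<le> norm (C * (indicator \<Omega> z * dens z))"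
    proof (cases "z \<in> \<Omega>")
      case True
      have "\<bar>dens z\<bar> * \<bar>b z\<bar> \<le> \<bar>dens z\<bar> * \<bar>C\<bar>" using C[OF True] by (intro mult_left_mono) auto
      then show ?thesis using True by (simp add: abs_mult mult.commute)
    qed simp
  qed
qed

lemma dens_mult_Hbar:
  assumes b[measurable]: "b \<in> borel_measurable borel" and C: "\<And>z. z \<in> \<Omega> \<Longrightarrow> \<bar>b z\<bar> \<le> C"
  shows "(\<lambda>z. dens z * b z) \<in> Hbar \<alpha> \<beta> U"
proof -
  have "integrable lborel (\<lambda>z. indicator \<Omega> z * (dens z * (b z)\<^sup>2))"
  proof (rule dens_mult_integrable)
    fix z assume "z \<in> \<Omega>"
    then have "\<bar>b z\<bar>\<^sup>2 \<le> C\<^sup>2" using C by (intro power_mono) auto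
    then show "\<bar>(b z)\<^sup>2\<bar> \<le> C\<^sup>2" by simp
  qed measurable
  also have "(\<lambda>z. indicator \<Omega> z * (dens z * (b z)\<^sup>2)) = (\<lambda>z. indicator \<Omega> z *\<^sub>R ((dens z * b z)\<^sup>2 / \<bar>phid \<alpha> \<beta> U z\<bar>))"
  proof
    fix z
    show "indicator \<Omega> z * (dens z * (b z)\<^sup>2) = indicator \<Omega> z *\<^sub>R ((dens z * b z)\<^sup>2 / \<bar>phid \<alpha> \<beta> U z\<bar>)"
      using phid_dens[of z] dens_pos[of z] by (cases "z \<in> \<Omega>") (auto simp: power2_eq_square)
  qed
  finally show ?thesis
    unfolding Hbar_def set_integrable_def set_borel_measurable_def by simp
qed

lemma dens_mult_L1loc:
  assumes b[measurable]: "b \<in> borel_measurable borel" and C: "\<And>z. z \<in> \<Omega> \<Longrightarrow> \<bar>b z\<bar> \<le> C"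
  shows "L1loc \<Omega> (\<lambda>z. dens z * b z)"
  unfolding L1loc_def
proof (intro allI impI, elim conjE)
  fix K assume K: "compact K" "K \<subseteq> \<Omega>"
  have "set_integrable lborel \<Omega> (\<lambda>z. dens z * b z)"
    using dens_mult_integrable[OF b C] by (simp add: set_integrable_def)
  then show "set_integrable lborel K (\<lambda>z. dens z * b z)"
    by (rule set_integrable_subset) (use K borel_compact in auto)
qed

text \<open>Off the compact support, whose complement is open, the derivative vanishes together with
  \<xi>; so both are continuous with compact support.\<close>

lemma C1c_integrable:
  assumes "C1c \<Omega> \<xi>" and b[measurable]: "b \<in> borel_measurable borel" and C: "\<And>z. z \<in> \<Omega> \<Longrightarrow> \<bar>b z\<bar> \<le> C"
  shows "integrable lborel (\<lambda>z. indicator \<Omega> z * (b z * \<xi> z))"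
    "integrable lborel (\<lambda>z. indicator \<Omega> z * (b z * Dtrans U \<xi> z))"
proof -
  define K where "K = closure {z. \<xi> z \<noteq> 0}"
  obtain D' where D': "\<And>z. (\<xi> has_derivative blinfun_apply (D' z)) (at z)" and cD: "continuous_on UNIV D'"
    and K: "compact K" using assms(1) by (auto simp: C1c_def K_def)
  have xc: "continuous_on UNIV \<xi>"
    by (intro continuous_at_imp_continuous_on ballI has_derivative_continuous[OF D'])
  have fr: "frechet_derivative \<xi> (at z) = blinfun_apply (D' z)" for z
    by (rule frechet_derivative_at[OF D', symmetric])
  have Deq: "Dtrans U \<xi> z = fst (snd z) * D' z (1, 0, (0, 0)) - U' (fst z) * D' z (0, 1, (0, 0))" for z
    by (simp add: Dtrans_def case_prod_beta fr DERIV_imp_deriv[OF U_deriv])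
  have Dc: "continuous_on UNIV (Dtrans U \<xi>)"
    unfolding Deq[abs_def]
  proof (intro continuous_on_diff continuous_on_mult)
    show "continuous_on UNIV (\<lambda>z :: ph. fst (snd z))" by (intro continuous_intros)
    show "continuous_on UNIV (\<lambda>z :: ph. U' (fst z))"
      by (rule continuous_on_compose2[OF U'_cont[of UNIV]]) (auto intro: continuous_intros)
  qed (rule blinfun.continuous_on[OF cD continuous_on_const])+
  have xK: "\<xi> z = 0" if "z \<notin> K" for z
    using that closure_subset[of "{z. \<xi> z \<noteq> 0}"] unfolding K_def by blast
  have DK: "Dtrans U \<xi> z = 0" if z: "z \<notin> K" for z
  proof -
    have "(\<xi> has_derivative (\<lambda>_. 0)) (at z)"
      by (rule has_derivative_transform_within_open[of "\<lambda>_. 0" _ z UNIV "- K"]) (use z xK in \<open>simp_all add: open_Compl compact_imp_closed K\<close>)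
    then have "blinfun_apply (D' z) = (\<lambda>_. 0)" by (rule has_derivative_unique[OF D'])
    then show ?thesis by (simp add: Deq)
  qed
  have main: "integrable lborel (\<lambda>z. indicator \<Omega> z * (b z * f z))"
    if f: "continuous_on UNIV f" "\<And>z. z \<notin> K \<Longrightarrow> f z = 0" for f
  proof -
    have [measurable]: "f \<in> borel_measurable borel" by (intro borel_measurable_continuous_onI f(1))
    have "integrable lborel (\<lambda>z. indicator K z *\<^sub>R f z)"
      by (rule borel_integrable_compact[OF K continuous_on_subset[OF f(1)]]) simp
    also have "(\<lambda>z. indicator K z *\<^sub>R f z) = f"
    proof
      fix z show "indicator K z *\<^sub>R f z = f z" using f(2)[of z] by (cases "z \<in> K") simp_all
    qed
    finally have fi: "integrable lborel f" .
    show ?thesis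
    proof (rule Bochner_Integration.integrable_bound[OF integrable_mult_right[OF fi, of C]])
      show "AE z in lborel. norm (indicator \<Omega> z * (b z * f z)) \<le> norm (C * f z)"
      proof (rule AE_I2)
        fix z
        show "norm (indicator \<Omega> z * (b z * f z)) \<le> norm (C * f z)"
        proof (cases "z \<in> \<Omega>")
          case True
          then have "\<bar>b z\<bar> * \<bar>f z\<bar> \<le> \<bar>C\<bar> * \<bar>f z\<bar>" using C[OF True] by (intro mult_right_mono) auto
          then show ?thesis using True by (simp add: abs_mult)
        qed simp
      qed
    qed measurable
  qed
  show "integrable lborel (\<lambda>z. indicator \<Omega> z * (b z * \<xi> z))" by (rule main[OF xc xK])
  show "integrable lborel (\<lambda>z. indicator \<Omega> z * (b z * Dtrans U \<xi> z))" by (rule main[OF Dc DK])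
qed

text \<open>The factor |\<phi>'| of the two functions cancels the weight 1 / |\<phi>'|, and the weak
  identity says that b D\<xi> + d \<xi> has integral 0 over \<Omega>. It is then enough to check one
  closed orbit at a time.\<close>

lemma weakD_dens:
  assumes b: "b \<in> borel_measurable borel" "\<And>z. z \<in> \<Omega> \<Longrightarrow> \<bar>b z\<bar> \<le> C"
    and d: "d \<in> borel_measurable borel" "\<And>z. z \<in> \<Omega> \<Longrightarrow> \<bar>d z\<bar> \<le> C"
    and loop: "\<And>\<xi> vb a. C1c \<Omega> \<xi> \<Longrightarrow> 0 < a \<Longrightarrow> a < R \<Longrightarrow> 0 < \<beta> vb \<Longrightarrow>
      (LINT x:{0<..<a}|lborel. jac a x * orbit_sum (\<lambda>z. b z * Dtrans U \<xi> z + d z * \<xi> z) vb a x) = 0"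
  shows "weakD \<alpha> \<beta> U (\<lambda>z. dens z * b z) (\<lambda>z. dens z * d z)"
  unfolding weakD_def
proof (intro conjI allI impI)
  show "L1loc \<Omega> (\<lambda>z. dens z * b z)" by (rule dens_mult_L1loc[OF b])
  show "L1loc \<Omega> (\<lambda>z. dens z * d z)" by (rule dens_mult_L1loc[OF d])
  fix \<xi> assume \<xi>: "C1c \<Omega> \<xi>"
  note i1 = C1c_integrable(2)[OF \<xi> b] and i2 = C1c_integrable(1)[OF \<xi> d]
  let ?f = "\<lambda>z. indicator \<Omega> z * (b z * Dtrans U \<xi> z + d z * \<xi> z)"
  have 1: "(LINT z:\<Omega>|lborel. dens z * b z * Dtrans U \<xi> z / \<bar>phid \<alpha> \<beta> U z\<bar>) = (LINT z|lborel. indicator \<Omega> z * (b z * Dtrans U \<xi> z))"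
    unfolding set_lebesgue_integral_def
  proof (rule Bochner_Integration.integral_cong[OF refl])
    fix z
    show "indicator \<Omega> z *\<^sub>R (dens z * b z * Dtrans U \<xi> z / \<bar>phid \<alpha> \<beta> U z\<bar>) = indicator \<Omega> z * (b z * Dtrans U \<xi> z)"
      using phid_dens[of z] dens_pos[of z] by (cases "z \<in> \<Omega>") auto
  qed
  have 2: "(LINT z:\<Omega>|lborel. dens z * d z * \<xi> z / \<bar>phid \<alpha> \<beta> U z\<bar>) = (LINT z|lborel. indicator \<Omega> z * (d z * \<xi> z))"
    unfolding set_lebesgue_integral_def
  proof (rule Bochner_Integration.integral_cong[OF refl])
    fix z
    show "indicator \<Omega> z *\<^sub>R (dens z * d z * \<xi> z / \<bar>phid \<alpha> \<beta> U z\<bar>) = indicator \<Omega> z * (d z * \<xi> z)"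
      using phid_dens[of z] dens_pos[of z] by (cases "z \<in> \<Omega>") auto
  qed
  have sum: "(LINT z|lborel. ?f z) = (LINT z|lborel. indicator \<Omega> z * (b z * Dtrans U \<xi> z)) + (LINT z|lborel. indicator \<Omega> z * (d z * \<xi> z))"
    using Bochner_Integration.integral_add[OF i1 i2] by (simp add: distrib_left)
  have "(LINT z|lborel. ?f z) = 0"
  proof (rule integral_phase_zero)
    show "integrable lborel ?f" using Bochner_Integration.integrable_add[OF i1 i2] by (simp add: distrib_left)
    show "?f z = 0" if "U R \<le> energy U z" for z using that by (simp add: Omega_iff)
    fix vb :: "real \<times> real" and a assume a: "0 < a" "a < R"
    show "(LINT x:{0<..<a}|lborel. jac a x * orbit_sum ?f vb a x) = 0"
    proof (cases "0 < \<beta> vb")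
      case True
      have "orbit_sum ?f vb a x = orbit_sum (\<lambda>z. b z * Dtrans U \<xi> z + d z * \<xi> z) vb a x" if x: "0 < x" "x < a" for x
      proof -
        have "energy U (x, speed x a, vb) = U a" "energy U (- x, speed x a, vb) = U a"
          "energy U (x, - speed x a, vb) = U a" "energy U (- x, - speed x a, vb) = U a"
          using energy_orbit[of x a 1 1 vb] energy_orbit[of x a "-1" 1 vb]
            energy_orbit[of x a 1 "-1" vb] energy_orbit[of x a "-1" "-1" vb] x by auto
        moreover have "U a < U R" using U_strict a by simp
        ultimately have "(x, speed x a, vb) \<in> \<Omega>" "(- x, speed x a, vb) \<in> \<Omega>"
          "(x, - speed x a, vb) \<in> \<Omega>" "(- x, - speed x a, vb) \<in> \<Omega>"
          using True by (simp_all only: Omega_iff snd_conv simp_thms)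
        then show ?thesis by (simp only: orbit_sum_def indicator_simps mult_1_left)
      qed
      then have "(LINT x:{0<..<a}|lborel. jac a x * orbit_sum ?f vb a x) =
          (LINT x:{0<..<a}|lborel. jac a x * orbit_sum (\<lambda>z. b z * Dtrans U \<xi> z + d z * \<xi> z) vb a x)"
        by (intro set_lebesgue_integral_cong) auto
      then show ?thesis using loop[OF \<xi> a True] by simp
    next
      case False
      then have "orbit_sum ?f vb a x = 0" for x
        by (simp only: orbit_sum_def Omega_iff snd_conv indicator_def) simp
      then show ?thesis by (simp only: mult_zero_right set_lebesgue_integral_def) simp
    qed
  qed
  then show "(LINT z:\<Omega>|lborel. dens z * b z * Dtrans U \<xi> z / \<bar>phid \<alpha> \<beta> U z\<bar>)
     = - (LINT z:\<Omega>|lborel. dens z * d z * \<xi> z / \<bar>phid \<alpha> \<beta> U z\<bar>)"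
    unfolding 1 2 using sum by simp
qed

end

section \<open>The eigenfunction\<close>

lemma (in pair_sigma_finite) integral_times:
  fixes f :: "_ \<Rightarrow> real" and g :: "_ \<Rightarrow> real"
  assumes f: "integrable M1 f" and g: "integrable M2 g"
  shows "(LINT z|(M1 \<Otimes>\<^sub>M M2). f (fst z) * g (snd z)) = (LINT x|M1. f x) * (LINT y|M2. g y)"
proof -
  have "(LINT z|(M1 \<Otimes>\<^sub>M M2). f (fst z) * g (snd z)) = (LINT x|M1. LINT y|M2. f x * g y)"
    using integral_fst'[OF integrable_times[OF f g]] by (simp add: case_prod_unfold)
  then show ?thesis by simp
qed

context planar_potential
begin

text \<open>For signed integrands. The substitution formula for indicators identifies the image
  under \<open>speed x\<close> of the measure (U' a / speed x a) da with Lebesgue measure on (0,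
  speed x R).\<close>

lemma speed_substitution_real:
  fixes f :: "real \<Rightarrow> real"
  assumes f[measurable]: "f \<in> borel_measurable borel" and x: "0 \<le> x" "x < R"
    and int: "integrable lborel (\<lambda>a. indicator {x<..<R} a * (U' a / speed x a) * f (speed x a))"
  shows "integrable lborel (\<lambda>v. indicator {0<..<speed x R} v * f v)"
    "(LINT v|lborel. indicator {0<..<speed x R} v * f v) =
      (LINT a|lborel. indicator {x<..<R} a * (U' a / speed x a) * f (speed x a))"
proof -
  let ?g = "\<lambda>a. indicator {x<..<R} a * (U' a / speed x a)"
  have g0: "0 \<le> ?g a" for a
    using U'_nonneg[of a] speed_nonneg[of x a] x by (cases "x < a") auto
  have gm: "?g \<in> borel_measurable lborel" by measurable
  have im: "(\<lambda>v. indicator {0<..<speed x R} v :: real) \<in> borel_measurable lborel" by measurable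
  have sm: "speed x \<in> borel_measurable lborel" by measurable
  let ?M = "density lborel (\<lambda>a. ennreal (?g a))"
  have smM: "speed x \<in> measurable ?M borel" using sm by simp
  have eq: "distr ?M borel (speed x) = density lborel (\<lambda>v. ennreal (indicator {0<..<speed x R} v))"
  proof (rule measure_eqI)
    fix B assume "B \<in> sets (distr ?M borel (speed x))"
    then have B[measurable]: "B \<in> sets borel" by simp
    have "emeasure (distr ?M borel (speed x)) B = (\<integral>\<^sup>+b. indicator B b \<partial>distr ?M borel (speed x))"
      by simp
    also have "\<dots> = (\<integral>\<^sup>+a. indicator B (speed x a) \<partial>?M)"
      by (rule nn_integral_distr[OF smM]) simp
    also have "\<dots> = (\<integral>\<^sup>+a. ennreal (?g a) * indicator B (speed x a) \<partial>lborel)"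
      by (rule nn_integral_density) (use gm in measurable)
    also have "\<dots> = (\<integral>\<^sup>+a. indicator B (speed x a) * ennreal (U' a / speed x a) * indicator {x<..<R} a \<partial>lborel)"
      by (rule nn_integral_cong) (simp add: indicator_def)
    also have "\<dots> = (\<integral>\<^sup>+v. indicator B v * indicator {0<..<speed x R} v \<partial>lborel)"
      by (rule speed_substitution_open[symmetric]) (use x in auto)
    also have "\<dots> = (\<integral>\<^sup>+v. ennreal (indicator {0<..<speed x R} v) * indicator B v \<partial>lborel)"
      by (rule nn_integral_cong) (simp add: indicator_def)
    also have "\<dots> = emeasure (density lborel (\<lambda>v. ennreal (indicator {0<..<speed x R} v))) B"
      by (rule emeasure_density[symmetric]) auto
    finally show "emeasure (distr ?M borel (speed x)) B = emeasure (density lborel (\<lambda>v. ennreal (indicator {0<..<speed x R} v))) B" .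
  qed simp
  have "integrable ?M (\<lambda>a. f (speed x a))"
    using int by (subst integrable_density[OF _ gm]) (use g0 in auto)
  then have "integrable (distr ?M borel (speed x)) f"
    by (subst integrable_distr_eq[OF smM]) auto
  then show "integrable lborel (\<lambda>v. indicator {0<..<speed x R} v * f v)"
    unfolding eq by (subst (asm) integrable_density[OF _ im]) auto
  have "(LINT v|lborel. indicator {0<..<speed x R} v * f v) = (LINT v|distr ?M borel (speed x). f v)"
    unfolding eq by (subst integral_density[OF _ im]) auto
  also have "\<dots> = (LINT a|?M. f (speed x a))" by (rule integral_distr[OF smM f])
  also have "\<dots> = (LINT a|lborel. ?g a * f (speed x a))"
    by (subst integral_density[OF _ gm]) (use g0 in auto)
  finally show "(LINT v|lborel. indicator {0<..<speed x R} v * f v) = (LINT a|lborel. ?g a * f (speed x a))" .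
qed

lemma cut_meas:
  assumes [measurable]: "case_prod P \<in> borel_measurable (borel \<Otimes>\<^sub>M borel)"
  shows "case_prod (cut P) \<in> borel_measurable (borel \<Otimes>\<^sub>M borel)"
  unfolding cut_def[abs_def] by measurable

end

lemma sn_deriv:
  assumes "c \<noteq> 0" "(f has_real_derivative f') (at x)"
  shows "((\<lambda>x. sn c (f x)) has_real_derivative cos (c * f x) * f') (at x)"
proof -
  have "((\<lambda>x. sin (c * f x) / c) has_real_derivative cos (c * f x) * (c * f') / c) (at x)"
    by (intro DERIV_cdivide DERIV_chain2[OF DERIV_sin] DERIV_cmult assms(2))
  then show ?thesis using assms(1) by (simp add: sn_eq)
qed

section \<open>From a fixed point F to the eigenfunction on phase space\<close>

locale planar_mode = planar_phase +
  fixes c :: real and F :: "real \<Rightarrow> real"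
  assumes c_pos: "0 < c" and c_gap: "c * quarter R < pi"
    and F_cont: "continuous_on UNIV F"
    and F_eq: "\<And>x. x \<in> {0..R} \<Longrightarrow> F x = 8 * pi * (LINT a:{x<..<R}|lborel. w a * wave c F a x)"
begin

lemma c_ne: "c \<noteq> 0" using c_pos by simp

lemma F_meas[measurable]: "F \<in> borel_measurable borel"
  by (intro borel_measurable_continuous_onI F_cont)

abbreviation "Inn \<equiv> inner_part c F"
abbreviation "Out \<equiv> outer_part c F"

text \<open>The time derivative of \<open>wave\<close> along the orbit; the contributions of the
  moving limits of integration cancel.\<close>

definition slope :: "real \<Rightarrow> real \<Rightarrow> real" where
  "slope a x = (- cos (c * (quarter a - time x a)) * Inn a x + cos (c * time x a) * Out a x) / sn c (quarter a)"

lemma sn_quarter_pos: "0 < a \<Longrightarrow> a \<le> R \<Longrightarrow> 0 < sn c (quarter a)"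
  using quarter_pos[of a] phase_less(1)[of c c a "quarter a"] c_pos c_gap by (intro sn_pos) auto

context
  fixes a assumes a: "0 < a" "a \<le> R"
begin

lemma integrand_cont:
  "continuous_on {0..r} (\<lambda>y. sn c (time y a) * F y)"
  "continuous_on {0..r} (\<lambda>y. sn c (quarter a - time y a) * F y)"
  by (intro continuous_intros sn_time_cont[OF a] continuous_on_subset[OF F_cont] subset_UNIV)+

lemma parts_cont: "continuous_on {0..a} (Inn a)" "continuous_on {0..a} (Out a)"
  unfolding inner_part_def[abs_def] outer_part_def[abs_def]
  by (intro indefinite_integral_continuous_1 indefinite_integral_continuous_1' integrable_continuous_interval integrand_cont)+

lemma parts_deriv:
  assumes x: "0 < x" "x < a"
  shows "(Inn a has_real_derivative sn c (time x a) * F x) (at x)"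
    "(Out a has_real_derivative - (sn c (quarter a - time x a) * F x)) (at x)"
  unfolding inner_part_def[abs_def] outer_part_def[abs_def]
  using integral_has_real_derivative[OF integrand_cont(1), of x a]
    integral_has_real_derivative'[OF integrand_cont(2), of x a] x
  by (simp_all add: at_within_Icc_at)

lemma quarter_time_deriv:
  assumes x: "0 < x" "x < a"
  shows "((\<lambda>x. quarter a - time x a) has_real_derivative - (1 / speed x a)) (at x)"
  using DERIV_diff[OF DERIV_const time_deriv[OF a x]] by simp

lemma wave_cont: "continuous_on {0..a} (wave c F a)"
  unfolding wave_def[abs_def]
  by (intro continuous_intros sn_time_cont[OF a] parts_cont) (use sn_quarter_pos[OF a] in auto)

lemma slope_cont: "continuous_on {0..a} (slope a)"
  unfolding slope_def[abs_def]
  by (intro continuous_intros time_cont[OF a] parts_cont) (use sn_quarter_pos[OF a] in auto)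

lemma wave_deriv:
  assumes x: "0 < x" "x < a"
  shows "(wave c F a has_real_derivative slope a x / speed x a) (at x)"
proof -
  note d = sn_deriv[OF c_ne quarter_time_deriv[OF x]] sn_deriv[OF c_ne time_deriv[OF a x]]
  show ?thesis
    unfolding wave_def[abs_def]
    by (rule DERIV_cong[OF DERIV_cdivide[OF DERIV_add[OF DERIV_mult[OF d(1) parts_deriv(1)[OF x]]
            DERIV_mult[OF d(2) parts_deriv(2)[OF x]]]]])
      (simp add: slope_def diff_divide_distrib add_divide_distrib algebra_simps)
qed

text \<open>Here the moving limits contribute - F, by the addition theorem for the sine (the
  Wronskian of the two sine solutions). Multiplied by the speed this is the orbit equation h'' = -
  c^2 h - v F in time.\<close>

lemma slope_deriv:
  assumes x: "0 < x" "x < a"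
  shows "(slope a has_real_derivative - c\<^sup>2 * wave c F a x / speed x a - F x) (at x)"
proof -
  let ?t = "time x a" and ?l = "quarter a - time x a" and ?S = "sn c (quarter a)" and ?v = "speed x a"
  have S: "?S \<noteq> 0" using sn_quarter_pos[OF a] by simp
  have d1: "((\<lambda>x. - cos (c * (quarter a - time x a))) has_real_derivative - (- sin (c * ?l) * (c * - (1 / ?v)))) (at x)"
    by (intro DERIV_minus DERIV_chain2[OF DERIV_cos] DERIV_cmult quarter_time_deriv x)
  have d2: "((\<lambda>x. cos (c * time x a)) has_real_derivative - sin (c * ?t) * (c * (1 / ?v))) (at x)"
    by (intro DERIV_chain2[OF DERIV_cos] DERIV_cmult time_deriv a x)
  have sum: "cos (c * ?l) * sn c ?t + cos (c * ?t) * sn c ?l = ?S"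
  proof -
    have "sin (c * quarter a) = sin (c * ?l + c * ?t)" by (simp add: algebra_simps)
    then show ?thesis using c_ne by (simp add: sn_eq sin_add add_divide_distrib mult.commute add.commute)
  qed
  have der: "(slope a has_real_derivative
     ((- (- sin (c * ?l) * (c * - (1 / ?v)))) * Inn a x + sn c ?t * F x * (- cos (c * ?l))
      + ((- sin (c * ?t) * (c * (1 / ?v))) * Out a x + - (sn c ?l * F x) * cos (c * ?t))) / ?S) (at x)"
    unfolding slope_def[abs_def]
    by (intro DERIV_cdivide DERIV_add DERIV_mult d1 d2 parts_deriv x)
  have eq: "(- (- sin (c * ?l) * (c * - (1 / ?v)))) * Inn a x + sn c ?t * F x * (- cos (c * ?l))
      + ((- sin (c * ?t) * (c * (1 / ?v))) * Out a x + - (sn c ?l * F x) * cos (c * ?t))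
      = - c\<^sup>2 * (sn c ?l * Inn a x + sn c ?t * Out a x) / ?v - (cos (c * ?l) * sn c ?t + cos (c * ?t) * sn c ?l) * F x"
    unfolding sn_eq[OF c_ne] using c_ne speed_pos[of x a] x
    by (simp add: field_simps power2_eq_square)
  show ?thesis
    by (rule DERIV_cong[OF der], unfold eq sum) (use S in \<open>simp add: wave_def diff_divide_distrib\<close>)
qed

lemma wave_ends: "wave c F a 0 = 0" "wave c F a a = 0"
  by (simp_all add: wave_def inner_part_def outer_part_def time_ge)

end

text \<open>The denominator is at least m quarter a while each numerator carries a factor quarter a,
  so the bound is uniform down to small orbits.\<close>

lemma mode_bounds: "\<exists>C\<ge>0. \<forall>a x. \<bar>cut (wave c F) a x\<bar> \<le> C \<and> \<bar>cut slope a x\<bar> \<le> C"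
proof -
  have cc: "0 \<le> c" "c \<in> {0..c}" using c_pos by auto
  obtain m where m: "0 < m" "\<And>a. 0 < a \<Longrightarrow> a \<le> R \<Longrightarrow> m * quarter a \<le> sn c (quarter a)"
    using sn_quarter_lower[OF cc(1) c_gap] cc(2) by blast
  have "bounded (F ` {0..R})"
    by (intro compact_imp_bounded compact_continuous_image continuous_on_subset[OF F_cont]) auto
  then obtain M where M0: "0 < M" and M: "\<And>x. x \<in> {0..R} \<Longrightarrow> \<bar>F x\<bar> \<le> M"
    unfolding bounded_pos by auto
  define B where "B = 2 * M * R / m"
  have B: "0 < B" using M0 m R_pos by (simp add: B_def)
  have main: "\<bar>wave c F a x\<bar> \<le> quarter R * B" "\<bar>slope a x\<bar> \<le> B" if a: "0 < a" "a \<le> R" and x: "0 \<le> x" "x \<le> a" for a x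
  proof -
    let ?L = "quarter a"
    have L: "0 < ?L" "?L \<le> quarter R" using quarter_pos[OF a] quarter_mono[OF a] by auto
    have sb: "\<bar>sn c t\<bar> \<le> ?L" if "0 \<le> t" "t \<le> ?L" for t
      using sn_le[of c t] sn_nonneg[of c t] phase_less(1)[OF cc(1) c_gap cc(1) order_refl a that] cc that by auto
    have tb: "0 \<le> time y a" "time y a \<le> ?L" for y using time_nonneg time_le_quarter[OF a] by auto
    have part: "\<bar>integral {r..s} (\<lambda>y. sn c (f y) * F y)\<bar> \<le> ?L * M * R"
      if rs: "0 \<le> r" "r \<le> s" "s \<le> R" and f: "\<And>y. 0 \<le> f y \<and> f y \<le> ?L"
        and cf: "continuous_on {r..s} (\<lambda>y. sn c (f y) * F y)" for r s f
    proof -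
      have "\<bar>integral {r..s} (\<lambda>y. sn c (f y) * F y)\<bar> \<le> integral {r..s} (\<lambda>y. ?L * M)"
        unfolding real_norm_def[symmetric]
      proof (rule integral_norm_bound_integral)
        show "(\<lambda>y. sn c (f y) * F y) integrable_on {r..s}" by (rule integrable_continuous_interval[OF cf])
        show "norm (sn c (f y) * F y) \<le> ?L * M" if "y \<in> {r..s}" for y
          using sb[of "f y"] f[of y] M[of y] that rs L by (auto simp: abs_mult intro!: mult_mono)
      qed (intro integrable_continuous_interval continuous_on_const)
      also have "\<dots> = ?L * M * (s - r)" using rs by simp
      also have "\<dots> \<le> ?L * M * R" using rs L M0 by (intro mult_left_mono) auto
      finally show ?thesis .
    qed
    have Ib: "\<bar>Inn a x\<bar> \<le> ?L * M * R"
      unfolding inner_part_def using x a tb by (intro part integrand_cont(1)[OF a]) auto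
    have Ob: "\<bar>Out a x\<bar> \<le> ?L * M * R"
      unfolding outer_part_def using x a tb
      by (intro part continuous_on_subset[OF integrand_cont(2)[OF a, of a]]) auto
    have S: "0 < sn c ?L" "m * ?L \<le> sn c ?L" using sn_quarter_pos[OF a] m(2)[OF a] by auto
    have "\<bar>slope a x\<bar> \<le> (?L * M * R + ?L * M * R) / (m * ?L)"
      unfolding slope_def abs_divide
    proof (rule frac_le)
      have c1: "\<bar>cos u * i\<bar> \<le> \<bar>i\<bar>" for u i :: real by (simp add: abs_mult mult_left_le_one_le)
      show "\<bar>- cos (c * (?L - time x a)) * Inn a x + cos (c * time x a) * Out a x\<bar> \<le> ?L * M * R + ?L * M * R"
        using c1[of "c * (?L - time x a)" "Inn a x"] c1[of "c * time x a" "Out a x"] Ib Ob by linarith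
    qed (use S L m(1) M0 R_pos in auto)
    also have "\<dots> = B" using L by (simp add: B_def)
    finally show "\<bar>slope a x\<bar> \<le> B" .
    have "\<bar>wave c F a x\<bar> \<le> (?L * (?L * M * R) + ?L * (?L * M * R)) / (m * ?L)"
      unfolding wave_def abs_divide
    proof (rule frac_le)
      have "\<bar>sn c (?L - time x a) * Inn a x\<bar> \<le> ?L * (?L * M * R)" "\<bar>sn c (time x a) * Out a x\<bar> \<le> ?L * (?L * M * R)"
        unfolding abs_mult using tb[of x] L by (intro mult_mono sb Ib Ob; simp)+
      then show "\<bar>sn c (?L - time x a) * Inn a x + sn c (time x a) * Out a x\<bar> \<le> ?L * (?L * M * R) + ?L * (?L * M * R)"
        by linarith
    qed (use S L m(1) M0 R_pos in auto)
    also have "\<dots> = ?L * B" using L by (simp add: B_def)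
    also have "\<dots> \<le> quarter R * B" using L B by simp
    finally show "\<bar>wave c F a x\<bar> \<le> quarter R * B" .
  qed
  define C where "C = max (quarter R * B) B"
  have "\<bar>cut (wave c F) a x\<bar> \<le> C \<and> \<bar>cut slope a x\<bar> \<le> C" for a x
  proof (cases "0 < a \<and> a \<le> R \<and> 0 \<le> x \<and> x \<le> a")
    case True
    then have "\<bar>wave c F a x\<bar> \<le> quarter R * B" "\<bar>slope a x\<bar> \<le> B" using main[of a x] by auto
    then show ?thesis using True by (simp add: cut_def C_def le_max_iff_disj)
  next
    case False
    then show ?thesis using B by (auto simp: cut_def C_def le_max_iff_disj)
  qed
  moreover have "0 \<le> C" using B by (simp add: C_def le_max_iff_disj)
  ultimately show ?thesis by blast
qed

text \<open>On the triangle the two parts equal Lebesgue integrals whose integrands depend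
  measurably on a and x; \<open>cut\<close> discards everything else.\<close>

lemma mode_meas:
  "case_prod (cut (wave c F)) \<in> borel_measurable (borel \<Otimes>\<^sub>M borel)"
  "case_prod (cut slope) \<in> borel_measurable (borel \<Otimes>\<^sub>M borel)"
proof -
  define I' where "I' a x = (LINT y|lborel. (if 0 \<le> y \<and> y \<le> x then sn c (time y a) * F y else 0))" for a x
  define O' where "O' a x = (LINT y|lborel. (if x \<le> y \<and> y \<le> a then sn c (quarter a - time y a) * F y else 0))" for a x
  have [measurable]: "case_prod I' \<in> borel_measurable (borel \<Otimes>\<^sub>M borel)"
    unfolding I'_def[abs_def] by measurable
  have [measurable]: "case_prod O' \<in> borel_measurable (borel \<Otimes>\<^sub>M borel)"
    unfolding O'_def[abs_def] by measurable
  have eqI: "I' a x = Inn a x" if a: "0 < a" "a \<le> R" and x: "0 \<le> x" "x \<le> a" for a x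
  proof -
    have "I' a x = (LINT y:{0..x}|lborel. sn c (time y a) * F y)"
      unfolding I'_def set_lebesgue_integral_def
      by (rule Bochner_Integration.integral_cong) (auto simp: indicator_def)
    also have "\<dots> = Inn a x"
      unfolding inner_part_def
      by (intro set_borel_integral_eq_integral(2) borel_integrable_atLeastAtMost' integrand_cont(1)[OF a])
    finally show ?thesis .
  qed
  have eqO: "O' a x = Out a x" if a: "0 < a" "a \<le> R" and x: "0 \<le> x" "x \<le> a" for a x
  proof -
    have cO: "continuous_on {x..a} (\<lambda>y. sn c (quarter a - time y a) * F y)"
      by (rule continuous_on_subset[OF integrand_cont(2)[OF a, of a]]) (use x in auto)
    have "O' a x = (LINT y:{x..a}|lborel. sn c (quarter a - time y a) * F y)"
      unfolding O'_def set_lebesgue_integral_def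
      by (rule Bochner_Integration.integral_cong) (auto simp: indicator_def)
    also have "\<dots> = Out a x"
      unfolding outer_part_def
      by (intro set_borel_integral_eq_integral(2) borel_integrable_atLeastAtMost' cO)
    finally show ?thesis .
  qed
  let ?w = "\<lambda>a x. (sn c (quarter a - time x a) * I' a x + sn c (time x a) * O' a x) / sn c (quarter a)"
  let ?s = "\<lambda>a x. (- cos (c * (quarter a - time x a)) * I' a x + cos (c * time x a) * O' a x) / sn c (quarter a)"
  have "cut (wave c F) = cut ?w"
    by (intro ext) (simp add: cut_def wave_def eqI eqO)
  moreover have "case_prod (cut ?w) \<in> borel_measurable (borel \<Otimes>\<^sub>M borel)" by (rule cut_meas) measurable
  ultimately show "case_prod (cut (wave c F)) \<in> borel_measurable (borel \<Otimes>\<^sub>M borel)" by simp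
  have "cut slope = cut ?s"
    by (intro ext) (simp add: cut_def slope_def eqI eqO)
  moreover have "case_prod (cut ?s) \<in> borel_measurable (borel \<Otimes>\<^sub>M borel)" by (rule cut_meas) measurable
  ultimately show "case_prod (cut slope) \<in> borel_measurable (borel \<Otimes>\<^sub>M borel)" by simp
qed

text \<open>Odd continuation of the quarter-orbit solution; its zeros at both ends let the four arcs
  fit together.\<close>

definition hmode :: "ph \<Rightarrow> real" where
  "hmode z = sgn (fst z) * sgn (fst (snd z)) * lift (wave c F) z"

definition kmode :: "ph \<Rightarrow> real" where "kmode z = lift slope z"

definition Fodd :: "real \<Rightarrow> real" where "Fodd x = sgn x * F \<bar>x\<bar>"

text \<open>The second transport derivative of \<open>hmode\<close> as prescribed by the orbit
  equation.\<close>

definition mmode :: "ph \<Rightarrow> real" where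
  "mmode z = - c\<^sup>2 * hmode z - fst (snd z) * Fodd (fst z)"

lemma sgn_meas[measurable]: "(sgn :: real \<Rightarrow> real) \<in> borel_measurable borel"
  unfolding sgn_real_def[abs_def] by measurable

lemma Fodd_meas[measurable]: "Fodd \<in> borel_measurable borel"
  unfolding Fodd_def[abs_def] by measurable

lemma mode_functions_meas[measurable]:
  "hmode \<in> borel_measurable borel" "kmode \<in> borel_measurable borel" "mmode \<in> borel_measurable borel"
proof -
  note [measurable] = lift_meas[OF mode_meas(1)] lift_meas[OF mode_meas(2)]
  show h[measurable]: "hmode \<in> borel_measurable borel" unfolding hmode_def[abs_def] by measurable
  show "kmode \<in> borel_measurable borel" unfolding kmode_def[abs_def] by measurable
  show "mmode \<in> borel_measurable borel" unfolding mmode_def[abs_def] by measurable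
qed

lemma Omega_bounds:
  assumes "z \<in> \<Omega>" shows "\<bar>fst z\<bar> < R" "\<bar>fst (snd z)\<bar> \<le> vmax"
proof -
  obtain x v vb where z: "z = (x, v, vb)" by (metis prod.exhaust)
  have E: "energy U (x, v, vb) < U R" using assms by (simp add: Omega_iff z)
  from radius_exists[OF E] show "\<bar>fst z\<bar> < R" by (auto simp: z)
  have "U 0 \<le> U \<bar>x\<bar>" using U_le_iff[of 0 "\<bar>x\<bar>"] by simp
  then have "U 0 \<le> U x" using U_even by (simp add: abs_if split: if_splits)
  then have "v\<^sup>2 \<le> 2 * (U R - U 0)" using E by (simp add: energy_def)
  then have "sqrt (v\<^sup>2) \<le> vmax" unfolding vmax_def speed_def by (rule real_sqrt_le_mono)
  then show "\<bar>fst (snd z)\<bar> \<le> vmax" by (simp add: z)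
qed

lemma mode_functions_bounded:
  "\<exists>C. (\<forall>z\<in>\<Omega>. \<bar>hmode z\<bar> \<le> C) \<and> (\<forall>z\<in>\<Omega>. \<bar>kmode z\<bar> \<le> C) \<and> (\<forall>z\<in>\<Omega>. \<bar>mmode z\<bar> \<le> C)"
proof -
  obtain C where C: "0 \<le> C" "\<And>a x. \<bar>cut (wave c F) a x\<bar> \<le> C" "\<And>a x. \<bar>cut slope a x\<bar> \<le> C"
    using mode_bounds by blast
  have "bounded (F ` {0..R})"
    by (intro compact_imp_bounded compact_continuous_image continuous_on_subset[OF F_cont]) auto
  then obtain M where M0: "0 < M" and M: "\<And>x. x \<in> {0..R} \<Longrightarrow> \<bar>F x\<bar> \<le> M"
    unfolding bounded_pos by auto
  have s: "\<bar>sgn y * u\<bar> \<le> \<bar>u\<bar>" for y u :: real by (simp add: abs_mult sgn_real_def)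
  have h: "\<bar>hmode z\<bar> \<le> C" for z
    unfolding hmode_def lift_def mult.assoc by (rule order_trans[OF s order_trans[OF s C(2)]])
  have k: "\<bar>kmode z\<bar> \<le> C" for z using C(3) by (simp add: kmode_def lift_def)
  have m: "\<bar>mmode z\<bar> \<le> c\<^sup>2 * C + vmax * M" if z: "z \<in> \<Omega>" for z
  proof -
    have "\<bar>F \<bar>fst z\<bar>\<bar> \<le> M" using M[of "\<bar>fst z\<bar>"] Omega_bounds(1)[OF z] by simp
    then have "\<bar>Fodd (fst z)\<bar> \<le> M" unfolding Fodd_def by (rule order_trans[OF s])
    then have "\<bar>fst (snd z) * Fodd (fst z)\<bar> \<le> vmax * M"
      unfolding abs_mult using Omega_bounds(2)[OF z] vmax_pos by (intro mult_mono) auto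
    moreover have "\<bar>- c\<^sup>2 * hmode z\<bar> \<le> c\<^sup>2 * C" using h[of z] by (simp add: abs_mult mult_left_mono)
    ultimately show ?thesis unfolding mmode_def by linarith
  qed
  define D where "D = max C (c\<^sup>2 * C + vmax * M)"
  have "C \<le> D" "c\<^sup>2 * C + vmax * M \<le> D" by (simp_all add: D_def)
  then show ?thesis
    by (intro exI[of _ D] conjI ballI) (rule order_trans[OF h] order_trans[OF k] order_trans[OF m]; assumption)+
qed

lemma C1c_curve:
  assumes \<xi>: "C1c \<Omega> \<xi>" and a: "0 < a"
  shows "\<sigma> = 1 \<or> \<sigma> = -1 \<Longrightarrow> \<tau> = 1 \<or> \<tau> = -1 \<Longrightarrow> 0 < x \<Longrightarrow> x < a \<Longrightarrow>
      ((\<lambda>x. \<xi> (\<sigma> * x, \<tau> * speed x a, vb)) has_real_derivative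
        \<sigma> * \<tau> * Dtrans U \<xi> (\<sigma> * x, \<tau> * speed x a, vb) / speed x a) (at x)"
    "continuous_on {0..a} (\<lambda>x. \<xi> (\<sigma> * x, \<tau> * speed x a, vb))"
proof -
  obtain D' where D': "\<And>z. (\<xi> has_derivative blinfun_apply (D' z)) (at z)"
    using \<xi> by (auto simp: C1c_def)
  show "((\<lambda>x. \<xi> (\<sigma> * x, \<tau> * speed x a, vb)) has_real_derivative
        \<sigma> * \<tau> * Dtrans U \<xi> (\<sigma> * x, \<tau> * speed x a, vb) / speed x a) (at x)"
    if "\<sigma> = 1 \<or> \<sigma> = -1" "\<tau> = 1 \<or> \<tau> = -1" "0 < x" "x < a"
    by (rule curve_deriv[OF D' that(3,4,1,2)])
  have "continuous_on UNIV \<xi>"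
    by (intro continuous_at_imp_continuous_on ballI has_derivative_continuous[OF D'])
  then show "continuous_on {0..a} (\<lambda>x. \<xi> (\<sigma> * x, \<tau> * speed x a, vb))"
    by (rule continuous_on_compose2) (auto intro!: continuous_intros speed_cont)
qed

lemma mode_values:
  assumes x: "0 < x" "x < a" "a < R" and s: "\<sigma> = 1 \<or> \<sigma> = -1" "\<tau> = 1 \<or> \<tau> = -1"
  shows "hmode (\<sigma> * x, \<tau> * speed x a, vb) = \<sigma> * \<tau> * wave c F a x"
    "kmode (\<sigma> * x, \<tau> * speed x a, vb) = slope a x"
    "mmode (\<sigma> * x, \<tau> * speed x a, vb) = \<sigma> * \<tau> * (- c\<^sup>2 * wave c F a x - speed x a * F x)"
proof -
  have v: "0 < speed x a" using speed_pos x by simp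
  have sg: "sgn (\<sigma> * x) = \<sigma>" "sgn (\<tau> * speed x a) = \<tau>" "\<bar>\<sigma> * x\<bar> = x"
    using s x(1) v by (auto simp: sgn_mult abs_mult)
  show h: "hmode (\<sigma> * x, \<tau> * speed x a, vb) = \<sigma> * \<tau> * wave c F a x"
    unfolding hmode_def fst_conv snd_conv sg lift_orbit[OF x s] ..
  show "kmode (\<sigma> * x, \<tau> * speed x a, vb) = slope a x"
    unfolding kmode_def lift_orbit[OF x s] ..
  show "mmode (\<sigma> * x, \<tau> * speed x a, vb) = \<sigma> * \<tau> * (- c\<^sup>2 * wave c F a x - speed x a * F x)"
    unfolding mmode_def h Fodd_def fst_conv snd_conv sg by (simp add: algebra_simps)
qed

text \<open>The product h \<xi> is a primitive on each arc. Both h and dx/dt carry the sign \<sigma>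
  \<tau>, so the four values of \<xi> enter with equal signs, and the boundary terms vanish with
  \<open>wave\<close>.\<close>

lemma weakD_first: "weakD \<alpha> \<beta> U (\<lambda>z. dens z * hmode z) (\<lambda>z. dens z * kmode z)"
proof -
  obtain C where C: "\<forall>z\<in>\<Omega>. \<bar>hmode z\<bar> \<le> C" "\<forall>z\<in>\<Omega>. \<bar>kmode z\<bar> \<le> C"
    using mode_functions_bounded by blast
  show ?thesis
  proof (rule weakD_dens[where C = C])
    fix \<xi> vb a assume \<xi>: "C1c \<Omega> \<xi>" and a: "0 < a" "a < R"
    have aR: "a \<le> R" using a by simp
    let ?X = "\<lambda>\<sigma> \<tau> x. \<xi> (\<sigma> * x, \<tau> * speed x a, vb)"
    let ?D = "\<lambda>\<sigma> \<tau> x. Dtrans U \<xi> (\<sigma> * x, \<tau> * speed x a, vb)"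
    let ?f = "\<lambda>z. hmode z * Dtrans U \<xi> z + kmode z * \<xi> z"
    show "(LINT x:{0<..<a}|lborel. jac a x * orbit_sum ?f vb a x) = 0"
    proof (rule FTC_loop[where F = "\<lambda>x. U' a * (wave c F a x * (?X 1 1 x + ?X (-1) 1 x + (?X 1 (-1) x + ?X (-1) (-1) x)))"])
      show "continuous_on {0..a} (\<lambda>x. U' a * (wave c F a x * (?X 1 1 x + ?X (-1) 1 x + (?X 1 (-1) x + ?X (-1) (-1) x))))"
        by (intro continuous_on_mult continuous_on_add continuous_on_const wave_cont[OF a(1) aR] C1c_curve(2)[OF \<xi> a(1)])
      fix x assume x: "0 < x" "x < a"
      have v: "0 < speed x a" using speed_pos x by simp
      note d = C1c_curve(1)[OF \<xi> a(1) _ _ x]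
      have der: "((\<lambda>x. U' a * (wave c F a x * (?X 1 1 x + ?X (-1) 1 x + (?X 1 (-1) x + ?X (-1) (-1) x)))) has_real_derivative
          U' a * (slope a x / speed x a * (?X 1 1 x + ?X (-1) 1 x + (?X 1 (-1) x + ?X (-1) (-1) x)) +
            (1 * 1 * ?D 1 1 x / speed x a + (-1) * 1 * ?D (-1) 1 x / speed x a
             + (1 * (-1) * ?D 1 (-1) x / speed x a + (-1) * (-1) * ?D (-1) (-1) x / speed x a)) * wave c F a x)) (at x)"
        by (intro DERIV_cmult DERIV_mult DERIV_add wave_deriv a aR x d) simp_all
      have orb: "orbit_sum ?f vb a x =
          (wave c F a x * ?D 1 1 x + slope a x * ?X 1 1 x) + (- wave c F a x * ?D (-1) 1 x + slope a x * ?X (-1) 1 x)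
        + ((- wave c F a x * ?D 1 (-1) x + slope a x * ?X 1 (-1) x) + (wave c F a x * ?D (-1) (-1) x + slope a x * ?X (-1) (-1) x))"
        using mode_values(1,2)[OF x a(2), of 1 1 vb] mode_values(1,2)[OF x a(2), of "-1" 1 vb]
          mode_values(1,2)[OF x a(2), of 1 "-1" vb] mode_values(1,2)[OF x a(2), of "-1" "-1" vb]
        by (simp add: orbit_sum_def)
      have jc: "jac a x = U' a / speed x a" using x a by (simp add: jac_def)
      show "((\<lambda>x. U' a * (wave c F a x * (?X 1 1 x + ?X (-1) 1 x + (?X 1 (-1) x + ?X (-1) (-1) x)))) has_real_derivative
          jac a x * orbit_sum ?f vb a x) (at x)"
        by (rule DERIV_cong[OF der], unfold orb jc) (use v in \<open>simp add: field_simps\<close>)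
    qed (use a wave_ends[OF a(1) aR] in simp_all)
  qed (use C in auto)
qed

text \<open>The slope need not vanish at the ends, but now \<xi> enters with signs \<sigma> \<tau>.
  At x = 0 the arcs with opposite \<sigma> meet, at x = a those with opposite \<tau>, so the
  boundary terms cancel in pairs.\<close>

lemma weakD_second: "weakD \<alpha> \<beta> U (\<lambda>z. dens z * kmode z) (\<lambda>z. dens z * mmode z)"
proof -
  obtain C where C: "\<forall>z\<in>\<Omega>. \<bar>kmode z\<bar> \<le> C" "\<forall>z\<in>\<Omega>. \<bar>mmode z\<bar> \<le> C"
    using mode_functions_bounded by blast
  show ?thesis
  proof (rule weakD_dens[where C = C])
    fix \<xi> vb a assume \<xi>: "C1c \<Omega> \<xi>" and a: "0 < a" "a < R"
    have aR: "a \<le> R" using a by simp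
    let ?X = "\<lambda>\<sigma> \<tau> x. \<xi> (\<sigma> * x, \<tau> * speed x a, vb)"
    let ?D = "\<lambda>\<sigma> \<tau> x. Dtrans U \<xi> (\<sigma> * x, \<tau> * speed x a, vb)"
    let ?f = "\<lambda>z. kmode z * Dtrans U \<xi> z + mmode z * \<xi> z"
    show "(LINT x:{0<..<a}|lborel. jac a x * orbit_sum ?f vb a x) = 0"
    proof (rule FTC_loop[where F = "\<lambda>x. U' a * (slope a x * (?X 1 1 x - ?X (-1) 1 x - (?X 1 (-1) x - ?X (-1) (-1) x)))"])
      show "continuous_on {0..a} (\<lambda>x. U' a * (slope a x * (?X 1 1 x - ?X (-1) 1 x - (?X 1 (-1) x - ?X (-1) (-1) x))))"
        by (intro continuous_on_mult continuous_on_diff continuous_on_const slope_cont[OF a(1) aR] C1c_curve(2)[OF \<xi> a(1)])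
      fix x assume x: "0 < x" "x < a"
      have v: "0 < speed x a" using speed_pos x by simp
      note d = C1c_curve(1)[OF \<xi> a(1) _ _ x]
      let ?m = "- c\<^sup>2 * wave c F a x - speed x a * F x"
      have der: "((\<lambda>x. U' a * (slope a x * (?X 1 1 x - ?X (-1) 1 x - (?X 1 (-1) x - ?X (-1) (-1) x)))) has_real_derivative
          U' a * ((- c\<^sup>2 * wave c F a x / speed x a - F x) * (?X 1 1 x - ?X (-1) 1 x - (?X 1 (-1) x - ?X (-1) (-1) x)) +
            (1 * 1 * ?D 1 1 x / speed x a - (-1) * 1 * ?D (-1) 1 x / speed x a
             - (1 * (-1) * ?D 1 (-1) x / speed x a - (-1) * (-1) * ?D (-1) (-1) x / speed x a)) * slope a x)) (at x)"
        by (intro DERIV_cmult DERIV_mult DERIV_diff slope_deriv a aR x d) simp_all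
      have orb: "orbit_sum ?f vb a x =
          (slope a x * ?D 1 1 x + ?m * ?X 1 1 x) + (slope a x * ?D (-1) 1 x + - ?m * ?X (-1) 1 x)
        + ((slope a x * ?D 1 (-1) x + - ?m * ?X 1 (-1) x) + (slope a x * ?D (-1) (-1) x + ?m * ?X (-1) (-1) x))"
        using mode_values(2,3)[OF x a(2), of 1 1 vb] mode_values(2,3)[OF x a(2), of "-1" 1 vb]
          mode_values(2,3)[OF x a(2), of 1 "-1" vb] mode_values(2,3)[OF x a(2), of "-1" "-1" vb]
        by (simp add: orbit_sum_def)
      have jc: "jac a x = U' a / speed x a" using x a by (simp add: jac_def)
      show "((\<lambda>x. U' a * (slope a x * (?X 1 1 x - ?X (-1) 1 x - (?X 1 (-1) x - ?X (-1) (-1) x)))) has_real_derivative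
          jac a x * orbit_sum ?f vb a x) (at x)"
        by (rule DERIV_cong[OF der], unfold orb jc) (use v in \<open>simp add: field_simps\<close>)
    qed (use a in simp_all)
  qed (use C in auto)
qed

text \<open>Integrating out the remaining velocities leaves 1, and v1 times the mode is even in v1.
  Under v1 = speed x a the factor v1 cancels the speed in the Jacobian, which leaves the integral of
  w a wave c F a x, known from the fixed-point equation.\<close>

lemma Jbar_mode:
  assumes x: "\<bar>x\<bar> < R"
  shows "4 * pi * Jbar \<alpha> \<beta> U (\<lambda>z. dens z * hmode z) x = Fodd x"
proof -
  let ?x = "\<bar>x\<bar>"
  have x0: "0 \<le> ?x" "?x < R" using x by auto
  have Ux: "U ?x = U x" using U_even by (simp add: abs_if)
  let ?E = "\<lambda>v. v\<^sup>2 / 2 + U ?x"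
  let ?f = "\<lambda>v. v * (A (?E v) * cut (wave c F) (radius (?E v)) ?x)"
  note [measurable] = mode_meas(1)
  have fm[measurable]: "?f \<in> borel_measurable borel" by measurable
  have vals: "indicator {?x<..<R} a * (U' a / speed ?x a) * ?f (speed ?x a) = indicator {?x<..<R} a * (w a * wave c F a ?x)" for a
  proof (cases "?x < a \<and> a < R")
    case True
    have "?E (speed ?x a) = U a"
      using speed_sq[of ?x a] True by (simp only: abs_ge_zero less_imp_le) (simp add: field_simps)
    then show ?thesis
      using True radius_U[of a] speed_pos[of ?x a] x0 by (simp add: cut_def w_def)
  qed auto
  have cc: "0 \<le> c" "c \<in> {0..c}" using c_pos by auto
  have "integrable lborel (\<lambda>a. indicator {?x<..<R} a * (w a * wave c F a ?x))"
    using x0 by (intro kop_kernel(1)[OF cc(1) c_gap cc(2) continuous_on_subset[OF F_cont]]) auto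
  then have "integrable lborel (\<lambda>a. indicator {?x<..<R} a * (U' a / speed ?x a) * ?f (speed ?x a))"
    by (simp only: vals)
  note sub = speed_substitution_real[OF fm x0 this]
  have val: "(LINT v|lborel. indicator {0<..<speed ?x R} v * ?f v) = F ?x / (8 * pi)"
    unfolding sub(2) vals using F_eq[of ?x] x0 by (simp add: set_lebesgue_integral_def)
  \<comment> \<open>The integrand in v1 without the factors sgn x and \<beta>; the sign of v1
    contained in the mode turns v1 into |v1|.\<close>
  define \<phi> where "\<phi> v = (if ?E v < U R then \<bar>v\<bar> * (A (?E v) * cut (wave c F) (radius (?E v)) ?x) else 0)" for v
  have phi_pos: "\<phi> v = indicator {0<..<speed ?x R} v * ?f v" if v: "0 < v" for v
  proof (cases "?x = 0")
    case False
    then show ?thesis using speed_less_iff[of ?x v] x0 v by (simp add: \<phi>_def indicator_def)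
  next
    case True
    \<comment> \<open>\<open>speed_less_iff\<close> covers only positive positions; at x = 0 both
      sides are 0 because the wave vanishes there.\<close>
    have "cut (wave c F) a 0 = 0" for a by (simp add: cut_def wave_ends)
    then show ?thesis by (simp only: \<phi>_def True) simp
  qed
  have phi_even: "\<phi> (- v) = \<phi> v" for v by (simp add: \<phi>_def)
  have phi_split: "\<phi> v = indicator {0<..<speed ?x R} v * ?f v + indicator {0<..<speed ?x R} (- v) * ?f (- v)" for v
  proof (cases v "0 :: real" rule: linorder_cases)
    case less then show ?thesis using phi_pos[of "- v"] phi_even[of v] by simp
  next
    case equal then show ?thesis by (simp add: \<phi>_def)
  next
    case greater then show ?thesis using phi_pos[of v] by simp
  qed
  have phi_int: "integrable lborel \<phi>"
  proof -
    have "integrable lborel (\<lambda>v. indicator {0<..<speed ?x R} (- v) * ?f (- v))"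
      using lborel_integrable_real_affine_iff[of "-1" "\<lambda>v. indicator {0<..<speed ?x R} v * ?f v" 0] sub(1) by simp
    from Bochner_Integration.integrable_add[OF sub(1) this]
    show ?thesis by (simp only: phi_split[symmetric])
  qed
  have "(LINT v|lborel. \<phi> v) = 2 * (LINT v:{0<..}|lborel. \<phi> v)"
    by (rule lebesgue_integral_even[OF phi_int phi_even])
  also have "(LINT v:{0<..}|lborel. \<phi> v) = (LINT v|lborel. indicator {0<..<speed ?x R} v * ?f v)"
    unfolding set_lebesgue_integral_def
  proof (rule Bochner_Integration.integral_cong[OF refl])
    fix v :: real
    show "indicator {0<..} v *\<^sub>R \<phi> v = indicator {0<..<speed ?x R} v * ?f v"
      using phi_pos[of v] by (cases "0 < v") auto
  qed
  finally have phi_val: "(LINT v|lborel. \<phi> v) = F ?x / (4 * pi)" unfolding val by simp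
  have pt: "indicator \<Omega> (x, v) * fst v * (dens (x, v) * hmode (x, v)) = sgn x * \<phi> (fst v) * \<beta> (snd v)"
    for v :: "real \<times> (real \<times> real)"
  proof -
    obtain v1 vb where v: "v = (v1, vb)" by (cases v)
    have e: "energy U (x, v1, vb) = ?E v1" by (simp add: energy_def Ux)
    have m: "((x, v1, vb) \<in> \<Omega>) \<longleftrightarrow> ?E v1 < U R \<and> 0 < \<beta> vb" by (simp add: Omega_iff e)
    show ?thesis
    proof (cases "?E v1 < U R \<and> 0 < \<beta> vb")
      case True
      have "(x, v) \<in> \<Omega>" using True m by (simp only: v)
      moreover have "fst v * (dens (x, v) * hmode (x, v)) =
          sgn x * (v1 * sgn v1 * (A (?E v1) * cut (wave c F) (radius (?E v1)) ?x)) * \<beta> vb"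
        by (simp only: v hmode_def dens_def lift_def e fst_conv snd_conv ac_simps)
      moreover have "v1 * sgn v1 = \<bar>v1\<bar>" by (simp add: sgn_real_def)
      ultimately show ?thesis using True by (simp add: v \<phi>_def)
    next
      case False
      then have "\<phi> v1 * \<beta> vb = 0" using beta_nonneg[of vb] by (auto simp: \<phi>_def)
      then show ?thesis using False m unfolding v by simp
    qed
  qed
  have "Jbar \<alpha> \<beta> U (\<lambda>z. dens z * hmode z) x = (LINT v|lborel. sgn x * \<phi> (fst v) * \<beta> (snd v))"
    unfolding Jbar_def pt ..
  also have "\<dots> = (LINT v|(lborel \<Otimes>\<^sub>M lborel). (sgn x * \<phi> (fst v)) * \<beta> (snd v))"
    by (simp only: lborel_prod)
  also have "\<dots> = (LINT v|lborel. sgn x * \<phi> v) * (LINT u|lborel. \<beta> u)"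
    using phi_int by (intro lborel_pair.integral_times beta_int) simp
  also have "\<dots> = sgn x * (F ?x / (4 * pi))" by (simp add: phi_val beta_one)
  finally show ?thesis by (simp add: Fodd_def)
qed

lemma mode_odd: "(\<lambda>z. dens z * hmode z) \<in> Hbar_odd \<alpha> \<beta> U"
proof -
  obtain C where C: "\<And>z. z \<in> \<Omega> \<Longrightarrow> \<bar>hmode z\<bar> \<le> C" using mode_functions_bounded by blast
  have e: "energy U (- x, v, vb) = energy U (x, v, vb)" "energy U (x, - v, vb) = energy U (x, v, vb)" for x v vb
    by (simp_all add: energy_def U_even)
  have o: "dens (x, v, vb) * hmode (x, v, vb) = - (dens (- x, v, vb) * hmode (- x, v, vb))"
    "dens (x, v, vb) * hmode (x, v, vb) = - (dens (x, - v, vb) * hmode (x, - v, vb))" for x v vb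
    by (simp_all add: dens_def hmode_def lift_def e sgn_minus)
  show ?thesis
    unfolding Hbar_odd_def mem_Collect_eq
  proof (intro conjI dens_mult_Hbar[OF mode_functions_meas(1) C] AE_I2 impI)
    fix z :: ph
    obtain x v vb where z: "z = (x, v, vb)" by (metis prod.exhaust)
    show "case z of (x, v, vb) \<Rightarrow> dens (x, v, vb) * hmode (x, v, vb) = - (dens (- x, v, vb) * hmode (- x, v, vb)) \<and>
        dens (x, v, vb) * hmode (x, v, vb) = - (dens (x, - v, vb) * hmode (x, - v, vb))"
      unfolding z prod.case by (rule conjI[OF o])
  qed
qed

text \<open>Otherwise Fubini gives J(g) = 0 for almost every x, hence F = 0 almost everywhere on (0,
  R) by \<open>Jbar_mode\<close>. The set where F differs from 0 is open, so it is empty, and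
  continuity reaches the endpoints.\<close>

lemma mode_nonzero:
  assumes nz: "x0 \<in> {0..R}" "F x0 \<noteq> 0"
  shows "\<not> (AE z in lborel. z \<in> \<Omega> \<longrightarrow> dens z * hmode z = 0)"
proof
  assume "AE z in lborel. z \<in> \<Omega> \<longrightarrow> dens z * hmode z = 0"
  then have "AE z in (lborel :: real measure) \<Otimes>\<^sub>M (lborel :: (real \<times> real \<times> real) measure). z \<in> \<Omega> \<longrightarrow> dens z * hmode z = 0"
    by (simp only: lborel_prod)
  from lborel_pair.AE_pair[OF this]
  have "AE x in lborel. \<not> (0 < x \<and> x < R \<and> F x \<noteq> 0)"
  proof eventually_elim
    case (elim x)
    then have "AE v in lborel. indicator \<Omega> (x, v) * fst v * (dens (x, v) * hmode (x, v)) = 0"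
      by eventually_elim (auto simp: indicator_def)
    then have "Jbar \<alpha> \<beta> U (\<lambda>z. dens z * hmode z) x = 0"
      unfolding Jbar_def by (rule integral_eq_zero_AE)
    then show ?case using Jbar_mode[of x] by (auto simp: Fodd_def)
  qed
  moreover define N where "N = {0<..<R} \<inter> F -` (- {0})"
  ultimately have "AE x in lborel. x \<notin> N" by (auto elim: eventually_mono)
  moreover have "open N"
    unfolding N_def by (intro open_Int open_greaterThanLessThan open_vimage F_cont open_Compl closed_singleton)
  ultimately have "N = {}"
  proof (intro equals0I)
    fix p assume N: "AE x in lborel. x \<notin> N" "open N" and p: "p \<in> N"
    then obtain e where e: "0 < e" "ball p e \<subseteq> N" using open_contains_ball by blast
    have "AE x in lborel. x \<notin> {p - e<..<p + e}"
      using N(1) by eventually_elim (use e(2) in \<open>auto simp: ball_eq_greaterThanLessThan\<close>)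
    then have "emeasure lborel {x. \<not> x \<notin> {p - e<..<p + e}} = 0"
      by (subst (asm) AE_iff_measurable[OF _ refl]) auto
    also have "{x. \<not> x \<notin> {p - e<..<p + e}} = {p - e<..<p + e}" by auto
    finally show False using e by simp
  qed
  then have z: "F x = 0" if "x \<in> {0<..<R}" for x using that by (auto simp: N_def)
  have "F x0 = 0"
    using continuous_constant_on_closure[of "{0<..<R}" F 0 x0] z nz R_pos continuous_on_subset[OF F_cont] by auto
  then show False using nz by simp
qed

text \<open>The term v1 F in \<open>mmode\<close> is exactly B g divided by |\<phi>'|.\<close>

lemma mode_equation:
  assumes "z \<in> \<Omega>"
  shows "- (dens z * mmode z) - Bbar \<alpha> \<beta> U (\<lambda>z. dens z * hmode z) z = c\<^sup>2 * (dens z * hmode z)"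
proof -
  obtain x v vb where z: "z = (x, v, vb)" by (metis prod.exhaust)
  have "\<bar>x\<bar> < R" using Omega_bounds(1)[OF assms] by (simp add: z)
  from Jbar_mode[OF this]
  have "Bbar \<alpha> \<beta> U (\<lambda>z. dens z * hmode z) z = dens z * v * Fodd x"
    using phid_dens[OF assms] by (simp add: Bbar_def z)
  then show ?thesis by (simp add: mmode_def z algebra_simps)
qed

end

section \<open>The steady state\<close>

context planar_phase
begin

lemma eigenvalue_exists:
  "\<exists>c g \<mu>1 \<mu>2. 0 < c \<and> c * quarter R < pi \<and> g \<in> Hbar_odd \<alpha> \<beta> U \<and> \<mu>1 \<in> Hbar \<alpha> \<beta> U \<and> weakD \<alpha> \<beta> U g \<mu>1 \<and>
     \<mu>2 \<in> Hbar \<alpha> \<beta> U \<and> weakD \<alpha> \<beta> U \<mu>1 \<mu>2 \<and> \<not> (AE z in lborel. z \<in> \<Omega> \<longrightarrow> g z = 0) \<and>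
     (AE z in lborel. z \<in> \<Omega> \<longrightarrow> - \<mu>2 z - Bbar \<alpha> \<beta> U g z = c\<^sup>2 * g z)"
proof -
  obtain c F x0 where c: "0 < c" "c * quarter R < pi" and F: "continuous_on UNIV F"
    and x0: "x0 \<in> {0..R}" "F x0 \<noteq> 0"
    and F_eq: "\<And>x. x \<in> {0..R} \<Longrightarrow> F x = 8 * pi * (LINT a:{x<..<R}|lborel. w a * wave c F a x)"
    using reduced_eigenfunction_exists by blast
  interpret planar_mode U U' \<rho> R \<alpha> A A0 \<beta> c F by unfold_locales (fact c F F_eq)+
  obtain C where C: "\<And>z. z \<in> \<Omega> \<Longrightarrow> \<bar>kmode z\<bar> \<le> C" "\<And>z. z \<in> \<Omega> \<Longrightarrow> \<bar>mmode z\<bar> \<le> C"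
    using mode_functions_bounded by blast
  have "AE z in lborel. z \<in> \<Omega> \<longrightarrow>
      - (dens z * mmode z) - Bbar \<alpha> \<beta> U (\<lambda>z. dens z * hmode z) z = c\<^sup>2 * (dens z * hmode z)"
    by (intro AE_I2 impI mode_equation)
  note mode = c mode_odd dens_mult_Hbar[OF mode_functions_meas(2) C(1)] weakD_first
    dens_mult_Hbar[OF mode_functions_meas(3) C(2)] weakD_second mode_nonzero[OF x0] this
  show ?thesis
    by (rule exI[of _ c], rule exI[of _ "\<lambda>z. dens z * hmode z"], rule exI[of _ "\<lambda>z. dens z * kmode z"],
        rule exI[of _ "\<lambda>z. dens z * mmode z"]) (intro conjI mode)
qed

end

section \<open>The period at the boundary energy\<close>

context planar_potential
begin

text \<open>The definition of the period contributes a factor 2 and evenness of U another; strict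
  monotonicity identifies R and -R as the turning points.\<close>

lemma Tper_quarter: "Tper U (U R) = 4 * quarter R"
proof -
  have inj: "x = R" if "0 \<le> x" "U x = U R" for x
    using U_strict[of x R] U_strict[of R x] that R_pos by (cases x R rule: linorder_cases) auto
  have xp: "xplus U (U R) = R"
    unfolding xplus_def
  proof (rule the_equality)
    show "0 \<le> R \<and> U R = U R" using R_pos by simp
    fix x assume "0 \<le> x \<and> U x = U R"
    then show "x = R" by (intro inj) auto
  qed
  have xm: "xminus U (U R) = - R"
    unfolding xminus_def
  proof (rule the_equality)
    show "- R \<le> 0 \<and> U (- R) = U R" using R_pos by (simp add: U_even)
    fix x assume x: "x \<le> 0 \<and> U x = U R"
    then have "- x = R" by (intro inj) (auto simp: U_even)
    then show "x = - R" by simp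
  qed
  let ?f = "\<lambda>x. indicator {- R<..<R} x * (1 / speed x R)"
  have ae: "AE x in lborel. slow R x + slow R (- x) = ?f x"
  proof -
    have "AE x in lborel. x \<noteq> (0::real)" by (rule AE_lborel_singleton)
    then show ?thesis
    proof eventually_elim
      case (elim x)
      have e: "speed (- x) R = speed x R" by (simp add: speed_def U_even)
      show ?case
      proof (cases "0 < x")
        case True then show ?thesis by (simp add: slow_def indicator_def)
      next
        case False then show ?thesis using elim e by (simp add: slow_def indicator_def)
      qed
    qed
  qed
  have fm: "?f \<in> borel_measurable lborel" by measurable
  have si: "integrable lborel (slow R)" by (rule slow_integrable[OF R_pos order_refl])
  have "integrable lborel (\<lambda>x. slow R (- x))"
    using lborel_integrable_real_affine_iff[of "-1" "slow R" 0] si by simp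
  with si have "integrable lborel (\<lambda>x. slow R x + slow R (- x))" by (rule Bochner_Integration.integrable_add)
  then have fi: "integrable lborel ?f"
    by (rule integrable_cong_AE_imp[OF _ fm]) (rule ae)
  have "Tper U (U R) = 2 * (LINT x:{- R<..<R}|lborel. 1 / sqrt (2 * U R - 2 * U x))"
    unfolding Tper_def xp xm using R_pos by (simp add: interval_integral_Ioo)
  also have "(LINT x:{- R<..<R}|lborel. 1 / sqrt (2 * U R - 2 * U x)) = (LINT x|lborel. ?f x)"
    by (simp add: set_lebesgue_integral_def speed_def right_diff_distrib)
  also have "\<dots> = 2 * (LINT x:{0<..}|lborel. ?f x)"
    by (rule lebesgue_integral_even[OF fi]) (auto simp: speed_def U_even indicator_def)
  also have "(LINT x:{0<..}|lborel. ?f x) = quarter R"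
    unfolding set_lebesgue_integral_def quarter_def
    by (rule Bochner_Integration.integral_cong) (use R_pos in \<open>auto simp: slow_def indicator_def\<close>)
  finally show ?thesis by simp
qed

end

text \<open>The properties shared by both families. The derivative - A may blow up at E0; near that
  energy the proof relies on a positive lower bound for A.\<close>

definition profile :: "(real \<Rightarrow> real) \<Rightarrow> real \<Rightarrow> (real \<Rightarrow> real) \<Rightarrow> bool" where
  "profile \<alpha> E0 A \<longleftrightarrow> continuous_on UNIV \<alpha> \<and>
     (\<forall>E<E0. (\<alpha> has_real_derivative - A E) (at E) \<and> 0 < \<alpha> E) \<and> (\<forall>E\<ge>E0. \<alpha> E = 0) \<and>
     (\<forall>E E'. E \<le> E' \<longrightarrow> \<alpha> E' \<le> \<alpha> E) \<and> A \<in> borel_measurable borel \<and>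
     (\<forall>m<E0. \<exists>A0>0. \<forall>E. m \<le> E \<longrightarrow> E < E0 \<longrightarrow> A0 \<le> A E)"

text \<open>For k \<le> 1 the exponent k - 1 is nonpositive, so A is smallest at the left end m of
  the energy interval.\<close>

lemma profile_polytrope:
  assumes k: "0 < k" "k \<le> (1::real)"
  shows "profile (\<lambda>E. if E < E0 then (E0 - E) powr k else 0) E0 (\<lambda>E. k * (E0 - E) powr (k - 1))"
proof -
  let ?a = "\<lambda>E. if E < E0 then (E0 - E) powr k else 0"
  have a_eq: "?a = (\<lambda>E. max 0 (E0 - E) powr k)" by (auto simp: max_def)
  have "continuous_on UNIV (\<lambda>E. max 0 (E0 - E) powr k)"
    by (rule continuous_on_powr') (use k in \<open>auto intro!: continuous_intros\<close>)
  then have c: "continuous_on UNIV ?a" unfolding a_eq .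
  have d: "(?a has_real_derivative - (k * (E0 - E) powr (k - 1))) (at E)" if E: "E < E0" for E
  proof -
    have "((\<lambda>E. (E0 - E) powr k) has_real_derivative k * (E0 - E) powr (k - 1) * (0 - 1)) (at E)"
      by (intro DERIV_chain2[OF has_real_derivative_powr] DERIV_diff DERIV_const DERIV_ident) (use E in simp)
    then have "((\<lambda>E. (E0 - E) powr k) has_real_derivative - (k * (E0 - E) powr (k - 1))) (at E)" by simp
    then show ?thesis
      by (rule has_field_derivative_transform_within_open[of _ _ _ "{..<E0}"]) (use E in auto)
  qed
  have m: "?a E' \<le> ?a E" if "E \<le> E'" for E E'
    using that k by (auto intro!: powr_mono2)
  have low: "\<exists>A0>0. \<forall>E. m \<le> E \<longrightarrow> E < E0 \<longrightarrow> A0 \<le> k * (E0 - E) powr (k - 1)" if "m < E0" for m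
    using that k by (intro exI[of _ "k * (E0 - m) powr (k - 1)"]) (auto intro!: mult_left_mono powr_mono2')
  show ?thesis
    unfolding profile_def by (intro conjI allI impI c d m low) simp_all
qed

lemma profile_king: "profile (\<lambda>E. max (exp (E0 - E) - 1) 0) E0 (\<lambda>E. exp (E0 - E))"
proof -
  let ?a = "\<lambda>E. max (exp (E0 - E) - 1) 0 :: real"
  have c: "continuous_on UNIV ?a" by (intro continuous_intros)
  have d: "(?a has_real_derivative - exp (E0 - E)) (at E)" if E: "E < E0" for E
  proof -
    have "((\<lambda>E. exp (E0 - E) - 1) has_real_derivative exp (E0 - E) * (0 - 1) - 0) (at E)"
      by (intro DERIV_diff DERIV_chain2[OF DERIV_exp] DERIV_const DERIV_ident)
    then have "((\<lambda>E. exp (E0 - E) - 1) has_real_derivative - exp (E0 - E)) (at E)" by simp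
    then show ?thesis
      by (rule has_field_derivative_transform_within_open[of _ _ _ "{..<E0}"]) (use E in auto)
  qed
  have low: "\<exists>A0>0. \<forall>E. m \<le> E \<longrightarrow> E < E0 \<longrightarrow> A0 \<le> exp (E0 - E)" for m
    by (intro exI[of _ 1]) auto
  show ?thesis
    unfolding profile_def by (intro conjI allI impI c d low max.mono) simp_all
qed

lemma profile_integrable:
  assumes "profile \<alpha> E0 A" shows "integrable lborel (\<lambda>v. \<alpha> (v\<^sup>2 / 2 + u))"
proof -
  \<comment> \<open>For |v| > m \<ge> 1 one has v^2 \<ge> m \<ge> 2 (E0 - u), so the energy is at
    least E0.\<close>
  define m where "m = 1 + 2 * \<bar>E0 - u\<bar>"
  have ca: "continuous_on UNIV \<alpha>" using assms unfolding profile_def by blast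
  have c: "continuous_on S (\<lambda>v. \<alpha> (v\<^sup>2 / 2 + u))" for S
    by (rule continuous_on_compose2[OF ca]) (auto intro!: continuous_intros)
  have zero: "\<alpha> (v\<^sup>2 / 2 + u) = 0" if v: "m < \<bar>v\<bar>" for v
  proof -
    have m: "1 \<le> m" "2 * (E0 - u) \<le> m" using abs_ge_self[of "E0 - u"] unfolding m_def by auto
    have "1 * m \<le> \<bar>v\<bar> * \<bar>v\<bar>" by (rule mult_mono) (use v m(1) in auto)
    then have "m \<le> v\<^sup>2" by (simp add: power2_eq_square)
    then have "E0 \<le> v\<^sup>2 / 2 + u" using m(2) by simp
    then show ?thesis using assms by (simp add: profile_def)
  qed
  have "(\<lambda>v. \<alpha> (v\<^sup>2 / 2 + u)) = (\<lambda>v. indicator {- m..m} v *\<^sub>R \<alpha> (v\<^sup>2 / 2 + u))"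
  proof
    fix v
    show "\<alpha> (v\<^sup>2 / 2 + u) = indicator {- m..m} v *\<^sub>R \<alpha> (v\<^sup>2 / 2 + u)"
    proof (cases "m < \<bar>v\<bar>")
      case True
      show ?thesis unfolding zero[OF True] by simp
    next
      case False
      then have "v \<in> {- m..m}" by auto
      then show ?thesis by simp
    qed
  qed
  moreover have "integrable lborel (\<lambda>v. indicator {- m..m} v *\<^sub>R \<alpha> (v\<^sup>2 / 2 + u))"
    using borel_integrable_atLeastAtMost'[OF c] by (simp add: set_integrable_def)
  ultimately show ?thesis by simp
qed

text \<open>Averaging over x and -x uses |x - y| + |x + y| - 2 |y| = 2 max 0 (x - |y|): the far
  field cancels and only the mass in |y| < x remains.\<close>

lemma planar_potential_formula:
  fixes U0 \<rho>0 :: "real \<Rightarrow> real"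
  assumes U_int: "\<And>x. integrable lborel (\<lambda>y. \<bar>x - y\<bar> * \<rho>0 y)"
    and U_def: "\<And>x. U0 x = 2 * pi * (LINT y|lborel. \<bar>x - y\<bar> * \<rho>0 y)"
    and rho_even: "\<And>x. \<rho>0 (- x) = \<rho>0 x"
    and x: "0 \<le> x"
  shows "U0 x - U0 0 = 4 * pi * (LINT y:{0..x}|lborel. (x - y) * \<rho>0 y)"
proof -
  have refl: "(LINT y|lborel. \<bar>x - y\<bar> * \<rho>0 y) = (LINT y|lborel. \<bar>x + y\<bar> * \<rho>0 y)"
    using lborel_integral_real_affine[of "-1" "\<lambda>y. \<bar>x - y\<bar> * \<rho>0 y" 0] by (simp add: rho_even)
  have i2: "integrable lborel (\<lambda>y. \<bar>x + y\<bar> * \<rho>0 y)"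
    using lborel_integrable_real_affine_iff[of "-1" "\<lambda>y. \<bar>x - y\<bar> * \<rho>0 y" 0] U_int[of x] by (simp add: rho_even)
  have i0: "integrable lborel (\<lambda>y. \<bar>y\<bar> * \<rho>0 y)" using U_int[of 0] by simp
  let ?m = "\<lambda>y. max 0 (x - \<bar>y\<bar>) * \<rho>0 y"
  have pt: "?m y = (\<bar>x - y\<bar> * \<rho>0 y + \<bar>x + y\<bar> * \<rho>0 y - 2 * (\<bar>y\<bar> * \<rho>0 y)) / 2" for y
  proof -
    have "2 * max 0 (x - \<bar>y\<bar>) = \<bar>x - y\<bar> + \<bar>x + y\<bar> - 2 * \<bar>y\<bar>"
      using x by (auto simp: max_def abs_if)
    then have "2 * max 0 (x - \<bar>y\<bar>) * \<rho>0 y = (\<bar>x - y\<bar> + \<bar>x + y\<bar> - 2 * \<bar>y\<bar>) * \<rho>0 y" by simp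
    then show ?thesis by (simp add: algebra_simps)
  qed
  have mi: "integrable lborel ?m"
    unfolding pt by (intro integrable_divide Bochner_Integration.integrable_diff Bochner_Integration.integrable_add
        integrable_mult_right U_int i2 i0)
  have "(LINT y|lborel. ?m y) = ((LINT y|lborel. \<bar>x - y\<bar> * \<rho>0 y) + (LINT y|lborel. \<bar>x + y\<bar> * \<rho>0 y)
      - 2 * (LINT y|lborel. \<bar>y\<bar> * \<rho>0 y)) / 2"
    unfolding pt
    by (simp add: Bochner_Integration.integral_diff Bochner_Integration.integral_add U_int i2 i0)
  also have "\<dots> = (LINT y|lborel. \<bar>x - y\<bar> * \<rho>0 y) - (LINT y|lborel. \<bar>y\<bar> * \<rho>0 y)"
    unfolding refl by simp
  finally have "U0 x - U0 0 = 2 * pi * (LINT y|lborel. ?m y)"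
    unfolding U_def by (simp add: right_diff_distrib)
  also have "(LINT y|lborel. ?m y) = 2 * (LINT y:{0<..}|lborel. ?m y)"
    by (rule lebesgue_integral_even[OF mi]) (simp add: rho_even)
  also have "(LINT y:{0<..}|lborel. ?m y) = (LINT y:{0..x}|lborel. (x - y) * \<rho>0 y)"
    unfolding set_lebesgue_integral_def
  proof (rule integral_cong_AE)
    have [measurable]: "?m \<in> borel_measurable lborel" using mi by auto
    show "(\<lambda>y. indicator {0<..} y *\<^sub>R ?m y) \<in> borel_measurable lborel" by measurable
    have "(\<lambda>y. indicator {0..x} y *\<^sub>R ((x - y) * \<rho>0 y)) = (\<lambda>y. indicator {0..x} y *\<^sub>R ?m y)"
      by (auto simp: indicator_def)
    also have "\<dots> \<in> borel_measurable lborel" by measurable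
    finally show "(\<lambda>y. indicator {0..x} y *\<^sub>R ((x - y) * \<rho>0 y)) \<in> borel_measurable lborel" .
    have "AE y in lborel. y \<noteq> (0::real)" by (rule AE_lborel_singleton)
    then show "AE y in lborel. indicator {0<..} y *\<^sub>R ?m y = indicator {0..x} y *\<^sub>R ((x - y) * \<rho>0 y)"
      by eventually_elim (auto simp: indicator_def max_def)
  qed
  finally show ?thesis by simp
qed

lemma interval_primitive_deriv:
  fixes f :: "real \<Rightarrow> real"
  assumes "continuous_on UNIV f"
  shows "((\<lambda>u. LBINT y=0..u. f y) has_real_derivative f x) (at x)"
proof -
  let ?a = "- \<bar>x\<bar> - 1" and ?b = "\<bar>x\<bar> + 1"
  have "((\<lambda>u. LBINT y=0..u. f y) has_vector_derivative f x) (at x within {?a..?b})"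
    using interval_integral_FTC2[of ?a 0 ?b f x] continuous_on_subset[OF assms] by (simp add: zero_ereal_def)
  then show ?thesis
    by (simp add: has_real_derivative_iff_has_vector_derivative at_within_Icc_at)
qed

text \<open>With \<open>m\<close> and \<open>n\<close> the primitives of \<rho>0 and y \<rho>0, the
  potential is a constant plus 4 pi (x m - n), whose derivative is 4 pi m. Interval integrals define
  both primitives for either sign of x, and evenness carries the formula to x < 0.\<close>

lemma planar_potential_regular:
  fixes U0 \<rho>0 :: "real \<Rightarrow> real"
  assumes U_int: "\<And>x. integrable lborel (\<lambda>y. \<bar>x - y\<bar> * \<rho>0 y)"
    and U_def: "\<And>x. U0 x = 2 * pi * (LINT y|lborel. \<bar>x - y\<bar> * \<rho>0 y)"
    and U_even: "\<And>x. U0 (- x) = U0 x"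
    and rho_even: "\<And>x. \<rho>0 (- x) = \<rho>0 x"
    and rho_cont: "continuous_on UNIV \<rho>0"
  shows "\<exists>U'. (\<forall>x. (U0 has_real_derivative U' x) (at x)) \<and> (\<forall>x. (U' has_real_derivative 4 * pi * \<rho>0 x) (at x))"
proof -
  define m where "m x = (LBINT y=0..x. \<rho>0 y)" for x :: real
  define n where "n x = (LBINT y=0..x. y * \<rho>0 y)" for x :: real
  have dm: "(m has_real_derivative \<rho>0 x) (at x)" for x
    unfolding m_def[abs_def] by (rule interval_primitive_deriv[OF rho_cont])
  have dn: "(n has_real_derivative x * \<rho>0 x) (at x)" for x
    unfolding n_def[abs_def] by (rule interval_primitive_deriv) (intro continuous_intros rho_cont)
  have m0: "m 0 = 0" "n 0 = 0" by (simp_all add: m_def n_def zero_ereal_def)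
  have odd: "m (- x) = - m x" for x
  proof -
    have "((\<lambda>x. m x + m (- x)) has_real_derivative \<rho>0 x + \<rho>0 (- x) * - 1) (at x)" for x
      by (intro DERIV_add dm DERIV_chain2[OF dm] DERIV_minus DERIV_ident)
    then have "\<forall>x. ((\<lambda>x. m x + m (- x)) has_real_derivative 0) (at x)" by (simp add: rho_even)
    from DERIV_isconst_all[OF this, of x 0] show ?thesis by (simp add: m0)
  qed
  define H where "H x = x * m x - n x" for x
  have dH: "(H has_real_derivative m x) (at x)" for x
  proof -
    have "(H has_real_derivative (1 * m x + \<rho>0 x * x) - x * \<rho>0 x) (at x)"
      unfolding H_def[abs_def] by (intro DERIV_diff DERIV_mult DERIV_ident dm dn)
    then show ?thesis by (simp add: mult.commute)
  qed
  have even: "H (- x) = H x" for x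
  proof -
    have "((\<lambda>x. H (- x) - H x) has_real_derivative m (- x) * - 1 - m x) (at x)" for x
      by (intro DERIV_diff dH DERIV_chain2[OF dH] DERIV_minus DERIV_ident)
    then have "\<forall>x. ((\<lambda>x. H (- x) - H x) has_real_derivative 0) (at x)" by (simp add: odd)
    from DERIV_isconst_all[OF this, of x 0] show ?thesis by simp
  qed
  have pos: "U0 x = U0 0 + 4 * pi * H x" if x: "0 \<le> x" for x
  proof -
    have c: "continuous_on {0..x} \<rho>0" by (rule continuous_on_subset[OF rho_cont]) simp
    have i: "set_integrable lborel {0..x} \<rho>0" "set_integrable lborel {0..x} (\<lambda>y. y * \<rho>0 y)"
      by (intro borel_integrable_atLeastAtMost' continuous_intros c)+
    have "(LINT y:{0..x}|lborel. (x - y) * \<rho>0 y) = (LINT y:{0..x}|lborel. x * \<rho>0 y - y * \<rho>0 y)"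
      by (simp add: left_diff_distrib)
    also have "\<dots> = x * (LINT y:{0..x}|lborel. \<rho>0 y) - (LINT y:{0..x}|lborel. y * \<rho>0 y)"
      using i by (simp add: set_integral_diff)
    also have "\<dots> = H x"
      unfolding H_def m_def n_def using x by (simp add: interval_integral_Icc zero_ereal_def)
    finally show ?thesis
      using planar_potential_formula[OF U_int U_def rho_even x] by simp
  qed
  have "U0 x = U0 0 + 4 * pi * H x" for x
    using pos[of x] pos[of "- x"] U_even[of x] even[of x] by (cases "0 \<le> x") auto
  then have U0: "U0 = (\<lambda>x. U0 0 + 4 * pi * H x)" by (rule ext)
  have "((\<lambda>x. U0 0 + 4 * pi * H x) has_real_derivative 0 + 4 * pi * m x) (at x)" for x
    by (intro DERIV_add DERIV_const DERIV_cmult dH)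
  then have "(U0 has_real_derivative 4 * pi * m x) (at x)" for x by (subst U0) simp
  moreover have "((\<lambda>x. 4 * pi * m x) has_real_derivative 4 * pi * \<rho>0 x) (at x)" for x
    by (intro DERIV_cmult dm)
  ultimately show ?thesis by (intro exI[of _ "\<lambda>x. 4 * pi * m x"] conjI allI)
qed

theorem theorem8p12:
  fixes \<alpha> :: "real \<Rightarrow> real" and \<beta> :: "real \<times> real \<Rightarrow> real"
    and U0 \<rho>0 :: "real \<Rightarrow> real" and R0 E0 :: real
  assumes alpha_choice:
      "(\<exists>k::real. 1/2 < k \<and> k \<le> 1 \<and> \<alpha> = (\<lambda>E. if E < E0 then (E0 - E) powr k else 0))
       \<or> \<alpha> = (\<lambda>E. max (exp (E0 - E) - 1) 0)"
    and beta_cont: "continuous_on UNIV \<beta>"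
    and beta_nonneg: "\<And>w. \<beta> w \<ge> 0"
    and beta_supp: "compact (closure {w. \<beta> w \<noteq> 0})"
    and beta_int: "integrable lborel \<beta>" "(LINT w|lborel. \<beta> w) = 1"
    and f0_int: "\<And>x. integrable lborel (\<lambda>v. fzero \<alpha> \<beta> U0 (x, v))"
    and rho_def: "\<And>x. \<rho>0 x = (LINT v|lborel. fzero \<alpha> \<beta> U0 (x, v))"
    and U_int: "\<And>x. integrable lborel (\<lambda>y. \<bar>x - y\<bar> * \<rho>0 y)"
    and U_def: "\<And>x. U0 x = 2 * pi * (LINT y|lborel. \<bar>x - y\<bar> * \<rho>0 y)"
    and U_even: "\<And>x. U0 (-x) = U0 x"
    and rho_even: "\<And>x. \<rho>0 (-x) = \<rho>0 x"
    and R0_pos: "0 < R0"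
    and rho_supp: "closure {x. \<rho>0 x \<noteq> 0} = {-R0..R0}"
    and U_convex: "convex_on {0..} U0"
    and U_incr: "strict_mono_on {0..} U0"
    and E0_def: "E0 = U0 R0"
  shows "\<exists>lam::real. 0 < lam \<and> lam < 16 * pi^2 / (Tper U0 E0)^2 \<and>
           (\<exists>g \<mu>1 \<mu>2.
              g \<in> Hbar_odd \<alpha> \<beta> U0 \<and>
              \<mu>1 \<in> Hbar \<alpha> \<beta> U0 \<and> weakD \<alpha> \<beta> U0 g \<mu>1 \<and>
              \<mu>2 \<in> Hbar \<alpha> \<beta> U0 \<and> weakD \<alpha> \<beta> U0 \<mu>1 \<mu>2 \<and>
              \<not> (AE z in lborel. z \<in> Omega0 \<alpha> \<beta> U0 \<longrightarrow> g z = 0) \<and>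
              (AE z in lborel. z \<in> Omega0 \<alpha> \<beta> U0 \<longrightarrow>
                 - \<mu>2 z - Bbar \<alpha> \<beta> U0 g z = lam * g z))"
proof -
  obtain A where pr: "profile \<alpha> E0 A"
    using alpha_choice
  proof
    assume "\<exists>k::real. 1/2 < k \<and> k \<le> 1 \<and> \<alpha> = (\<lambda>E. if E < E0 then (E0 - E) powr k else 0)"
    then obtain k :: real where k': "1/2 < k" "k \<le> 1" and a: "\<alpha> = (\<lambda>E. if E < E0 then (E0 - E) powr k else 0)"
      by blast
    have k: "0 < k" "k \<le> 1" using k' by auto
    show thesis by (rule that) (unfold a, rule profile_polytrope[OF k])
  next
    assume a: "\<alpha> = (\<lambda>E. max (exp (E0 - E) - 1) 0)"
    show thesis by (rule that) (unfold a, rule profile_king)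
  qed
  have mono: "U0 x \<le> U0 y" if "0 \<le> x" "x \<le> y" for x y
    using strict_mono_onD[OF U_incr, of x y] that by (cases "x = y") auto
  have Umin: "U0 0 \<le> U0 x" for x
    using mono[of 0 "\<bar>x\<bar>"] U_even[of x] by (cases "0 \<le> x") auto
  have U0R: "U0 0 < E0" using strict_mono_onD[OF U_incr, of 0 R0] R0_pos by (simp add: E0_def)
  then obtain A0 where A0: "0 < A0" "\<And>E. U0 0 \<le> E \<Longrightarrow> E < E0 \<Longrightarrow> A0 \<le> A E"
    using pr unfolding profile_def by blast
  have alpha_mono: "E \<le> E' \<Longrightarrow> \<alpha> E' \<le> \<alpha> E" for E E' using pr unfolding profile_def by blast
  have alpha_cont: "continuous_on UNIV \<alpha>" using pr unfolding profile_def by blast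
  have alpha_nonneg: "0 \<le> \<alpha> E" for E
    using alpha_mono[of E "max E E0"] pr unfolding profile_def by (simp add: le_max_iff_disj)
  note ai = profile_integrable[OF pr]
  have rho_eq: "\<rho>0 x = (LINT v|lborel. \<alpha> (v\<^sup>2 / 2 + U0 x))" for x
  proof -
    have "\<rho>0 x = (LINT v|(lborel \<Otimes>\<^sub>M lborel). \<alpha> ((fst v)\<^sup>2 / 2 + U0 x) * \<beta> (snd v))"
      unfolding rho_def lborel_prod by (simp add: fzero_def energy_def case_prod_beta)
    also have "\<dots> = (LINT v|lborel. \<alpha> (v\<^sup>2 / 2 + U0 x)) * (LINT u|lborel. \<beta> u)"
      by (rule lborel_pair.integral_times[OF ai beta_int(1)])
    finally show ?thesis by (simp add: beta_int(2))
  qed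
  have rho_nonneg: "0 \<le> \<rho>0 x" for x unfolding rho_eq using alpha_nonneg by simp
  have rho_antimono: "\<rho>0 y \<le> \<rho>0 x" if "0 \<le> x" "x \<le> y" for x y
    unfolding rho_eq using mono[OF that] by (intro integral_mono ai alpha_mono) simp
  \<comment> \<open>A zero at x < R0 would persist for all larger |y| by monotonicity, and the
    support would lie in [-x, x].\<close>
  have rho_pos: "0 < \<rho>0 x" if x: "0 \<le> x" "x < R0" for x
  proof (rule ccontr)
    assume "\<not> 0 < \<rho>0 x"
    then have "\<rho>0 y = 0" if "x < \<bar>y\<bar>" for y
    proof -
      have "\<rho>0 \<bar>y\<bar> = 0"
        using rho_antimono[of x "\<bar>y\<bar>"] rho_nonneg[of "\<bar>y\<bar>"] x that \<open>\<not> 0 < \<rho>0 x\<close> by linarith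
      then show ?thesis using rho_even[of y] by (cases "0 \<le> y") auto
    qed
    then have "{x. \<rho>0 x \<noteq> 0} \<subseteq> {- x..x}" by (force simp: abs_le_iff not_less[symmetric])
    then have "{- R0..R0} \<subseteq> {- x..x}" unfolding rho_supp[symmetric] by (rule closure_minimal) simp
    then show False using x R0_pos by auto
  qed
  \<comment> \<open>Since |y| + |1 - y| \<ge> 1, the density is recovered and dominated by the
    integrable functions |y| \<rho>0 and |1 - y| \<rho>0.\<close>
  have rho_int: "integrable lborel \<rho>0"
  proof -
    have i0: "integrable lborel (\<lambda>y. \<bar>y\<bar> * \<rho>0 y)" using U_int[of 0] by simp
    have s: "integrable lborel (\<lambda>y. \<bar>y\<bar> * \<rho>0 y + \<bar>1 - y\<bar> * \<rho>0 y)"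
      by (rule Bochner_Integration.integrable_add[OF i0 U_int])
    have eq: "\<rho>0 = (\<lambda>y. (\<bar>y\<bar> * \<rho>0 y + \<bar>1 - y\<bar> * \<rho>0 y) / (\<bar>y\<bar> + \<bar>1 - y\<bar>))"
    proof
      fix y :: real
      have "\<bar>y\<bar> + \<bar>1 - y\<bar> \<noteq> 0" by linarith
      then show "\<rho>0 y = (\<bar>y\<bar> * \<rho>0 y + \<bar>1 - y\<bar> * \<rho>0 y) / (\<bar>y\<bar> + \<bar>1 - y\<bar>)"
        by (simp add: distrib_right[symmetric])
    qed
    have "(\<lambda>y. (\<bar>y\<bar> * \<rho>0 y + \<bar>1 - y\<bar> * \<rho>0 y) / (\<bar>y\<bar> + \<bar>1 - y\<bar>)) \<in> borel_measurable lborel"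
      by (rule borel_measurable_divide) (use s in auto)
    then have meas: "\<rho>0 \<in> borel_measurable lborel" by (subst eq)
    show ?thesis
    proof (rule Bochner_Integration.integrable_bound[OF s meas AE_I2])
      fix y :: real
      have "1 * \<rho>0 y \<le> (\<bar>y\<bar> + \<bar>1 - y\<bar>) * \<rho>0 y" by (intro mult_right_mono rho_nonneg) linarith
      then show "norm (\<rho>0 y) \<le> norm (\<bar>y\<bar> * \<rho>0 y + \<bar>1 - y\<bar> * \<rho>0 y)"
        using rho_nonneg[of y] by (simp add: distrib_right)
    qed
  qed
  \<comment> \<open>Regularity is gained in turns: an integrable density makes U0 Lipschitz,
    continuity of U0 and \<alpha> makes the density continuous, and then U0 is twice
    differentiable.\<close>
  have U_lip: "\<bar>U0 x - U0 x'\<bar> \<le> 2 * pi * (LINT y|lborel. \<rho>0 y) * \<bar>x - x'\<bar>" for x x'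
  proof -
    have "\<bar>(LINT y|lborel. \<bar>x - y\<bar> * \<rho>0 y) - (LINT y|lborel. \<bar>x' - y\<bar> * \<rho>0 y)\<bar>
      = \<bar>LINT y|lborel. \<bar>x - y\<bar> * \<rho>0 y - \<bar>x' - y\<bar> * \<rho>0 y\<bar>"
      by (simp add: Bochner_Integration.integral_diff U_int)
    also have "\<dots> \<le> (LINT y|lborel. \<bar>\<bar>x - y\<bar> * \<rho>0 y - \<bar>x' - y\<bar> * \<rho>0 y\<bar>)"
      by (rule integral_abs_bound)
    also have "\<dots> \<le> (LINT y|lborel. \<bar>x - x'\<bar> * \<rho>0 y)"
    proof (rule integral_mono)
      show "integrable lborel (\<lambda>y. \<bar>\<bar>x - y\<bar> * \<rho>0 y - \<bar>x' - y\<bar> * \<rho>0 y\<bar>)"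
        by (intro integrable_abs Bochner_Integration.integrable_diff U_int)
      show "integrable lborel (\<lambda>y. \<bar>x - x'\<bar> * \<rho>0 y)" by (intro integrable_mult_right rho_int)
      fix y :: real
      have "\<bar>\<bar>x - y\<bar> - \<bar>x' - y\<bar>\<bar> * \<rho>0 y \<le> \<bar>x - x'\<bar> * \<rho>0 y"
        by (intro mult_right_mono rho_nonneg) linarith
      then show "\<bar>\<bar>x - y\<bar> * \<rho>0 y - \<bar>x' - y\<bar> * \<rho>0 y\<bar> \<le> \<bar>x - x'\<bar> * \<rho>0 y"
        using rho_nonneg[of y] by (simp add: left_diff_distrib[symmetric] abs_mult)
    qed
    finally have "\<bar>(LINT y|lborel. \<bar>x - y\<bar> * \<rho>0 y) - (LINT y|lborel. \<bar>x' - y\<bar> * \<rho>0 y)\<bar>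
      \<le> \<bar>x - x'\<bar> * (LINT y|lborel. \<rho>0 y)" by simp
    then have "2 * pi * \<bar>(LINT y|lborel. \<bar>x - y\<bar> * \<rho>0 y) - (LINT y|lborel. \<bar>x' - y\<bar> * \<rho>0 y)\<bar>
      \<le> 2 * pi * (\<bar>x - x'\<bar> * (LINT y|lborel. \<rho>0 y))" by (intro mult_left_mono) auto
    moreover have e: "\<bar>2 * pi * r - 2 * pi * s\<bar> = 2 * pi * \<bar>r - s\<bar>" for r s :: real
      by (simp add: abs_mult flip: right_diff_distrib)
    ultimately show ?thesis unfolding U_def e by (simp only: ac_simps)
  qed
  have U_cont: "continuous_on UNIV U0"
  proof (rule lipschitz_on_continuous_on[of "2 * pi * (LINT y|lborel. \<rho>0 y)"], rule lipschitz_onI)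
    show "dist (U0 x) (U0 y) \<le> 2 * pi * (LINT y|lborel. \<rho>0 y) * dist x y" for x y
      using U_lip[of x y] by (simp add: dist_real_def)
    show "0 \<le> 2 * pi * (LINT y|lborel. \<rho>0 y)" using rho_nonneg by simp
  qed
  have rho_cont: "continuous_on UNIV \<rho>0"
    unfolding continuous_on_sequentially comp_def
  proof (intro ballI allI impI, elim conjE)
    fix x :: real and X assume X: "X \<longlonglongrightarrow> x"
    have UX: "(\<lambda>n. U0 (X n)) \<longlonglongrightarrow> U0 x"
      by (rule continuous_on_tendsto_compose[OF U_cont X]) auto
    show "(\<lambda>n. \<rho>0 (X n)) \<longlonglongrightarrow> \<rho>0 x"
      unfolding rho_eq
    \<comment> \<open>U0 is smallest at 0 and \<alpha> is nonincreasing, so the integrand at x = 0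
      is a majorant.\<close>
    proof (rule integral_dominated_convergence[where w = "\<lambda>v. \<alpha> (v\<^sup>2 / 2 + U0 0)"])
      show "AE v in lborel. (\<lambda>n. \<alpha> (v\<^sup>2 / 2 + U0 (X n))) \<longlonglongrightarrow> \<alpha> (v\<^sup>2 / 2 + U0 x)"
        by (intro AE_I2 continuous_on_tendsto_compose[OF alpha_cont] tendsto_intros UX) auto
      show "AE v in lborel. norm (\<alpha> (v\<^sup>2 / 2 + U0 (X n))) \<le> \<alpha> (v\<^sup>2 / 2 + U0 0)" for n
        using alpha_nonneg Umin[of "X n"] by (intro AE_I2) (simp add: alpha_mono)
    qed (use ai in auto)
  qed
  obtain U' where U': "\<And>x. (U0 has_real_derivative U' x) (at x)" "\<And>x. (U' has_real_derivative 4 * pi * \<rho>0 x) (at x)"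
    using planar_potential_regular[OF U_int U_def U_even rho_even rho_cont] by blast
  interpret planar_phase U0 U' \<rho>0 R0 \<alpha> A A0 \<beta>
  proof unfold_locales
    show "(\<alpha> has_real_derivative - A E) (at E)" if "E < U0 R0" for E
      using pr that unfolding profile_def E0_def by blast
    show "\<alpha> E = 0" if "U0 R0 \<le> E" for E using pr that unfolding profile_def E0_def by blast
    show "A \<in> borel_measurable borel" using pr unfolding profile_def by blast
    show "A0 \<le> A E" if "U0 0 \<le> E" "E < U0 R0" for E using A0(2) that by (simp add: E0_def)
    show "0 < \<alpha> E" if "E < U0 R0" for E using pr that unfolding profile_def E0_def by blast
  qed (fact R0_pos U' U_even rho_cont rho_antimono rho_nonneg rho_pos alpha_cont A0(1) rho_eq
      beta_cont beta_nonneg beta_int)+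
  obtain c g \<mu>1 \<mu>2 where c: "0 < c" "c * quarter R0 < pi"
    and g: "g \<in> Hbar_odd \<alpha> \<beta> U0" "\<mu>1 \<in> Hbar \<alpha> \<beta> U0" "weakD \<alpha> \<beta> U0 g \<mu>1"
      "\<mu>2 \<in> Hbar \<alpha> \<beta> U0" "weakD \<alpha> \<beta> U0 \<mu>1 \<mu>2"
      "\<not> (AE z in lborel. z \<in> Omega0 \<alpha> \<beta> U0 \<longrightarrow> g z = 0)"
      "AE z in lborel. z \<in> Omega0 \<alpha> \<beta> U0 \<longrightarrow> - \<mu>2 z - Bbar \<alpha> \<beta> U0 g z = c\<^sup>2 * g z"
    using eigenvalue_exists by blast
  have L: "0 < quarter R0" by (rule quarter_pos[OF R0_pos order_refl])
  \<comment> \<open>With T(E0) = 4 quarter R0 the condition c quarter R0 < pi is the upper end of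
    the gap for c^2.\<close>
  have "(c * quarter R0)\<^sup>2 < pi\<^sup>2" using c L by (intro power_strict_mono) auto
  then have "c\<^sup>2 < 16 * pi\<^sup>2 / (Tper U0 E0)\<^sup>2"
    unfolding E0_def Tper_quarter using L by (simp add: power_mult_distrib pos_less_divide_eq)
  moreover have "0 < c\<^sup>2" using c(1) by simp
  moreover have "\<exists>g \<mu>1 \<mu>2. g \<in> Hbar_odd \<alpha> \<beta> U0 \<and> \<mu>1 \<in> Hbar \<alpha> \<beta> U0 \<and> weakD \<alpha> \<beta> U0 g \<mu>1 \<and>
      \<mu>2 \<in> Hbar \<alpha> \<beta> U0 \<and> weakD \<alpha> \<beta> U0 \<mu>1 \<mu>2 \<and>
      \<not> (AE z in lborel. z \<in> Omega0 \<alpha> \<beta> U0 \<longrightarrow> g z = 0) \<and>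
      (AE z in lborel. z \<in> Omega0 \<alpha> \<beta> U0 \<longrightarrow> - \<mu>2 z - Bbar \<alpha> \<beta> U0 g z = c\<^sup>2 * g z)"
    by (rule exI[of _ g], rule exI[of _ \<mu>1], rule exI[of _ \<mu>2]) (intro conjI g)
  ultimately show ?thesis by (intro exI[of _ "c\<^sup>2"] conjI)
qed

end
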